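(* Let the standing assumptions on $A$, $Q$, $W^Q$, $X_0$ and $F$ stated in the context hold, and let $n\in\mathbb{N}$. Then the solution $\{X^n(t)\}_{t\ge 0}$ of the spectral Galerkin approximation $$\mathrm{d}X^n(t)=A_nX^n(t)\,\mathrm{d}t+P_nF(X^n(t))\,\mathrm{d}t+P_n\,\mathrm{d}W^Q(t),\quad t>0,\qquad X^n(0)=P_nX_0,$$ is ergodic with a unique invariant measure $\nu^n$.
   Context: Setting. $(H,\langle\cdot,\cdot\rangle,\|\cdot\|)$ is a real separable Hilbert space; $\mathcal{L}(H)$ and $\mathcal{L}_2(H)$ denote bounded linear and Hilbert--Schmidt operators on $H$; $\mathbb{N}=\{1,2,\dots\}$. Assumption on $A$: $A:\mathcal{D}(A)\subset H\to H$ is a densely defined, self-adjoint, negative definite linear operator, not necessarily bounded but with compact inverse. Hence there are an orthonormal basis $\{e_i\}_{i\in\mathbb{N}}$ of $H$ and reals $0<\lambda_1\le\lambda_2\le\cdots\to\infty$ with $-Ae_i=\lambda_ie_i$. Fractional powers $(-A)^\gamma$, $\gamma\in\mathbb{R}$, are defined spectrally; $\dot H^\gamma=\mathcal{D}((-A)^{\gamma/2})$ with norm $\|\varphi\|_\gamma=\|(-A)^{\gamma/2}\varphi\|$. Assumptions on $Q,W^Q,X_0,F$: $\{W^Q(t)\}_{t\ge0}$ is a cylindrical $Q$-Wiener process on a filtered probability space $(\Omega,\mathcal{F},\mathbb{P};\{\mathcal{F}_t\}_{t\ge0})$, where $Q:H\to H$ is a self-adjoint, positive definite bounded linear operator commuting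 with $A$, so that $Qe_i=q_ie_i$ and $W^Q(t)=\sum_{i=1}^\infty\sqrt{q_i}\,\beta_i(t)e_i$ with independent real Brownian motions $\beta_i$; and $\|(-A)^{\frac{\beta-1}{2}}Q^{1/2}\|_{\mathcal{L}_2(H)}<\infty$ for some $\beta\in(0,1]$. The initial value $X_0\in\dot H^{\max(2\beta,1)}$ is deterministic. The map $F:H\to H$ is twice differentiable and satisfies $\langle\varphi_1-\varphi_2,F(\varphi_1)-F(\varphi_2)\rangle\le L_F\|\varphi_1-\varphi_2\|^2$ for all $\varphi_1,\varphi_2\in H$, with $L_F<\lambda_1$; and there are $L>0$, $\delta\in[1,2)$, $\eta\in[0,1)$ with $\|F'(\varphi)\psi\|\le L\|\psi\|$ for $\varphi,\psi\in H$; $\|(-A)^{-\delta/2}F'(\varphi)\psi\|\le L(1+\|\varphi\|_1)\|\psi\|_{-1}$ for $\varphi\in\dot H^1,\psi\in H$; $\|(-A)^{-\eta}F''(\varphi)(\psi_1,\psi_2)\|\le L\|\psi_1\|\|\psi_2\|$ for $\varphi,\psi_1,\psi_2\in H$. Galerkin notation: $H_n=\mathrm{span}\{e_1,\dots,e_n\}$, $P_n:H\to H_n$ is $P_n\varphi=\sum_{i=1}^n\langle e_i,\varphi\rangle e_i$, and $A_n=AP_n:H_n\to H_n$. Ergodicity: for $x\in H_n$ let $X^n(t,x)$ be the solution with $X^n(0)=x$ and $P_t\Phi(x)=\mathbb{E}[\Phi(X^n(t,x))]$ for bounded Borel $\Phi:H_n\to\mathbb{R}$. A probability measure $\mu$ on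 $(H_n,\mathcal{B}(H_n))$ is invariant if $\int_{H_n} P_t\Phi\,\mathrm{d}\mu=\int_{H_n}\Phi\,\mathrm{d}\mu$ for all bounded Borel $\Phi$ and $t\ge0$. The process is called ergodic (with invariant probability measure $\mu$) if $\lim_{T\to\infty}\frac1T\int_0^TP_t\Phi\,\mathrm{d}t=\int_{H_n}\Phi\,\mathrm{d}\mu$ in $L^2(H_n,\mu)$ for all $\Phi\in L^2(H_n,\mu)$. *)

theory Defs
  imports "HOL-Probability.Probability"
begin

section \<open>The linear operator\<close>

text \<open>An unbounded operator is a pair of its domain \<open>D\<close> and a total function \<open>A\<close> whose values
  outside \<open>D\<close> are irrelevant.\<close>

definition linear_on_domain ::
  "'h::real_vector set \<Rightarrow> ('h \<Rightarrow> 'h) \<Rightarrow> bool" where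
  "linear_on_domain D A \<longleftrightarrow> subspace D \<and>
     (\<forall>x\<in>D. \<forall>y\<in>D. A (x + y) = A x + A y) \<and> (\<forall>c. \<forall>x\<in>D. A (c *\<^sub>R x) = c *\<^sub>R A x)"

definition densely_defined :: "'h::real_normed_vector set \<Rightarrow> bool" where
  "densely_defined D \<longleftrightarrow> closure D = UNIV"

text \<open>For densely defined \<open>A\<close>, the left-hand side says that \<open>(y, z)\<close> belongs to the graph of the
  adjoint of \<open>A\<close>; so this is equality of \<open>A\<close> and its adjoint, domains included.\<close>

definition self_adjoint_on :: "'h::real_inner set \<Rightarrow> ('h \<Rightarrow> 'h) \<Rightarrow> bool" where
  "self_adjoint_on D A \<longleftrightarrow>
     (\<forall>y z. (\<forall>x\<in>D. A x \<bullet> y = x \<bullet> z) \<longleftrightarrow> (y \<in> D \<and> z = A y))"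

definition negative_definite_on :: "'h::real_inner set \<Rightarrow> ('h \<Rightarrow> 'h) \<Rightarrow> bool" where
  "negative_definite_on D A \<longleftrightarrow> (\<forall>x\<in>D. x \<noteq> 0 \<longrightarrow> A x \<bullet> x < 0)"

definition has_compact_inverse ::
  "'h::real_normed_vector set \<Rightarrow> ('h \<Rightarrow> 'h) \<Rightarrow> bool" where
  "has_compact_inverse D A \<longleftrightarrow> bij_betw A D UNIV \<and>
     (\<forall>S. bounded S \<longrightarrow> compact (closure (inv_into D A ` S)))"

definition orthonormal_basis :: "(nat \<Rightarrow> 'h::real_inner) \<Rightarrow> bool" where
  "orthonormal_basis e \<longleftrightarrow>
     (\<forall>i j. e i \<bullet> e j = (if i = j then 1 else 0)) \<and> closure (span (range e)) = UNIV"

text \<open>Indices start at 0: \<open>e i\<close> and \<open>lam i\<close> stand for \<open>e\<^sub>i\<^sub>+\<^sub>1\<close> and \<open>\<lambda>\<^sub>i\<^sub>+\<^sub>1\<close>; in particular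
  \<open>lam 0\<close> is the smallest eigenvalue \<open>\<lambda>\<^sub>1\<close>.\<close>

definition spectral_basis ::
  "'h::real_inner set \<Rightarrow> ('h \<Rightarrow> 'h) \<Rightarrow> (nat \<Rightarrow> 'h) \<Rightarrow> (nat \<Rightarrow> real) \<Rightarrow> bool" where
  "spectral_basis D A e lam \<longleftrightarrow> orthonormal_basis e \<and>
     (\<forall>i. e i \<in> D \<and> - A (e i) = lam i *\<^sub>R e i) \<and>
     0 < lam 0 \<and> mono lam \<and> filterlim lam at_top sequentially"

definition diag_dom :: "(nat \<Rightarrow> 'h::real_inner) \<Rightarrow> (nat \<Rightarrow> real) \<Rightarrow> 'h set" where
  "diag_dom e c = {x. summable (\<lambda>i. (c i * (e i \<bullet> x))\<^sup>2)}"

definition diag_op :: "(nat \<Rightarrow> 'h::real_inner) \<Rightarrow> (nat \<Rightarrow> real) \<Rightarrow> 'h \<Rightarrow> 'h" where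
  "diag_op e c x = (\<Sum>i. (c i * (e i \<bullet> x)) *\<^sub>R e i)"

text \<open>\<open>frac_pow e lam \<gamma>\<close> is the fractional power \<open>(-A)\<^sup>\<gamma>\<close>, meaningful on \<open>frac_dom e lam \<gamma>\<close>,
  which is all of the space when \<open>\<gamma> \<le> 0\<close>.\<close>

definition frac_dom :: "(nat \<Rightarrow> 'h::real_inner) \<Rightarrow> (nat \<Rightarrow> real) \<Rightarrow> real \<Rightarrow> 'h set" where
  "frac_dom e lam \<gamma> = diag_dom e (\<lambda>i. lam i powr \<gamma>)"

definition frac_pow :: "(nat \<Rightarrow> 'h::real_inner) \<Rightarrow> (nat \<Rightarrow> real) \<Rightarrow> real \<Rightarrow> 'h \<Rightarrow> 'h" where
  "frac_pow e lam \<gamma> = diag_op e (\<lambda>i. lam i powr \<gamma>)"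

definition Hdot :: "(nat \<Rightarrow> 'h::real_inner) \<Rightarrow> (nat \<Rightarrow> real) \<Rightarrow> real \<Rightarrow> 'h set" where
  "Hdot e lam \<gamma> = frac_dom e lam (\<gamma> / 2)"

definition Hdot_norm :: "(nat \<Rightarrow> 'h::real_inner) \<Rightarrow> (nat \<Rightarrow> real) \<Rightarrow> real \<Rightarrow> 'h \<Rightarrow> real" where
  "Hdot_norm e lam \<gamma> x = norm (frac_pow e lam (\<gamma> / 2) x)"


section \<open>The covariance operator\<close>

definition covariance_operator ::
  "'h::real_inner set \<Rightarrow> ('h \<Rightarrow> 'h) \<Rightarrow> (nat \<Rightarrow> 'h) \<Rightarrow> ('h \<Rightarrow> 'h) \<Rightarrow> (nat \<Rightarrow> real) \<Rightarrow> bool" where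
  "covariance_operator D A e Q q \<longleftrightarrow>
     bounded_linear Q \<and> (\<forall>x y. Q x \<bullet> y = x \<bullet> Q y) \<and> (\<forall>x. x \<noteq> 0 \<longrightarrow> 0 < Q x \<bullet> x) \<and>
     (\<forall>x\<in>D. Q x \<in> D \<and> A (Q x) = Q (A x)) \<and>
     (\<forall>i. Q (e i) = q i *\<^sub>R e i)"

text \<open>The square root of an operator \<open>Q\<close> with \<open>Q (e i) = q i *\<^sub>R e i\<close>.\<close>

definition sqrt_op :: "(nat \<Rightarrow> 'h::real_inner) \<Rightarrow> (nat \<Rightarrow> real) \<Rightarrow> 'h \<Rightarrow> 'h" where
  "sqrt_op e q = diag_op e (\<lambda>i. sqrt (q i))"

text \<open>Finiteness of the Hilbert--Schmidt norm does not depend on the orthonormal basis \<open>e\<close>.\<close>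

definition hilbert_schmidt :: "(nat \<Rightarrow> 'h::real_inner) \<Rightarrow> ('h \<Rightarrow> 'h) \<Rightarrow> bool" where
  "hilbert_schmidt e T \<longleftrightarrow> bounded_linear T \<and> summable (\<lambda>i. (norm (T (e i)))\<^sup>2)"


section \<open>The noise\<close>

text \<open>Only times \<open>t \<ge> 0\<close> matter; a filtration on \<open>[0, \<infinity>)\<close> extends to all of \<open>\<real>\<close> by its value at 0,
  as required by the index type of the library's locale.\<close>

definition filtered_prob_space :: "'w measure \<Rightarrow> (real \<Rightarrow> 'w measure) \<Rightarrow> bool" where
  "filtered_prob_space M Ft \<longleftrightarrow>
     prob_space M \<and> filtration (space M) Ft \<and> (\<forall>t. subalgebra M (Ft t))"

definition brownian_motion ::
  "'w measure \<Rightarrow> (real \<Rightarrow> 'w measure) \<Rightarrow> (real \<Rightarrow> 'w \<Rightarrow> real) \<Rightarrow> bool" where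
  "brownian_motion M Ft b \<longleftrightarrow>
     (\<forall>t\<ge>0. b t \<in> borel_measurable (Ft t)) \<and>
     (AE w in M. b 0 w = 0) \<and>
     (AE w in M. continuous_on {0..} (\<lambda>t. b t w)) \<and>
     (\<forall>s t. 0 \<le> s \<and> s < t \<longrightarrow>
        distributed M lborel (\<lambda>w. b t w - b s w) (normal_density 0 (sqrt (t - s)))) \<and>
     (\<forall>s t. 0 \<le> s \<and> s < t \<longrightarrow>
        prob_space.indep_set M (sets (Ft s))
          {(\<lambda>w. b t w - b s w) -` U \<inter> space M | U. U \<in> sets borel})"

text \<open>The cylindrical \<open>Q\<close>-Wiener process \<open>\<Sum>i. sqrt (q i) * B i t *\<^sub>R e i\<close> is given by the family
  \<open>B\<close> of Brownian motions, since the series need not converge in the Hilbert space. The processes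
  \<open>B i\<close> (as random elements of the path space) are independent, and, as part of being Wiener with
  respect to the filtration, the increments of the whole family are independent of the past.\<close>

definition cylindrical_wiener ::
  "'w measure \<Rightarrow> (real \<Rightarrow> 'w measure) \<Rightarrow> (nat \<Rightarrow> real \<Rightarrow> 'w \<Rightarrow> real) \<Rightarrow> bool" where
  "cylindrical_wiener M Ft B \<longleftrightarrow>
     (\<forall>i. brownian_motion M Ft (B i)) \<and>
     prob_space.indep_vars M (\<lambda>_. Pi\<^sub>M {0..} (\<lambda>_. borel)) (\<lambda>i w. \<lambda>t\<in>{0..}. B i t w) UNIV \<and>
     (\<forall>s t. 0 \<le> s \<and> s < t \<longrightarrow>
        prob_space.indep_set M (sets (Ft s))
          {(\<lambda>w i. B i t w - B i s w) -` U \<inter> space M | U. U \<in> sets (Pi\<^sub>M UNIV (\<lambda>_. borel))})"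


section \<open>The nonlinearity\<close>

text \<open>\<open>F1\<close> and \<open>F2\<close> are the first and second Frechet derivatives of \<open>F\<close>. The exponent \<open>- 1\<close> in
  \<open>Hdot_norm\<close> is only applied to elements of the Hilbert space itself.\<close>

definition nonlinearity ::
  "(nat \<Rightarrow> 'h::real_inner) \<Rightarrow> (nat \<Rightarrow> real) \<Rightarrow> ('h \<Rightarrow> 'h) \<Rightarrow> ('h \<Rightarrow> 'h \<Rightarrow>\<^sub>L 'h) \<Rightarrow>
   ('h \<Rightarrow> 'h \<Rightarrow>\<^sub>L ('h \<Rightarrow>\<^sub>L 'h)) \<Rightarrow> real \<Rightarrow> real \<Rightarrow> real \<Rightarrow> real \<Rightarrow> bool" where
  "nonlinearity e lam F F1 F2 LF L \<delta> \<eta> \<longleftrightarrow>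
     (\<forall>u. (F has_derivative blinfun_apply (F1 u)) (at u)) \<and>
     (\<forall>u. (F1 has_derivative blinfun_apply (F2 u)) (at u)) \<and>
     (\<forall>u v. (u - v) \<bullet> (F u - F v) \<le> LF * (norm (u - v))\<^sup>2) \<and> LF < lam 0 \<and>
     0 < L \<and> 1 \<le> \<delta> \<and> \<delta> < 2 \<and> 0 \<le> \<eta> \<and> \<eta> < 1 \<and>
     (\<forall>u v. norm (F1 u v) \<le> L * norm v) \<and>
     (\<forall>u\<in>Hdot e lam 1. \<forall>v. norm (frac_pow e lam (- \<delta> / 2) (F1 u v))
        \<le> L * (1 + Hdot_norm e lam 1 u) * Hdot_norm e lam (- 1) v) \<and>
     (\<forall>u v w. norm (frac_pow e lam (- \<eta>) (F2 u v w)) \<le> L * norm v * norm w)"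


section \<open>The spectral Galerkin approximation\<close>

definition galerkin_space :: "(nat \<Rightarrow> 'h::real_inner) \<Rightarrow> nat \<Rightarrow> 'h set" where
  "galerkin_space e n = span (e ` {..<n})"

definition galerkin_proj :: "(nat \<Rightarrow> 'h::real_inner) \<Rightarrow> nat \<Rightarrow> 'h \<Rightarrow> 'h" where
  "galerkin_proj e n x = (\<Sum>i<n. (e i \<bullet> x) *\<^sub>R e i)"

text \<open>The projection to \<open>galerkin_space e n\<close> of the cylindrical \<open>Q\<close>-Wiener process.\<close>

definition galerkin_noise ::
  "(nat \<Rightarrow> 'h::real_inner) \<Rightarrow> (nat \<Rightarrow> real) \<Rightarrow> (nat \<Rightarrow> real \<Rightarrow> 'w \<Rightarrow> real) \<Rightarrow> nat \<Rightarrow>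
   real \<Rightarrow> 'w \<Rightarrow> 'h" where
  "galerkin_noise e q B n t w = (\<Sum>i<n. (sqrt (q i) * B i t w) *\<^sub>R e i)"

definition galerkin_borel ::
  "(nat \<Rightarrow> 'h::real_inner) \<Rightarrow> nat \<Rightarrow> 'h measure" where
  "galerkin_borel e n = restrict_space borel (galerkin_space e n)"

text \<open>The noise is additive, so the equation is its pathwise integral form.\<close>

definition galerkin_solution ::
  "'w measure \<Rightarrow> (real \<Rightarrow> 'w measure) \<Rightarrow> ('h::{real_inner, banach} \<Rightarrow> 'h) \<Rightarrow> (nat \<Rightarrow> 'h) \<Rightarrow>
   (nat \<Rightarrow> real) \<Rightarrow> (nat \<Rightarrow> real \<Rightarrow> 'w \<Rightarrow> real) \<Rightarrow> ('h \<Rightarrow> 'h) \<Rightarrow> nat \<Rightarrow> 'h \<Rightarrow>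
   (real \<Rightarrow> 'w \<Rightarrow> 'h) \<Rightarrow> bool" where
  "galerkin_solution M Ft A e q B F n x X \<longleftrightarrow>
     (\<forall>t\<ge>0. X t \<in> measurable (Ft t) (galerkin_borel e n)) \<and>
     (AE w in M. continuous_on {0..} (\<lambda>t. X t w)) \<and>
     (AE w in M. \<forall>t\<ge>0. X t w = x +
        integral {0..t} (\<lambda>s. A (galerkin_proj e n (X s w)) + galerkin_proj e n (F (X s w))) +
        galerkin_noise e q B n t w)"


section \<open>Invariant measures and ergodicity\<close>

text \<open>In this section \<open>X x t\<close> is the state at time \<open>t\<close> of the process started at \<open>x\<close>, and \<open>S\<close>
  carries the sigma-algebra of the state space.\<close>

definition transition_op ::
  "'w measure \<Rightarrow> ('s \<Rightarrow> real \<Rightarrow> 'w \<Rightarrow> 's) \<Rightarrow> real \<Rightarrow> ('s \<Rightarrow> real) \<Rightarrow> 's \<Rightarrow> real" where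
  "transition_op M X t \<Phi> x = prob_space.expectation M (\<lambda>w. \<Phi> (X x t w))"

definition invariant_measure ::
  "'w measure \<Rightarrow> 's measure \<Rightarrow> ('s \<Rightarrow> real \<Rightarrow> 'w \<Rightarrow> 's) \<Rightarrow> 's measure \<Rightarrow> bool" where
  "invariant_measure M S X \<mu> \<longleftrightarrow> prob_space \<mu> \<and> sets \<mu> = sets S \<and>
     (\<forall>\<Phi> \<in> borel_measurable S. (\<exists>K. \<forall>x\<in>space S. \<bar>\<Phi> x\<bar> \<le> K) \<longrightarrow>
        (\<forall>t\<ge>0. (\<integral>x. transition_op M X t \<Phi> x \<partial>\<mu>) = (\<integral>x. \<Phi> x \<partial>\<mu>)))"

definition L2 :: "'s measure \<Rightarrow> ('s \<Rightarrow> real) set" where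
  "L2 \<mu> = {\<Phi> \<in> borel_measurable \<mu>. integrable \<mu> (\<lambda>x. (\<Phi> x)\<^sup>2)}"

definition time_average ::
  "'w measure \<Rightarrow> ('s \<Rightarrow> real \<Rightarrow> 'w \<Rightarrow> 's) \<Rightarrow> real \<Rightarrow> ('s \<Rightarrow> real) \<Rightarrow> 's \<Rightarrow> real" where
  "time_average M X T \<Phi> x = (1 / T) * (LBINT t:{0..T}. transition_op M X t \<Phi> x)"

text \<open>For unbounded \<open>\<Phi>\<close> in \<open>L2 \<mu>\<close> the first three conditions ensure that the expectations, the
  time averages and the square-integral below are genuine integrals (a Bochner integral of a
  non-integrable function is 0 by convention).\<close>

definition ergodic ::
  "'w measure \<Rightarrow> ('s \<Rightarrow> real \<Rightarrow> 'w \<Rightarrow> 's) \<Rightarrow> 's measure \<Rightarrow> bool" where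
  "ergodic M X \<mu> \<longleftrightarrow> (\<forall>\<Phi> \<in> L2 \<mu>.
     (\<forall>t\<ge>0. AE x in \<mu>. integrable M (\<lambda>w. \<Phi> (X x t w))) \<and>
     (\<forall>T>0. AE x in \<mu>. set_integrable lborel {0..T} (\<lambda>t. transition_op M X t \<Phi> x)) \<and>
     (\<forall>T>0. time_average M X T \<Phi> \<in> L2 \<mu>) \<and>
     ((\<lambda>T. \<integral>x. (time_average M X T \<Phi> x - (\<integral>y. \<Phi> y \<partial>\<mu>))\<^sup>2 \<partial>\<mu>) \<longlongrightarrow> 0) at_top)"

end

theory Submission
  imports Defs
begin

text \<open>The Galerkin equation lives in a finite-dimensional space and its noise is additive, so the
  difference of two solutions driven by the same noise has no noise term. Its drift is one-sided
  Lipschitz with constant \<open>LF - lam 0 < 0\<close>: the linear part contributes at most \<open>- lam 0\<close> and the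
  nonlinearity at most \<open>LF\<close>, because the projection is symmetric. Hence, pathwise, any two solutions
  approach each other at rate \<open>exp (- (lam 0 - LF) t)\<close>. Everything follows from this contraction.

  \<^emph>\<open>Existence.\<close> At time 1 the solutions form a random contraction of the state space. Composing
  independent copies of it with the newest copy innermost gives a sequence that converges
  almost surely, since the \<open>k\<close>-th increment carries the factor \<open>r ^ k\<close> and a first moment is finite.
  The law of the limit is stationary under the time-1 kernel
  (\<open>random_contraction_stationary\<close>).

  \<^emph>\<open>Uniqueness.\<close> For a bounded Lipschitz function \<open>f\<close> the transition operators \<open>P_t f\<close> flatten out,
  so \<open>P_t f x\<close> tends to the integral of \<open>f\<close> against any stationary law (\<open>stationary_mixing\<close>). Two
  stationary laws therefore agree on all such \<open>f\<close> and are equal. Since the kernels commute, the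
  time-1 stationary law is mapped by the time-\<open>t\<close> kernel to a time-1 stationary law, that is to
  itself, and so is invariant at all times.

  \<^emph>\<open>Ergodicity.\<close> For bounded Lipschitz functions the time averages converge by dominated
  convergence. Averaging over time is a contraction of the space of square-integrable functions by
  Jensen's inequality and invariance (\<open>kernel_L2\<close>), and bounded Lipschitz functions are dense in it
  (\<open>bounded_lipschitz_dense_L2\<close>), which gives the general case (\<open>ergodic_if_stationary\<close>).

  \<^emph>\<open>Markov property.\<close> The solutions are arbitrary processes satisfying the integral equation, so the
  semigroup property of their laws has to be derived. The explicit Euler scheme started at the
  solution at time \<open>s\<close> converges pathwise to the solution at time \<open>s + t\<close> (\<open>euler_tendsto\<close>). By
  independence of the increments its expectations are iterates of a one-step operator that does not
  depend on \<open>s\<close>, and passing to the limit gives the Markov property (\<open>sol_markov\<close>). The same scheme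
  and Fatou's lemma bound the first moment (\<open>sol_first_moment\<close>).\<close>


section \<open>Bounded Lipschitz test functions\<close>

definition bounded_lipschitz :: "('a::metric_space \<Rightarrow> real) \<Rightarrow> bool" where
  "bounded_lipschitz f \<longleftrightarrow> bounded (range f) \<and> (\<exists>L. L-lipschitz_on UNIV f)"

lemma bounded_lipschitzI:
  assumes "\<And>x. \<bar>f x\<bar> \<le> b" "\<And>x y. \<bar>f x - f y\<bar> \<le> L * dist x y" "0 \<le> L"
  shows "bounded_lipschitz f"
  unfolding bounded_lipschitz_def bounded_iff lipschitz_on_def dist_real_def using assms by fastforce

lemma bounded_lipschitzE:
  assumes "bounded_lipschitz f"
  obtains b L where "\<And>x. \<bar>f x\<bar> \<le> b" "\<And>x y. \<bar>f x - f y\<bar> \<le> L * dist x y" "0 \<le> L" "0 \<le> b"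
proof -
  from assms obtain b L where b: "\<And>x. \<bar>f x\<bar> \<le> b" and L: "L-lipschitz_on UNIV f"
    unfolding bounded_lipschitz_def bounded_iff by auto
  moreover have "0 \<le> b" using b[of undefined] by linarith
  ultimately show ?thesis
    using that lipschitz_onD[OF L] lipschitz_on_nonneg[OF L] by (auto simp: dist_real_def)
qed

lemma bounded_lipschitz_continuous: "bounded_lipschitz f \<Longrightarrow> continuous_on UNIV f"
  unfolding bounded_lipschitz_def by (auto intro: lipschitz_on_continuous_on)

lemma bounded_lipschitz_borel: "bounded_lipschitz f \<Longrightarrow> f \<in> borel_measurable borel"
  by (intro borel_measurable_continuous_onI bounded_lipschitz_continuous)

lemma bounded_lipschitz_borel_on:
  "bounded_lipschitz f \<Longrightarrow> f \<in> borel_measurable (restrict_space borel C)"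
  by (intro measurable_restrict_space1 bounded_lipschitz_borel)

lemma bounded_lipschitz_integrable:
  assumes "finite_measure \<mu>" "g \<in> \<mu> \<rightarrow>\<^sub>M borel" "bounded_lipschitz f"
  shows "integrable \<mu> (\<lambda>w. f (g w))"
proof -
  obtain b L where "\<And>x. \<bar>f x\<bar> \<le> b" using bounded_lipschitzE[OF assms(3)] by metis
  then show ?thesis
    using finite_measure.integrable_const_bound[OF assms(1), of "\<lambda>w. f (g w)" b]
      measurable_compose[OF assms(2) bounded_lipschitz_borel[OF assms(3)]] by auto
qed

lemma bounded_lipschitz_add:
  assumes "bounded_lipschitz f" "bounded_lipschitz g"
  shows "bounded_lipschitz (\<lambda>x. f x + g x)"
proof -
  obtain b L where 1: "\<And>x. \<bar>f x\<bar> \<le> b" "\<And>x y. \<bar>f x - f y\<bar> \<le> L * dist x y" "0 \<le> L"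
    using bounded_lipschitzE[OF assms(1)] by metis
  obtain b' L' where 2: "\<And>x. \<bar>g x\<bar> \<le> b'" "\<And>x y. \<bar>g x - g y\<bar> \<le> L' * dist x y" "0 \<le> L'"
    using bounded_lipschitzE[OF assms(2)] by metis
  show ?thesis
  proof (rule bounded_lipschitzI[where b = "b + b'" and L = "L + L'"])
    show "\<bar>f x + g x\<bar> \<le> b + b'" for x using 1(1)[of x] 2(1)[of x] by linarith
    show "\<bar>f x + g x - (f y + g y)\<bar> \<le> (L + L') * dist x y" for x y
      using 1(2)[of x y] 2(2)[of x y] by (simp add: distrib_right)
  qed (use 1 2 in auto)
qed

lemma bounded_lipschitz_cmult:
  assumes "bounded_lipschitz f"
  shows "bounded_lipschitz (\<lambda>x. c * f x)"
proof -
  obtain b L where 1: "\<And>x. \<bar>f x\<bar> \<le> b" "\<And>x y. \<bar>f x - f y\<bar> \<le> L * dist x y" "0 \<le> L"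
    using bounded_lipschitzE[OF assms(1)] by metis
  show ?thesis
  proof (rule bounded_lipschitzI[where b = "\<bar>c\<bar> * b" and L = "\<bar>c\<bar> * L"])
    show "\<bar>c * f x\<bar> \<le> \<bar>c\<bar> * b" for x using 1(1)[of x] by (simp add: abs_mult mult_left_mono)
    have "\<bar>c * f x - c * f y\<bar> = \<bar>c\<bar> * \<bar>f x - f y\<bar>" for x y
      by (simp add: abs_mult flip: right_diff_distrib)
    then show "\<bar>c * f x - c * f y\<bar> \<le> \<bar>c\<bar> * L * dist x y" for x y
      using mult_left_mono[OF 1(2)[of x y], of "\<bar>c\<bar>"] by (simp add: mult.assoc)
  qed (use 1 in auto)
qed

lemma bounded_lipschitz_clip:
  assumes "bounded_lipschitz f"
  shows "bounded_lipschitz (\<lambda>x. max (- m) (min m (f x)))"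
proof -
  obtain b L where 1: "\<And>x y. \<bar>f x - f y\<bar> \<le> L * dist x y" "0 \<le> L"
    using bounded_lipschitzE[OF assms(1)] by metis
  show ?thesis
  proof (rule bounded_lipschitzI[where b = "\<bar>m\<bar>" and L = L])
    show "\<bar>max (- m) (min m (f x)) - max (- m) (min m (f y))\<bar> \<le> L * dist x y" for x y
      using 1(1)[of x y] by (auto simp: max_def min_def)
  qed (use 1 in \<open>auto simp: max_def min_def\<close>)
qed

text \<open>These functions decrease to the indicator of a nonempty closed set \<open>K\<close> as \<open>k\<close> grows, which is how test
  functions see measures of closed sets.\<close>

lemma bounded_lipschitz_bump: "bounded_lipschitz (\<lambda>x. max 0 (1 - real k * infdist x K))"
proof (rule bounded_lipschitzI[where b = 1 and L = "real k"])
  show "\<bar>max 0 (1 - real k * infdist x K)\<bar> \<le> 1" for x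
    using infdist_nonneg[of x K] by (auto simp: max_def)
  fix x y
  have "\<bar>infdist x K - infdist y K\<bar> \<le> dist x y"
    using infdist_triangle[of x K y] infdist_triangle[of y K x] by (auto simp: dist_commute)
  then have "\<bar>real k * infdist x K - real k * infdist y K\<bar> \<le> real k * dist x y"
    by (metis abs_mult abs_of_nat mult_left_mono of_nat_0_le_iff right_diff_distrib)
  then show "\<bar>max 0 (1 - real k * infdist x K) - max 0 (1 - real k * infdist y K)\<bar> \<le> real k * dist x y"
    by (auto simp: max_def)
qed auto

lemma integral_bump_tendsto_measure:
  assumes "finite_measure \<mu>" and sets: "sets \<mu> = sets (restrict_space borel C)"
    and K: "closed K" "K \<subseteq> C" "K \<noteq> {}"
  shows "(\<lambda>k. \<integral>x. max 0 (1 - real k * infdist x K) \<partial>\<mu>) \<longlonglongrightarrow> measure \<mu> K"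
proof -
  interpret finite_measure \<mu> by fact
  have meas: "(\<lambda>x. max 0 (1 - real k * infdist x K)) \<in> borel_measurable \<mu>" for k
    using bounded_lipschitz_borel_on[OF bounded_lipschitz_bump, of k K C]
      measurable_cong_sets[OF sets refl] by blast
  have [measurable]: "K \<in> sets \<mu>"
    using K by (auto simp: sets sets_restrict_space image_iff intro!: bexI[of _ K])
  have "(\<lambda>k. \<integral>x. max 0 (1 - real k * infdist x K) \<partial>\<mu>) \<longlonglongrightarrow> (\<integral>x. indicator K x \<partial>\<mu>)"
  proof (rule integral_dominated_convergence[where w = "\<lambda>_. 1"])
    show "AE x in \<mu>. (\<lambda>k. max 0 (1 - real k * infdist x K)) \<longlonglongrightarrow> indicator K x"
    proof (intro always_eventually allI)
      fix x show "(\<lambda>k. max 0 (1 - real k * infdist x K)) \<longlonglongrightarrow> indicator K x"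
      proof (cases "x \<in> K")
        case False
        then have "infdist x K > 0"
          using K in_closed_iff_infdist_zero infdist_nonneg by (metis order_le_less)
        then have "filterlim (\<lambda>k. real k * infdist x K) at_top sequentially"
          by (intro filterlim_at_top_mult_tendsto_pos[OF tendsto_const] filterlim_real_sequentially)
            (auto simp: mult.commute)
        then have "\<forall>\<^sub>F k in sequentially. real k * infdist x K \<ge> 1"
          by (simp add: filterlim_at_top)
        then have "\<forall>\<^sub>F k in sequentially. max 0 (1 - real k * infdist x K) = 0"
          by eventually_elim auto
        then show ?thesis using False by (auto intro!: tendsto_eventually simp: indicator_def)
      qed simp
    qed
    show "AE x in \<mu>. norm (max 0 (1 - real k * infdist x K)) \<le> 1" for k
      using infdist_nonneg[of _ K] by (intro always_eventually) (auto simp: max_def)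
  qed (use meas in auto)
  then show ?thesis by simp
qed

lemma sets_restrict_borel_closed:
  assumes "closed C"
  shows "sets (restrict_space borel C) = sigma_sets C {K. closed K \<and> K \<subseteq> C}"
proof -
  have "sets (restrict_space borel C) = (\<inter>) C ` sigma_sets UNIV (Collect closed)"
    by (simp add: sets_restrict_space borel_eq_closed)
  also have "\<dots> = sigma_sets C ((\<inter>) C ` Collect closed)"
    using assms by (intro sigma_sets_Int) (auto simp: closed_def intro: sigma_sets.Basic)
  also have "(\<inter>) C ` Collect closed = {K. closed K \<and> K \<subseteq> C}"
    using assms by (auto simp: image_iff)
  finally show ?thesis .
qed

text \<open>Test functions determine the measure of every closed subset through the bumps above, and the
  closed subsets are an intersection-stable generator.\<close>

lemma measure_eqI_bounded_lipschitz:
  assumes C: "closed C" and "prob_space \<mu>" "prob_space \<nu>"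
    and sets: "sets \<mu> = sets (restrict_space borel C)" "sets \<nu> = sets (restrict_space borel C)"
    and eq: "\<And>f. bounded_lipschitz f \<Longrightarrow> (\<integral>x. f x \<partial>\<mu>) = (\<integral>x. f x \<partial>\<nu>)"
  shows "\<mu> = \<nu>"
proof -
  interpret \<mu>: prob_space \<mu> by fact
  interpret \<nu>: prob_space \<nu> by fact
  show ?thesis
  proof (rule measure_eqI_generator_eq[where \<Omega> = C and E = "{K. closed K \<and> K \<subseteq> C}" and A = "\<lambda>_. C"])
    fix K assume "K \<in> {K. closed K \<and> K \<subseteq> C}"
    then have K: "closed K" "K \<subseteq> C" by auto
    show "emeasure \<mu> K = emeasure \<nu> K"
    proof (cases "K = {}")
      case False
      note 1 = integral_bump_tendsto_measure[OF \<mu>.finite_measure_axioms sets(1) K False]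
      note 2 = integral_bump_tendsto_measure[OF \<nu>.finite_measure_axioms sets(2) K False]
      have "measure \<mu> K = measure \<nu> K"
        using LIMSEQ_unique[OF 1] 2 eq[OF bounded_lipschitz_bump] by simp
      then show ?thesis by (simp add: \<mu>.emeasure_eq_measure \<nu>.emeasure_eq_measure)
    qed simp
  qed (use C sets sets_restrict_borel_closed[OF C] in \<open>auto simp: Int_stable_def\<close>)
qed

text \<open>Measures of closed sets are limits of integrals of bumps, so measurability of a kernel only has to
  be checked on test functions. For a contracting family their integrals are even continuous.\<close>

lemma kernel_measurableI_bounded_lipschitz:
  assumes C: "closed C"
    and prob: "\<And>a. a \<in> space N \<Longrightarrow> prob_space (K a)"
    and sets: "\<And>a. a \<in> space N \<Longrightarrow> sets (K a) = sets (restrict_space borel C)"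
    and meas: "\<And>f. bounded_lipschitz f \<Longrightarrow> (\<lambda>a. \<integral>x. f x \<partial>K a) \<in> borel_measurable N"
  shows "K \<in> N \<rightarrow>\<^sub>M prob_algebra (restrict_space borel C)"
proof (rule measurable_prob_algebra_generated[where \<Omega> = C and G = "{K. closed K \<and> K \<subseteq> C}"])
  fix A assume "A \<in> {K. closed K \<and> K \<subseteq> C}"
  then have A: "closed A" "A \<subseteq> C" by auto
  have "(\<lambda>a. measure (K a) A) \<in> borel_measurable N"
  proof (cases "A = {}")
    case False
    show ?thesis
    proof (rule borel_measurable_LIMSEQ_real)
      show "(\<lambda>k. \<integral>x. max 0 (1 - real k * infdist x A) \<partial>K a) \<longlonglongrightarrow> measure (K a) A"
        if "a \<in> space N" for a
        using integral_bump_tendsto_measure[OF _ sets[OF that] A False]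
          prob[OF that] by (simp add: prob_space.finite_measure)
    qed (rule meas[OF bounded_lipschitz_bump])
  qed simp
  moreover have "emeasure (K a) A = ennreal (measure (K a) A)" if "a \<in> space N" for a
    using prob[OF that] by (simp add: finite_measure.emeasure_eq_measure prob_space.finite_measure)
  ultimately show "(\<lambda>a. emeasure (K a) A) \<in> borel_measurable N"
    by (simp cong: measurable_cong)
qed (use C sets prob sets_restrict_borel_closed[OF C] in \<open>auto simp: Int_stable_def\<close>)

section \<open>Integration against probability kernels\<close>

text \<open>Integrability under the mixture \<open>\<nu>\<close> passes to almost every kernel measure, by applying
  Tonelli's theorem to \<open>\<bar>f\<bar>\<close>. The identity for the integrals is first obtained for nonnegative \<open>f\<close>.\<close>

lemma kernel_integral_aux:
  fixes f :: "'a \<Rightarrow> real"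
  assumes J: "J \<in> N \<rightarrow>\<^sub>M prob_algebra S" and eq: "N \<bind> J = \<nu>" and sets: "sets \<nu> = sets S"
    and f: "integrable \<nu> f"
  shows "AE p in N. integrable (J p) f" "integrable N (\<lambda>p. \<integral>x. f x \<partial>J p)"
    and "(\<And>x. 0 \<le> f x) \<Longrightarrow> (\<integral>p. (\<integral>x. f x \<partial>J p) \<partial>N) = (\<integral>x. f x \<partial>\<nu>)"
proof -
  note J' = measurable_prob_algebraD[OF J]
  have fS[measurable]: "f \<in> borel_measurable S"
    using f measurable_cong_sets[OF sets refl] by blast
  have setsJ: "sets (J p) = sets S" if "p \<in> space N" for p
    using measurable_space[OF J that] by (auto simp: space_prob_algebra)
  have m: "(\<lambda>p. \<integral>x. f x \<partial>J p) \<in> borel_measurable N"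
    by (rule measurable_compose[OF J' integral_measurable_subprob_algebra[OF fS]])
  have "(\<integral>\<^sup>+p. \<integral>\<^sup>+x. ennreal \<bar>f x\<bar> \<partial>J p \<partial>N) = (\<integral>\<^sup>+x. ennreal \<bar>f x\<bar> \<partial>\<nu>)"
    unfolding eq[symmetric] by (rule nn_integral_bind[symmetric, OF _ J']) measurable
  also have "\<dots> < \<infinity>" using f by (simp add: integrable_iff_bounded)
  finally have fin: "(\<integral>\<^sup>+p. \<integral>\<^sup>+x. ennreal \<bar>f x\<bar> \<partial>J p \<partial>N) < \<infinity>" .
  have m2: "(\<lambda>p. \<integral>\<^sup>+x. ennreal \<bar>f x\<bar> \<partial>J p) \<in> borel_measurable N"
    by (rule measurable_compose[OF J' nn_integral_measurable_subprob_algebra]) measurable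
  have "AE p in N. (\<integral>\<^sup>+x. ennreal \<bar>f x\<bar> \<partial>J p) \<noteq> \<infinity>"
    using fin by (intro nn_integral_PInf_AE m2) auto
  with AE_space show AE: "AE p in N. integrable (J p) f"
  proof eventually_elim
    case (elim p)
    have "f \<in> borel_measurable (J p)"
      using fS measurable_cong_sets[OF setsJ[OF elim(1)] refl] by blast
    then show ?case using elim(2) by (simp add: integrable_iff_bounded top.not_eq_extremum)
  qed
  have "(\<integral>\<^sup>+p. ennreal (norm (\<integral>x. f x \<partial>J p)) \<partial>N) \<le> (\<integral>\<^sup>+p. \<integral>\<^sup>+x. ennreal \<bar>f x\<bar> \<partial>J p \<partial>N)"
  proof (intro nn_integral_mono_AE, use AE in eventually_elim)
    case (elim p)
    then show ?case using integral_norm_bound_ennreal by fastforce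
  qed
  with fin m show i: "integrable N (\<lambda>p. \<integral>x. f x \<partial>J p)"
    by (auto simp: integrable_iff_bounded)
  assume nn: "\<And>x. 0 \<le> f x"
  have "ennreal (\<integral>p. (\<integral>x. f x \<partial>J p) \<partial>N) = (\<integral>\<^sup>+p. ennreal (\<integral>x. f x \<partial>J p) \<partial>N)"
    using i nn by (intro nn_integral_eq_integral[symmetric]) auto
  also have "\<dots> = (\<integral>\<^sup>+p. \<integral>\<^sup>+x. ennreal (f x) \<partial>J p \<partial>N)"
  proof (intro nn_integral_cong_AE, use AE in eventually_elim)
    case (elim p)
    then show ?case using nn by (intro nn_integral_eq_integral[symmetric]) auto
  qed
  also have "\<dots> = (\<integral>\<^sup>+x. ennreal (f x) \<partial>\<nu>)"
    unfolding eq[symmetric] by (rule nn_integral_bind[symmetric, OF _ J']) measurable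
  also have "\<dots> = ennreal (\<integral>x. f x \<partial>\<nu>)"
    using f nn by (intro nn_integral_eq_integral) auto
  finally show "(\<integral>p. (\<integral>x. f x \<partial>J p) \<partial>N) = (\<integral>x. f x \<partial>\<nu>)"
    using nn by (simp add: integral_nonneg_AE)
qed

lemma kernel_integral:
  fixes f :: "'a \<Rightarrow> real"
  assumes J: "J \<in> N \<rightarrow>\<^sub>M prob_algebra S" and eq: "N \<bind> J = \<nu>" and sets: "sets \<nu> = sets S"
    and f: "integrable \<nu> f"
  shows "(\<integral>p. (\<integral>x. f x \<partial>J p) \<partial>N) = (\<integral>x. f x \<partial>\<nu>)"
proof -
  let ?p = "\<lambda>x. max 0 (f x)" and ?n = "\<lambda>x. max 0 (- f x)"
  have p: "integrable \<nu> ?p" and n: "integrable \<nu> ?n" using f by auto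
  note P = kernel_integral_aux[OF J eq sets p] and M = kernel_integral_aux[OF J eq sets n]
  have "(\<integral>p. (\<integral>x. f x \<partial>J p) \<partial>N) = (\<integral>p. (\<integral>x. ?p x \<partial>J p) - (\<integral>x. ?n x \<partial>J p) \<partial>N)"
  proof (rule integral_cong_AE)
    show "AE p in N. (\<integral>x. f x \<partial>J p) = (\<integral>x. ?p x \<partial>J p) - (\<integral>x. ?n x \<partial>J p)"
      using P(1) M(1)
    proof eventually_elim
      case (elim p)
      have "(\<integral>x. f x \<partial>J p) = (\<integral>x. ?p x - ?n x \<partial>J p)"
        by (intro Bochner_Integration.integral_cong refl) auto
      also have "\<dots> = (\<integral>x. ?p x \<partial>J p) - (\<integral>x. ?n x \<partial>J p)"
        by (intro Bochner_Integration.integral_diff elim)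
      finally show ?case .
    qed
  qed (use kernel_integral_aux(2)[OF J eq sets f] P(2) M(2) in auto)
  also have "\<dots> = (\<integral>x. ?p x \<partial>\<nu>) - (\<integral>x. ?n x \<partial>\<nu>)"
    using P(2,3) M(2,3) by simp
  also have "\<dots> = (\<integral>x. f x \<partial>\<nu>)"
    unfolding Bochner_Integration.integral_diff[OF p n, symmetric]
    by (intro Bochner_Integration.integral_cong refl) auto
  finally show ?thesis .
qed

lemma (in prob_space) square_expectation_le:
  fixes f :: "'a \<Rightarrow> real"
  assumes "f \<in> borel_measurable M" "integrable M (\<lambda>x. (f x)\<^sup>2)"
  shows "integrable M f" "(expectation f)\<^sup>2 \<le> expectation (\<lambda>x. (f x)\<^sup>2)"
proof -
  show 1: "integrable M f"
  proof (rule Bochner_Integration.integrable_bound[where f = "\<lambda>x. 1 + (f x)\<^sup>2"])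
    have "\<bar>t\<bar> \<le> 1 + t\<^sup>2" for t :: real
      using zero_le_power2[of "\<bar>t\<bar> - 1"] zero_le_power2[of t] unfolding power2_diff by (simp add: ; linarith)
    then show "AE x in M. norm (f x) \<le> norm (1 + (f x)\<^sup>2)" by auto
  qed (use assms in auto)
  show "(expectation f)\<^sup>2 \<le> expectation (\<lambda>x. (f x)\<^sup>2)"
    using variance_eq[OF 1 assms(2)] variance_positive[of f] by simp
qed

text \<open>A kernel is a contraction from the square-integrable functions of the mixture to those of the
  mixing measure: Jensen's inequality inside, Tonelli's theorem outside. This is what lets statements
  about test functions pass to all square-integrable functions.\<close>

lemma kernel_L2:
  fixes f :: "'a \<Rightarrow> real"
  assumes N: "prob_space N" and \<nu>: "prob_space \<nu>"
    and J: "J \<in> N \<rightarrow>\<^sub>M prob_algebra S" and eq: "N \<bind> J = \<nu>" and sets: "sets \<nu> = sets S"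
    and f: "f \<in> borel_measurable \<nu>" "integrable \<nu> (\<lambda>x. (f x)\<^sup>2)"
  shows "AE p in N. integrable (J p) f" "(\<lambda>p. \<integral>x. f x \<partial>J p) \<in> borel_measurable N"
    "integrable N (\<lambda>p. (\<integral>x. f x \<partial>J p)\<^sup>2)"
    "(\<integral>p. (\<integral>x. f x \<partial>J p)\<^sup>2 \<partial>N) \<le> (\<integral>x. (f x)\<^sup>2 \<partial>\<nu>)"
proof -
  interpret \<nu>: prob_space \<nu> by fact
  have intf: "integrable \<nu> f" using \<nu>.square_expectation_le[OF f] by simp
  note 1 = kernel_integral_aux[OF J eq sets intf]
  note 2 = kernel_integral_aux[OF J eq sets f(2)]
  show "AE p in N. integrable (J p) f" by (rule 1)
  show m: "(\<lambda>p. \<integral>x. f x \<partial>J p) \<in> borel_measurable N" using 1(2) by simp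
  have le: "AE p in N. (\<integral>x. f x \<partial>J p)\<^sup>2 \<le> (\<integral>x. (f x)\<^sup>2 \<partial>J p)"
    using 1(1) 2(1) AE_space
  proof eventually_elim
    case (elim p)
    then interpret prob_space "J p"
      using measurable_space[OF J] by (auto simp: space_prob_algebra)
    show ?case
      by (rule square_expectation_le(2)[OF borel_measurable_integrable[OF elim(1)] elim(2)])
  qed
  show 3: "integrable N (\<lambda>p. (\<integral>x. f x \<partial>J p)\<^sup>2)"
  proof (rule Bochner_Integration.integrable_bound[OF 2(2)])
    show "AE p in N. norm ((\<integral>x. f x \<partial>J p)\<^sup>2) \<le> norm (\<integral>x. (f x)\<^sup>2 \<partial>J p)"
      using le by eventually_elim (simp add: order_trans[OF _ abs_ge_self])
  qed (use m in measurable)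
  show "(\<integral>p. (\<integral>x. f x \<partial>J p)\<^sup>2 \<partial>N) \<le> (\<integral>x. (f x)\<^sup>2 \<partial>\<nu>)"
    using integral_mono_AE[OF 3 2(2) le] 2(3) by simp
qed


section \<open>Density of the test functions in square-integrable functions\<close>

lemma measurable_ident_borel:
  assumes "sets \<mu> = sets (restrict_space borel C)"
  shows "(\<lambda>x. x) \<in> \<mu> \<rightarrow>\<^sub>M borel"
  unfolding measurable_cong_sets[OF assms refl] by (rule measurable_restrict_space1) simp

definition L1_approximable :: "'a::metric_space measure \<Rightarrow> ('a \<Rightarrow> real) \<Rightarrow> bool" where
  "L1_approximable \<mu> f \<longleftrightarrow> (\<forall>\<epsilon>>0. \<exists>g. bounded_lipschitz g \<and> (\<integral>x. \<bar>f x - g x\<bar> \<partial>\<mu>) < \<epsilon>)"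

text \<open>Approximability is closed under limits in mean, so it can be built up from indicators of closed
  sets.\<close>

lemma L1_approximable_closed:
  assumes \<mu>: "finite_measure \<mu>" "sets \<mu> = sets (restrict_space borel C)" and f: "integrable \<mu> f"
    and lim: "\<And>\<epsilon>. \<epsilon> > 0 \<Longrightarrow> \<exists>g. integrable \<mu> g \<and> L1_approximable \<mu> g \<and> (\<integral>x. \<bar>f x - g x\<bar> \<partial>\<mu>) < \<epsilon>"
  shows "L1_approximable \<mu> f"
  unfolding L1_approximable_def
proof (intro allI impI)
  fix \<epsilon> :: real assume "\<epsilon> > 0"
  then obtain g where g: "integrable \<mu> g" "L1_approximable \<mu> g" "(\<integral>x. \<bar>f x - g x\<bar> \<partial>\<mu>) < \<epsilon> / 2"
    using lim[of "\<epsilon> / 2"] by auto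
  then obtain h where h: "bounded_lipschitz h" "(\<integral>x. \<bar>g x - h x\<bar> \<partial>\<mu>) < \<epsilon> / 2"
    using \<open>\<epsilon> > 0\<close> unfolding L1_approximable_def by (meson half_gt_zero)
  have hi: "integrable \<mu> h"
    by (rule bounded_lipschitz_integrable[OF \<mu>(1) measurable_ident_borel[OF \<mu>(2)] h(1)])
  have "(\<integral>x. \<bar>f x - h x\<bar> \<partial>\<mu>) \<le> (\<integral>x. \<bar>f x - g x\<bar> + \<bar>g x - h x\<bar> \<partial>\<mu>)"
    using f g(1) hi by (intro integral_mono) auto
  also have "\<dots> = (\<integral>x. \<bar>f x - g x\<bar> \<partial>\<mu>) + (\<integral>x. \<bar>g x - h x\<bar> \<partial>\<mu>)"
    using f g(1) hi by (intro Bochner_Integration.integral_add) auto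
  also have "\<dots> < \<epsilon>" using g h by simp
  finally show "\<exists>h. bounded_lipschitz h \<and> (\<integral>x. \<bar>f x - h x\<bar> \<partial>\<mu>) < \<epsilon>" using h by auto
qed

text \<open>Bumps approximate indicators of closed sets; inner regularity extends this to all measurable sets,
  and linearity and limits to all integrable functions.\<close>

lemma integrable_L1_approximable:
  fixes C :: "'a::{complete_space, second_countable_topology} set"
  assumes \<mu>: "finite_measure \<mu>" and sets: "sets \<mu> = sets (restrict_space borel C)" and C: "closed C"
    and f: "integrable \<mu> f"
  shows "L1_approximable \<mu> f"
proof -
  interpret finite_measure \<mu> by fact
  have id: "(\<lambda>x. x) \<in> \<mu> \<rightarrow>\<^sub>M borel"
    by (rule measurable_ident_borel[OF sets])
  have space: "space \<mu> = C" using sets_eq_imp_space_eq[OF sets] by (simp add: space_restrict_space)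
  have bl_int: "integrable \<mu> g" if "bounded_lipschitz g" for g
    using bounded_lipschitz_integrable[OF \<mu> id that] by simp
  have closed: "L1_approximable \<mu> (indicator K)" if K: "closed K" "K \<subseteq> C" for K
    unfolding L1_approximable_def
  proof (intro allI impI)
    fix \<epsilon> :: real assume \<epsilon>: "\<epsilon> > 0"
    show "\<exists>g. bounded_lipschitz g \<and> (\<integral>x. \<bar>indicator K x - g x\<bar> \<partial>\<mu>) < \<epsilon>"
    proof (cases "K = {}")
      case True
      have "bounded_lipschitz (\<lambda>x::'a. 0 :: real)"
        by (rule bounded_lipschitzI[where b = 0 and L = 0]) auto
      then show ?thesis using True \<epsilon> by (intro exI[of _ "\<lambda>_. 0"]) auto
    next
      case False
      let ?b = "\<lambda>k x. max 0 (1 - real k * infdist x K)"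
      have Ks: "K \<in> sets \<mu>" using K by (auto simp: sets sets_restrict_space image_iff intro!: bexI[of _ K])
      have "(\<lambda>k. (\<integral>x. ?b k x \<partial>\<mu>) - measure \<mu> K) \<longlonglongrightarrow> measure \<mu> K - measure \<mu> K"
        by (intro tendsto_diff tendsto_const integral_bump_tendsto_measure[OF \<mu> sets K False])
      then have "\<forall>\<^sub>F k in sequentially. (\<integral>x. ?b k x \<partial>\<mu>) - measure \<mu> K < \<epsilon>"
        using \<epsilon> by (intro order_tendstoD(2)) simp_all
      then obtain k where k: "(\<integral>x. ?b k x \<partial>\<mu>) - measure \<mu> K < \<epsilon>"
        by (auto simp: eventually_sequentially)
      have "(\<integral>x. \<bar>indicator K x - ?b k x\<bar> \<partial>\<mu>) = (\<integral>x. ?b k x - indicator K x \<partial>\<mu>)"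
      proof (intro Bochner_Integration.integral_cong refl)
        show "\<bar>indicator K x - ?b k x\<bar> = ?b k x - indicator K x" for x
          by (cases "x \<in> K") auto
      qed
      also have "\<dots> = (\<integral>x. ?b k x \<partial>\<mu>) - measure \<mu> K"
        using Ks by (subst Bochner_Integration.integral_diff)
          (auto intro!: bl_int bounded_lipschitz_bump simp: less_top[symmetric])
      finally show ?thesis using k bounded_lipschitz_bump[of k K] by (intro exI[of _ "?b k"]) simp
    qed
  qed
  have ind: "L1_approximable \<mu> (indicator A)" if A: "A \<in> sets \<mu>" for A
  proof (rule L1_approximable_closed[OF \<mu> sets])
    show "integrable \<mu> (indicator A :: 'a \<Rightarrow> real)" using A by (simp add: less_top[symmetric])
    fix \<epsilon> :: real assume \<epsilon>: "\<epsilon> > 0"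
    \<comment> \<open>Inner regularity holds for measures on the whole space, so \<open>\<mu>\<close> is pushed forward to it.\<close>
    let ?B = "distr \<mu> borel (\<lambda>x. x)"
    have AC: "A \<subseteq> C" and Ab: "A \<in> sets borel"
      using A C by (auto simp: sets sets_restrict_space)
    interpret B: finite_measure ?B by (rule finite_measure_distr[OF id])
    have reg: "emeasure ?B A = (SUP K \<in> {K. K \<subseteq> A \<and> compact K}. emeasure ?B K)"
      by (rule inner_regular) (auto simp: Ab B.emeasure_finite)
    have "\<exists>K. K \<subseteq> A \<and> compact K \<and> measure ?B A < measure ?B K + \<epsilon>"
    proof (rule ccontr)
      assume no: "\<nexists>K. K \<subseteq> A \<and> compact K \<and> measure ?B A < measure ?B K + \<epsilon>"
      then have le: "measure ?B K \<le> measure ?B A - \<epsilon>" if "K \<subseteq> A" "compact K" for K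
        using that by force
      from le[of "{}"] have pos: "0 \<le> measure ?B A - \<epsilon>" by simp
      have "emeasure ?B A \<le> ennreal (measure ?B A - \<epsilon>)"
        unfolding reg by (rule SUP_least) (use le in \<open>auto simp: B.emeasure_eq_measure intro!: ennreal_leI\<close>)
      then show False using \<epsilon> pos by (simp add: B.emeasure_eq_measure ennreal_le_iff)
    qed
    then obtain K where K: "K \<subseteq> A" "compact K" "measure ?B A < measure ?B K + \<epsilon>" by auto
    have KC: "closed K" "K \<subseteq> C" using K AC by (auto intro: compact_imp_closed)
    have Ks: "K \<in> sets \<mu>" using KC by (auto simp: sets sets_restrict_space image_iff intro!: bexI[of _ K])
    have m: "measure ?B A = measure \<mu> A" "measure ?B K = measure \<mu> K"
      using Ab KC AC id by (auto simp: measure_distr space Int_absorb2)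
    have "(\<integral>x. \<bar>indicator A x - indicator K x :: real\<bar> \<partial>\<mu>) = (\<integral>x. indicator A x - indicator K x \<partial>\<mu>)"
      using K(1) by (intro Bochner_Integration.integral_cong refl) (auto simp: indicator_def)
    also have "\<dots> = measure \<mu> A - measure \<mu> K"
      using A Ks by (subst Bochner_Integration.integral_diff) (auto simp: less_top[symmetric])
    finally have "(\<integral>x. \<bar>indicator A x - indicator K x :: real\<bar> \<partial>\<mu>) < \<epsilon>" using K(3) m by simp
    then show "\<exists>g. integrable \<mu> g \<and> L1_approximable \<mu> g \<and> (\<integral>x. \<bar>indicator A x - g x\<bar> \<partial>\<mu>) < \<epsilon>"
      using closed[OF KC] Ks by (intro exI[of _ "indicator K"]) (auto simp: less_top[symmetric])
  qed
  from f show ?thesis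
  proof (induction rule: integrable_induct)
    case (base A c)
    show ?case unfolding L1_approximable_def
    proof (intro allI impI)
      fix \<epsilon> :: real assume \<epsilon>: "\<epsilon> > 0"
      have "\<epsilon> / (\<bar>c\<bar> + 1) > 0" using \<epsilon> by auto
      then obtain g where g: "bounded_lipschitz g" "(\<integral>x. \<bar>indicator A x - g x\<bar> \<partial>\<mu>) < \<epsilon> / (\<bar>c\<bar> + 1)"
        using ind[OF base(1)] unfolding L1_approximable_def by metis
      have "(\<integral>x. \<bar>indicator A x *\<^sub>R c - c * g x\<bar> \<partial>\<mu>) = (\<integral>x. \<bar>c\<bar> * \<bar>indicator A x - g x\<bar> \<partial>\<mu>)"
        by (intro Bochner_Integration.integral_cong refl) (simp add: mult.commute flip: abs_mult right_diff_distrib)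
      also have "\<dots> = \<bar>c\<bar> * (\<integral>x. \<bar>indicator A x - g x\<bar> \<partial>\<mu>)" by simp
      also have "\<dots> \<le> \<bar>c\<bar> * (\<epsilon> / (\<bar>c\<bar> + 1))" using g(2) by (intro mult_left_mono) auto
      also have "\<dots> < \<epsilon>" using \<epsilon> by (simp add: field_simps)
      finally show "\<exists>g. bounded_lipschitz g \<and> (\<integral>x. \<bar>indicator A x *\<^sub>R c - g x\<bar> \<partial>\<mu>) < \<epsilon>"
        using bounded_lipschitz_cmult[OF g(1)] by blast
    qed
  next
    case (add f g)
    show ?case unfolding L1_approximable_def
    proof (intro allI impI)
      fix \<epsilon> :: real assume \<epsilon>: "\<epsilon> > 0"
      obtain u where u: "bounded_lipschitz u" "(\<integral>x. \<bar>f x - u x\<bar> \<partial>\<mu>) < \<epsilon> / 2"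
        using add(3) \<epsilon> unfolding L1_approximable_def by (meson half_gt_zero)
      obtain v where v: "bounded_lipschitz v" "(\<integral>x. \<bar>g x - v x\<bar> \<partial>\<mu>) < \<epsilon> / 2"
        using add(4) \<epsilon> unfolding L1_approximable_def by (meson half_gt_zero)
      have "(\<integral>x. \<bar>f x + g x - (u x + v x)\<bar> \<partial>\<mu>) \<le> (\<integral>x. \<bar>f x - u x\<bar> + \<bar>g x - v x\<bar> \<partial>\<mu>)"
        using add bl_int[OF u(1)] bl_int[OF v(1)] by (intro integral_mono) auto
      also have "\<dots> = (\<integral>x. \<bar>f x - u x\<bar> \<partial>\<mu>) + (\<integral>x. \<bar>g x - v x\<bar> \<partial>\<mu>)"
        using add bl_int[OF u(1)] bl_int[OF v(1)] by (intro Bochner_Integration.integral_add) auto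
      finally show "\<exists>w. bounded_lipschitz w \<and> (\<integral>x. \<bar>f x + g x - w x\<bar> \<partial>\<mu>) < \<epsilon>"
        using u v bounded_lipschitz_add[OF u(1) v(1)] by (intro exI[of _ "\<lambda>x. u x + v x"]) auto
    qed
  next
    case (lim f s)
    show ?case
    proof (rule L1_approximable_closed[OF \<mu> sets lim(4)])
      fix \<epsilon> :: real assume \<epsilon>: "\<epsilon> > 0"
      have "(\<lambda>i. \<integral>x. \<bar>f x - s i x\<bar> \<partial>\<mu>) \<longlonglongrightarrow> (\<integral>x. 0 \<partial>\<mu>)"
      proof (rule integral_dominated_convergence[where w = "\<lambda>x. 3 * \<bar>f x\<bar>"])
        show "AE x in \<mu>. (\<lambda>i. \<bar>f x - s i x\<bar>) \<longlonglongrightarrow> 0"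
          using AE_space
        proof eventually_elim
          case (elim x)
          from tendsto_rabs[OF tendsto_diff[OF tendsto_const[of "f x"] lim(2)[OF elim]]]
          show ?case by simp
        qed
        show "AE x in \<mu>. norm \<bar>f x - s i x\<bar> \<le> 3 * \<bar>f x\<bar>" for i
          using AE_space
        proof eventually_elim
          case (elim x)
          from lim(3)[OF elim, of i] show ?case by simp
        qed
      qed (use lim(1,4) in simp_all)
      then have "\<forall>\<^sub>F i in sequentially. (\<integral>x. \<bar>f x - s i x\<bar> \<partial>\<mu>) < \<epsilon>"
        using \<epsilon> by (intro order_tendstoD(2)) simp_all
      then obtain i where "(\<integral>x. \<bar>f x - s i x\<bar> \<partial>\<mu>) < \<epsilon>" by (auto simp: eventually_sequentially)
      then show "\<exists>g. integrable \<mu> g \<and> L1_approximable \<mu> g \<and> (\<integral>x. \<bar>f x - g x\<bar> \<partial>\<mu>) < \<epsilon>"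
        using lim(1)[of i] lim(5)[of i] by (intro exI[of _ "s i"] conjI)
    qed
  qed
qed

text \<open>Truncation reduces the claim to a function bounded by \<open>m\<close>. Its approximants in mean may be
  truncated at the same level, and then the squared error is at most \<open>2 * m\<close> times the error.\<close>

lemma bounded_lipschitz_dense_L2:
  fixes C :: "'a::{complete_space, second_countable_topology} set"
  assumes \<mu>: "finite_measure \<mu>" and sets: "sets \<mu> = sets (restrict_space borel C)" and C: "closed C"
    and f: "f \<in> borel_measurable \<mu>" "integrable \<mu> (\<lambda>x. (f x)\<^sup>2)" and \<epsilon>: "\<epsilon> > 0"
  obtains g where "bounded_lipschitz g" "integrable \<mu> (\<lambda>x. (f x - g x)\<^sup>2)" "(\<integral>x. (f x - g x)\<^sup>2 \<partial>\<mu>) < \<epsilon>"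
proof -
  interpret finite_measure \<mu> by fact
  define clip :: "nat \<Rightarrow> real \<Rightarrow> real" where "clip m t = max (- real m) (min (real m) t)" for m t
  have clip_meas[measurable]: "clip m \<in> borel_measurable borel" for m
    unfolding clip_def by measurable
  have id: "(\<lambda>x. x) \<in> \<mu> \<rightarrow>\<^sub>M borel"
    by (rule measurable_ident_borel[OF sets])
  note [measurable] = f(1)
  have le: "(f x - clip m (f x))\<^sup>2 \<le> (f x)\<^sup>2" for m x
  proof -
    have "\<bar>f x - clip m (f x)\<bar> \<le> \<bar>f x\<bar>" by (auto simp: clip_def max_def min_def)
    then show ?thesis by (simp only: abs_le_square_iff)
  qed
  have int1: "integrable \<mu> (\<lambda>x. (f x - clip m (f x))\<^sup>2)" for m
    by (rule Bochner_Integration.integrable_bound[OF f(2)]) (use le in auto)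
  have "(\<lambda>m. \<integral>x. (f x - clip m (f x))\<^sup>2 \<partial>\<mu>) \<longlonglongrightarrow> (\<integral>x. 0 \<partial>\<mu>)"
  proof (rule integral_dominated_convergence[OF _ _ f(2)])
    show "AE x in \<mu>. (\<lambda>m. (f x - clip m (f x))\<^sup>2) \<longlonglongrightarrow> 0"
    proof (intro always_eventually allI)
      fix x
      obtain m0 where m0: "\<bar>f x\<bar> \<le> real m0" using real_arch_simple by blast
      have "(f x - clip m (f x))\<^sup>2 = 0" if "m \<ge> m0" for m
        using m0 that by (auto simp: clip_def max_def min_def)
      then show "(\<lambda>m. (f x - clip m (f x))\<^sup>2) \<longlonglongrightarrow> 0"
        by (intro tendsto_eventually) (auto simp: eventually_sequentially)
    qed
  qed (use le in auto)
  then have "\<forall>\<^sub>F m in sequentially. (\<integral>x. (f x - clip m (f x))\<^sup>2 \<partial>\<mu>) < \<epsilon> / 4"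
    using \<epsilon> order_tendstoD(2)[of _ "0" _ "\<epsilon> / 4"] by simp
  then obtain m where m: "(\<integral>x. (f x - clip m (f x))\<^sup>2 \<partial>\<mu>) < \<epsilon> / 4"
    by (auto simp: eventually_sequentially)
  let ?c = "\<lambda>x. clip m (f x)"
  have ci: "integrable \<mu> ?c"
    by (rule integrable_const_bound[where B = "real m"]) (auto simp: clip_def)
  have "\<epsilon> / (8 * real m + 8) > 0" using \<epsilon> by auto
  then obtain h where h: "bounded_lipschitz h" "(\<integral>x. \<bar>?c x - h x\<bar> \<partial>\<mu>) < \<epsilon> / (8 * real m + 8)"
    using integrable_L1_approximable[OF \<mu> sets C ci] unfolding L1_approximable_def by metis
  let ?g = "\<lambda>x. clip m (h x)"
  have g: "bounded_lipschitz ?g" unfolding clip_def by (rule bounded_lipschitz_clip[OF h(1)])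
  have hi: "integrable \<mu> h" and gi: "integrable \<mu> ?g"
    using bounded_lipschitz_integrable[OF \<mu> id h(1)] bounded_lipschitz_integrable[OF \<mu> id g] by auto
  have sq: "(?c x - ?g x)\<^sup>2 \<le> 2 * real m * \<bar>?c x - h x\<bar>" for x
  proof -
    have "\<bar>?c x - ?g x\<bar> \<le> \<bar>?c x - h x\<bar>" "\<bar>?c x - ?g x\<bar> \<le> 2 * real m"
      by (auto simp: clip_def max_def min_def)
    then have "\<bar>?c x - ?g x\<bar> * \<bar>?c x - ?g x\<bar> \<le> (2 * real m) * \<bar>?c x - h x\<bar>"
      by (intro mult_mono) auto
    then show ?thesis by (simp add: power2_eq_square flip: abs_mult)
  qed
  have bd: "(f x - ?g x)\<^sup>2 \<le> 2 * (f x - ?c x)\<^sup>2 + 4 * real m * \<bar>?c x - h x\<bar>" for x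
  proof -
    have "(a + b)\<^sup>2 \<le> 2 * a\<^sup>2 + 2 * b\<^sup>2" for a b :: real
      using zero_le_power2[of "a - b"] unfolding power2_diff power2_sum by linarith
    from this[of "f x - ?c x" "?c x - ?g x"] show ?thesis using sq[of x] by simp
  qed
  have bi: "integrable \<mu> (\<lambda>x. 2 * (f x - ?c x)\<^sup>2 + 4 * real m * \<bar>?c x - h x\<bar>)"
    using int1 ci hi by auto
  have fi: "integrable \<mu> (\<lambda>x. (f x - ?g x)\<^sup>2)"
  proof (rule Bochner_Integration.integrable_bound[OF bi])
    show "AE x in \<mu>. norm ((f x - ?g x)\<^sup>2) \<le> norm (2 * (f x - ?c x)\<^sup>2 + 4 * real m * \<bar>?c x - h x\<bar>)"
      using bd by (intro always_eventually allI) (simp add: order_trans[OF _ abs_ge_self])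
  qed (use borel_measurable_integrable[OF gi] in measurable)
  have "(\<integral>x. (f x - ?g x)\<^sup>2 \<partial>\<mu>) \<le> (\<integral>x. 2 * (f x - ?c x)\<^sup>2 + 4 * real m * \<bar>?c x - h x\<bar> \<partial>\<mu>)"
    by (rule integral_mono[OF fi bi bd])
  also have "\<dots> = 2 * (\<integral>x. (f x - ?c x)\<^sup>2 \<partial>\<mu>) + 4 * real m * (\<integral>x. \<bar>?c x - h x\<bar> \<partial>\<mu>)"
    using int1 ci hi by (subst Bochner_Integration.integral_add) auto
  also have "\<dots> \<le> 2 * (\<integral>x. (f x - ?c x)\<^sup>2 \<partial>\<mu>) + 4 * real m * (\<epsilon> / (8 * real m + 8))"
    using h(2) by (intro add_left_mono mult_left_mono) auto
  also have "\<dots> < 2 * (\<epsilon> / 4) + 4 * real m * (\<epsilon> / (8 * real m + 8))"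
    using m by simp
  also have "4 * real m * (\<epsilon> / (8 * real m + 8)) \<le> \<epsilon> / 2" using \<epsilon> by (simp add: field_simps)
  finally have "(\<integral>x. (f x - ?g x)\<^sup>2 \<partial>\<mu>) < \<epsilon>" by simp
  with g fi show ?thesis using that by blast
qed


section \<open>Stationary laws of random contractions\<close>

lemma Cauchy_if_summable_steps:
  fixes z :: "nat \<Rightarrow> 'a::metric_space"
  assumes step: "\<And>k. dist (z k) (z (Suc k)) \<le> a k" and a: "summable a"
  shows "Cauchy z"
proof (rule metric_CauchyI)
  have 1: "dist (z m) (z n) \<le> (\<Sum>i<n. a i) - (\<Sum>i<m. a i)" if "m \<le> n" for m n
    using that
  proof (induction n rule: dec_induct)
    case (step n)
    then show ?case using dist_triangle[of "z m" "z (Suc n)" "z n"] assms(1)[of n] by simp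
  qed simp
  fix \<epsilon> :: real assume "\<epsilon> > 0"
  have "Cauchy (\<lambda>n. \<Sum>i<n. a i)"
    using a by (simp add: summable_iff_convergent convergent_Cauchy)
  then obtain M where M: "\<And>m n. m \<ge> M \<Longrightarrow> n \<ge> M \<Longrightarrow> dist (\<Sum>i<m. a i) (\<Sum>i<n. a i) < \<epsilon>"
    using metric_CauchyD[OF _ \<open>\<epsilon> > 0\<close>] by metis
  have "dist (z m) (z n) < \<epsilon>" if "m \<ge> M" "n \<ge> M" "m \<le> n" for m n
    using 1[OF that(3)] M[OF that(1,2)] by (simp add: dist_real_def)
  then have "dist (z m) (z n) < \<epsilon>" if "m \<ge> M" "n \<ge> M" for m n
    using that by (metis dist_commute nle_le)
  then show "\<exists>M. \<forall>m\<ge>M. \<forall>n\<ge>M. dist (z m) (z n) < \<epsilon>" by blast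
qed

text \<open>The newest random map is applied first, so that \<open>\<omega> 0\<close> acts last. With this order the iterates
  of contractions converge for almost every \<open>\<omega>\<close>; in the forward order only their laws do.\<close>

primrec backward_iterate :: "('w \<Rightarrow> 's \<Rightarrow> 's) \<Rightarrow> 's \<Rightarrow> nat \<Rightarrow> (nat \<Rightarrow> 'w) \<Rightarrow> 's" where
  "backward_iterate R x 0 \<omega> = x"
| "backward_iterate R x (Suc k) \<omega> = R (\<omega> 0) (backward_iterate R x k (\<lambda>i. \<omega> (Suc i)))"

text \<open>Passing from \<open>k\<close> to \<open>k + 1\<close> changes the starting point of \<open>k\<close> nested contractions, so it moves the
  backward iterate by at most \<open>r ^ k\<close> times the displacement of \<open>x0\<close> under the \<open>k\<close>-th map. The sum of
  these bounds has finite expectation; hence the iterates converge almost surely. Prepending an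
  independent map to the sequence applies this map to the limit and preserves the law of the sequence,
  so the law of the limit is stationary.\<close>

theorem random_contraction_stationary:
  fixes C :: "'s::{complete_space, second_countable_topology} set"
    and M :: "'w measure" and R :: "'w \<Rightarrow> 's \<Rightarrow> 's" and r :: real
  defines "S \<equiv> restrict_space borel C"
  assumes M: "prob_space M" and C: "closed C" and x0: "x0 \<in> C"
    and R[measurable]: "case_prod R \<in> M \<Otimes>\<^sub>M S \<rightarrow>\<^sub>M S"
    and contr: "\<And>w x y. w \<in> space M \<Longrightarrow> x \<in> C \<Longrightarrow> y \<in> C \<Longrightarrow> dist (R w x) (R w y) \<le> r * dist x y"
    and r: "0 \<le> r" "r < 1"
    and mom: "integrable M (\<lambda>w. dist x0 (R w x0))"
  obtains \<nu> where "prob_space \<nu>" "sets \<nu> = sets S" "\<nu> \<bind> (\<lambda>x. distr M S (\<lambda>w. R w x)) = \<nu>"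
proof -
  interpret M: prob_space M by fact
  interpret Q: sequence_space M by unfold_locales
  define N where "N = (\<Pi>\<^sub>M i\<in>(UNIV::nat set). M)"
  interpret N: prob_space N unfolding N_def by (rule prob_space_PiM) (rule M)
  have spS: "space S = C" by (simp add: S_def space_restrict_space)
  have spN: "\<omega> \<in> space N \<longleftrightarrow> (\<forall>i. \<omega> i \<in> space M)" for \<omega> by (auto simp: N_def space_PiM)
  have comp[measurable]: "(\<lambda>\<omega>. \<omega> i) \<in> N \<rightarrow>\<^sub>M M" for i unfolding N_def by measurable
  have shift[measurable]: "(\<lambda>\<omega> i. \<omega> (Suc i)) \<in> N \<rightarrow>\<^sub>M N"
    unfolding N_def by (rule measurable_PiM_single') (auto simp: space_PiM)
  let ?Z = "backward_iterate R x0"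
  have Zm[measurable]: "?Z k \<in> N \<rightarrow>\<^sub>M S" for k
  proof (induction k)
    case 0
    then show ?case using x0 spS by simp
  next
    case (Suc k)
    have [measurable]: "(\<lambda>\<omega>. ?Z k (\<lambda>i. \<omega> (Suc i))) \<in> N \<rightarrow>\<^sub>M S"
      by (rule measurable_compose[OF shift Suc])
    have "(\<lambda>\<omega>. case_prod R (\<omega> 0, ?Z k (\<lambda>i. \<omega> (Suc i)))) \<in> N \<rightarrow>\<^sub>M S"
      by (rule measurable_compose[OF _ R]) measurable
    then show ?case by simp
  qed
  have ZC: "?Z k \<omega> \<in> C" if "\<omega> \<in> space N" for k \<omega>
    using measurable_space[OF Zm that] by (simp add: spS)
  have idS: "(\<lambda>x. x) \<in> S \<rightarrow>\<^sub>M borel"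
    by (rule measurable_ident_borel) (simp add: S_def)
  have step: "dist (?Z k \<omega>) (?Z (Suc k) \<omega>) \<le> r ^ k * dist x0 (R (\<omega> k) x0)" if "\<omega> \<in> space N" for k \<omega>
    using that
  proof (induction k arbitrary: \<omega>)
    case (Suc k)
    let ?\<omega> = "\<lambda>i. \<omega> (Suc i)"
    have \<omega>: "?\<omega> \<in> space N" "\<omega> 0 \<in> space M" using Suc(2) by (auto simp: spN)
    have "dist (?Z (Suc k) \<omega>) (?Z (Suc (Suc k)) \<omega>) \<le> r * dist (?Z k ?\<omega>) (?Z (Suc k) ?\<omega>)"
      using contr[OF \<omega>(2) ZC[OF \<omega>(1)] ZC[OF \<omega>(1)], of k "Suc k"] by simp
    also have "\<dots> \<le> r * (r ^ k * dist x0 (R (?\<omega> k) x0))"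
      by (intro mult_left_mono Suc.IH \<omega> r)
    finally show ?case by (simp add: mult_ac)
  qed simp
  have Rx[measurable]: "(\<lambda>w. R w x) \<in> M \<rightarrow>\<^sub>M S" if "x \<in> C" for x
    using measurable_compose[OF measurable_Pair2'[of x S M] R] that by (simp add: spS)
  have "(\<lambda>w. R w x0) \<in> M \<rightarrow>\<^sub>M borel" by (rule measurable_compose[OF Rx[OF x0] idS])
  then have dm[measurable]: "(\<lambda>w. dist x0 (R w x0)) \<in> M \<rightarrow>\<^sub>M borel" by measurable
  define m where "m = (\<integral>w. dist x0 (R w x0) \<partial>M)"
  have m: "(\<integral>\<^sup>+w. ennreal (dist x0 (R w x0)) \<partial>M) = ennreal m" "0 \<le> m"
    unfolding m_def using mom by (auto intro!: nn_integral_eq_integral)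
  have comp_distr: "distr N M (\<lambda>\<omega>. \<omega> k) = M" for k
    unfolding N_def by (rule distr_PiM_component) (use M in auto)
  have nk: "(\<integral>\<^sup>+\<omega>. ennreal (dist x0 (R (\<omega> k) x0)) \<partial>N) = ennreal m" for k
  proof -
    have "(\<integral>\<^sup>+w. ennreal (dist x0 (R w x0)) \<partial>distr N M (\<lambda>\<omega>. \<omega> k))
        = (\<integral>\<^sup>+\<omega>. ennreal (dist x0 (R (\<omega> k) x0)) \<partial>N)"
      by (rule nn_integral_distr[OF comp]) (unfold measurable_distr_eq1, intro measurable_compose[OF dm measurable_ennreal])
    then show ?thesis unfolding comp_distr m(1) by (rule sym)
  qed
  have dk: "(\<lambda>\<omega>. dist x0 (R (\<omega> k) x0)) \<in> N \<rightarrow>\<^sub>M borel" for k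
    by (rule measurable_compose[OF comp dm])
  have "(\<integral>\<^sup>+\<omega>. (\<Sum>k. ennreal (r ^ k * dist x0 (R (\<omega> k) x0))) \<partial>N)
      = (\<Sum>k. \<integral>\<^sup>+\<omega>. ennreal (r ^ k * dist x0 (R (\<omega> k) x0)) \<partial>N)"
    by (intro nn_integral_suminf) (use dk in measurable)
  also have "\<dots> = (\<Sum>k. ennreal (r ^ k * m))"
  proof (intro suminf_cong)
    fix k
    have "(\<integral>\<^sup>+\<omega>. ennreal (r ^ k * dist x0 (R (\<omega> k) x0)) \<partial>N)
        = (\<integral>\<^sup>+\<omega>. ennreal (r ^ k) * ennreal (dist x0 (R (\<omega> k) x0)) \<partial>N)"
      using r by (intro nn_integral_cong) (simp add: ennreal_mult)
    also have "\<dots> = ennreal (r ^ k) * ennreal m"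
      unfolding nk[of k, symmetric] using dk[of k]
      by (intro nn_integral_cmult) (rule measurable_compose[OF _ measurable_ennreal])
    finally show "(\<integral>\<^sup>+\<omega>. ennreal (r ^ k * dist x0 (R (\<omega> k) x0)) \<partial>N) = ennreal (r ^ k * m)"
      using r m by (simp add: ennreal_mult)
  qed
  also have "\<dots> \<noteq> \<infinity>"
  proof -
    have "summable (\<lambda>k. r ^ k * m)" using r by (intro summable_mult2 summable_geometric) auto
    then have "(\<Sum>k. ennreal (r ^ k * m)) = ennreal (\<Sum>k. r ^ k * m)"
      using r m(2) by (intro suminf_ennreal2) auto
    then show ?thesis by simp
  qed
  finally have fin: "(\<integral>\<^sup>+\<omega>. (\<Sum>k. ennreal (r ^ k * dist x0 (R (\<omega> k) x0))) \<partial>N) \<noteq> \<infinity>" .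
  have "(\<lambda>\<omega>. (\<Sum>k. ennreal (r ^ k * dist x0 (R (\<omega> k) x0)))) \<in> borel_measurable N"
    using dk by measurable
  from nn_integral_PInf_AE[OF this fin]
  have AECauchy: "AE \<omega> in N. Cauchy (\<lambda>k. ?Z k \<omega>)"
    using AE_space
  proof eventually_elim
    case (elim \<omega>)
    have "summable (\<lambda>k. r ^ k * dist x0 (R (\<omega> k) x0))"
      using elim(1) r by (intro summable_suminf_not_top) auto
    then show ?case by (rule Cauchy_if_summable_steps[rotated]) (rule step[OF elim(2)])
  qed
  have Zb[measurable]: "?Z k \<in> N \<rightarrow>\<^sub>M borel" for k by (rule measurable_compose[OF Zm idS])
  \<comment> \<open>The default value \<open>x0\<close> makes the sequence converge for every \<open>\<omega>\<close>.\<close>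
  define Z' where "Z' k \<omega> = (if Cauchy (\<lambda>k. ?Z k \<omega>) then ?Z k \<omega> else x0)" for k \<omega>
  define Zl where "Zl \<omega> = lim (\<lambda>k. Z' k \<omega>)" for \<omega>
  have Z'b[measurable]: "Z' k \<in> N \<rightarrow>\<^sub>M borel" for k unfolding Z'_def by measurable
  have Z'conv: "(\<lambda>k. Z' k \<omega>) \<longlonglongrightarrow> Zl \<omega>" for \<omega>
  proof -
    have "convergent (\<lambda>k. Z' k \<omega>)"
      by (cases "Cauchy (\<lambda>k. ?Z k \<omega>)") (auto simp: Z'_def Cauchy_convergent_iff convergent_const)
    then show ?thesis unfolding Zl_def by (simp add: convergent_LIMSEQ_iff)
  qed
  have ZlC: "Zl \<omega> \<in> C" if "\<omega> \<in> space N" for \<omega>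
    by (rule closed_sequentially[OF C _ Z'conv]) (use ZC[OF that] x0 in \<open>auto simp: Z'_def\<close>)
  have "Zl \<in> N \<rightarrow>\<^sub>M borel" by (rule borel_measurable_LIMSEQ_metric[OF Z'b Z'conv])
  then have Zl[measurable]: "Zl \<in> N \<rightarrow>\<^sub>M S"
    unfolding S_def by (intro measurable_restrict_space2) (use ZlC in auto)
  define \<nu> where "\<nu> = distr N S Zl"
  have \<nu>: "prob_space \<nu>" "sets \<nu> = sets S" unfolding \<nu>_def by (auto intro: N.prob_space_distr)
  define K where "K x = distr M S (\<lambda>w. R w x)" for x
  have K: "K \<in> S \<rightarrow>\<^sub>M subprob_algebra S"
    unfolding K_def
  proof (rule measurable_distr2[where M = M])
    show "(\<lambda>(x, w). R w x) \<in> S \<Otimes>\<^sub>M M \<rightarrow>\<^sub>M S" by measurable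
  qed (simp add: M.M_in_subprob)
  interpret MN: pair_sigma_finite M N by unfold_locales
  have cons[measurable]: "(\<lambda>p. case_nat (fst p) (snd p)) \<in> M \<Otimes>\<^sub>M N \<rightarrow>\<^sub>M N"
    unfolding N_def
    by (rule measurable_PiM_single')
      (auto simp: space_PiM space_pair_measure N_def[symmetric] spN split: nat.split)
  have Niter: "distr (M \<Otimes>\<^sub>M N) N (\<lambda>p. case_nat (fst p) (snd p)) = N"
    using Q.PiM_iter by (simp add: N_def case_prod_unfold)
  have RZ[measurable]: "(\<lambda>p. R (fst p) (Zl (snd p))) \<in> M \<Otimes>\<^sub>M N \<rightarrow>\<^sub>M S" by measurable
  have "AE p in M \<Otimes>\<^sub>M N. Cauchy (\<lambda>k. ?Z k (snd p))"
  proof (rule MN.AE_pair_measure)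
    have [measurable]: "(\<lambda>p. ?Z k (snd p)) \<in> M \<Otimes>\<^sub>M N \<rightarrow>\<^sub>M borel" for k
      by (rule measurable_compose[OF measurable_snd Zb])
    show "{p \<in> space (M \<Otimes>\<^sub>M N). Cauchy (\<lambda>k. ?Z k (snd p))} \<in> sets (M \<Otimes>\<^sub>M N)"
      by measurable
  qed (use AECauchy in simp)
  then have AEeq: "AE p in M \<Otimes>\<^sub>M N. Zl (case_nat (fst p) (snd p)) = R (fst p) (Zl (snd p))"
    using AE_space
  proof eventually_elim
    case (elim p)
    obtain s \<omega> where p: "p = (s, \<omega>)" by (cases p)
    have s: "s \<in> space M" and \<omega>: "\<omega> \<in> space N" using elim(2) by (auto simp: p space_pair_measure)
    have c: "Cauchy (\<lambda>k. ?Z k \<omega>)" using elim(1) by (simp add: p)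
    have lim: "(\<lambda>k. ?Z k \<omega>) \<longlonglongrightarrow> Zl \<omega>" using Z'conv[of \<omega>] c by (simp add: Z'_def)
    have Suc: "?Z (Suc k) (case_nat s \<omega>) = R s (?Z k \<omega>)" for k by simp
    have "(\<lambda>k. dist (R s (?Z k \<omega>)) (R s (Zl \<omega>))) \<longlonglongrightarrow> 0"
    proof (rule tendsto_sandwich[OF _ _ tendsto_const])
      show "(\<lambda>k. r * dist (?Z k \<omega>) (Zl \<omega>)) \<longlonglongrightarrow> 0"
        using tendsto_mult_right_zero[OF lim[unfolded tendsto_dist_iff[of _ "Zl \<omega>"]]] by simp
    qed (auto intro!: always_eventually contr s ZC ZlC \<omega>)
    then have "(\<lambda>k. ?Z (Suc k) (case_nat s \<omega>)) \<longlonglongrightarrow> R s (Zl \<omega>)"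
      unfolding Suc by (subst tendsto_dist_iff)
    then have lim2: "(\<lambda>k. ?Z k (case_nat s \<omega>)) \<longlonglongrightarrow> R s (Zl \<omega>)"
      by (subst (asm) filterlim_sequentially_Suc)
    then have "Cauchy (\<lambda>k. ?Z k (case_nat s \<omega>))" by (rule LIMSEQ_imp_Cauchy)
    then have "(\<lambda>k. ?Z k (case_nat s \<omega>)) \<longlonglongrightarrow> Zl (case_nat s \<omega>)"
      using Z'conv[of "case_nat s \<omega>"] by (simp add: Z'_def)
    with lim2 show ?case by (auto simp: p intro: LIMSEQ_unique)
  qed
  have "\<nu> = distr (distr (M \<Otimes>\<^sub>M N) N (\<lambda>p. case_nat (fst p) (snd p))) S Zl"
    unfolding Niter \<nu>_def ..
  also have "\<dots> = distr (M \<Otimes>\<^sub>M N) S (\<lambda>p. Zl (case_nat (fst p) (snd p)))"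
    by (subst distr_distr) (auto simp: comp_def)
  also have "\<dots> = distr (M \<Otimes>\<^sub>M N) S (\<lambda>p. R (fst p) (Zl (snd p)))"
    by (intro distr_cong_AE AEeq refl) measurable
  finally have \<nu>eq: "\<nu> = distr (M \<Otimes>\<^sub>M N) S (\<lambda>p. R (fst p) (Zl (snd p)))" .
  have "\<nu> \<bind> K = \<nu>"
  proof (rule measure_eqI)
    have ne: "space \<nu> \<noteq> {}" using \<nu>(1) prob_space.not_empty by blast
    have K\<nu>: "K \<in> \<nu> \<rightarrow>\<^sub>M subprob_algebra S" using K \<nu>(2) by (simp cong: measurable_cong_sets)
    show "sets (\<nu> \<bind> K) = sets \<nu>" using ne by (simp add: K_def \<nu>(2))
    fix A assume "A \<in> sets (\<nu> \<bind> K)"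
    then have A[measurable]: "A \<in> sets S" using ne by (simp add: K_def)
    have "emeasure (\<nu> \<bind> K) A = (\<integral>\<^sup>+x. emeasure (K x) A \<partial>\<nu>)"
      by (rule emeasure_bind[OF ne K\<nu> A])
    also have "\<dots> = (\<integral>\<^sup>+\<omega>. emeasure (K (Zl \<omega>)) A \<partial>N)"
      unfolding \<nu>_def
      by (rule nn_integral_distr) (use K A in measurable)
    also have "\<dots> = (\<integral>\<^sup>+\<omega>. \<integral>\<^sup>+s. indicator A (R s (Zl \<omega>)) \<partial>M \<partial>N)"
    proof (rule nn_integral_cong)
      fix \<omega> assume "\<omega> \<in> space N"
      note RZ\<omega> = Rx[OF ZlC[OF this]]
      have "emeasure (K (Zl \<omega>)) A = (\<integral>\<^sup>+y. indicator A y \<partial>K (Zl \<omega>))"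
        by (simp add: K_def)
      also have "\<dots> = (\<integral>\<^sup>+s. indicator A (R s (Zl \<omega>)) \<partial>M)"
        unfolding K_def by (rule nn_integral_distr[OF RZ\<omega>]) (simp add: A)
      finally show "emeasure (K (Zl \<omega>)) A = (\<integral>\<^sup>+s. indicator A (R s (Zl \<omega>)) \<partial>M)" .
    qed
    also have "\<dots> = (\<integral>\<^sup>+p. indicator A (R (fst p) (Zl (snd p))) \<partial>(M \<Otimes>\<^sub>M N))"
      by (subst MN.nn_integral_snd[symmetric]) (auto simp: case_prod_unfold)
    also have "\<dots> = (\<integral>\<^sup>+y. indicator A y \<partial>\<nu>)"
      unfolding \<nu>eq by (rule nn_integral_distr[OF RZ, symmetric]) (simp add: A)
    also have "\<dots> = emeasure \<nu> A" by (simp add: \<nu>(2))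
    finally show "emeasure (\<nu> \<bind> K) A = emeasure \<nu> A" .
  qed
  then show ?thesis using that[OF \<nu>] unfolding K_def by blast
qed


section \<open>Contracting Markov families\<close>

lemma countable_dense_subset:
  fixes C :: "'s::{metric_space, second_countable_topology} set"
  assumes "C \<noteq> {}"
  obtains d :: "nat \<Rightarrow> 's" where "\<And>k. d k \<in> C" "\<And>x \<epsilon>. x \<in> C \<Longrightarrow> 0 < \<epsilon> \<Longrightarrow> \<exists>k. dist (d k) x < \<epsilon>"
proof -
  obtain B :: "'s set set" where B: "countable B" "topological_basis B"
    using ex_countable_basis by auto
  define pt where "pt b = (SOME x. x \<in> b \<inter> C)" for b
  define D where "D = pt ` {b \<in> B. b \<inter> C \<noteq> {}}"
  have pt: "pt b \<in> b \<inter> C" if "b \<inter> C \<noteq> {}" for b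
    using someI_ex[of "\<lambda>x. x \<in> b \<inter> C"] that unfolding pt_def by blast
  have near: "\<exists>y\<in>D. dist y x < \<epsilon>" if x: "x \<in> C" "0 < \<epsilon>" for x \<epsilon>
  proof -
    obtain b where b: "b \<in> B" "x \<in> b" "b \<subseteq> ball x \<epsilon>"
      using topological_basisE[OF B(2) open_ball, of x x \<epsilon>] x by auto
    then have "pt b \<in> D" "pt b \<in> b" using x(1) pt[of b] by (auto simp: D_def)
    then show ?thesis using b(3) by (auto simp: dist_commute intro!: bexI[of _ "pt b"])
  qed
  have "countable D" using B(1) by (simp add: D_def)
  moreover have "D \<noteq> {}" using near[of _ 1] assms by fastforce
  ultimately have r: "range (from_nat_into D) = D" by (rule range_from_nat_into[rotated])
  show ?thesis
  proof (rule that[of "from_nat_into D"])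
    show "from_nat_into D k \<in> C" for k
    proof -
      have "from_nat_into D k \<in> D" using r by blast
      then obtain b where "b \<inter> C \<noteq> {}" "from_nat_into D k = pt b" by (auto simp: D_def)
      then show ?thesis using pt by simp
    qed
    show "\<exists>k. dist (from_nat_into D k) x < \<epsilon>" if "x \<in> C" "0 < \<epsilon>" for x \<epsilon>
      using near[OF that] r by (metis imageE)
  qed
qed

text \<open>A family of processes \<open>X x\<close>, one for each initial state \<open>x \<in> C\<close>, all on one probability space.
  The null sets may depend on the initial states, so \<open>X\<close> need not be jointly measurable in \<open>x\<close>; its
  laws are nevertheless, by contraction.\<close>

locale contracting_markov_family = prob_space M for M :: "'w measure" +
  fixes C :: "'s::{complete_space, second_countable_topology} set"
    and X :: "'s \<Rightarrow> real \<Rightarrow> 'w \<Rightarrow> 's" and c :: real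
  assumes closed: "closed C" and nonempty: "C \<noteq> {}" and rate_pos: "0 < c"
    and state_measurable: "\<And>x t. x \<in> C \<Longrightarrow> 0 \<le> t \<Longrightarrow> X x t \<in> M \<rightarrow>\<^sub>M restrict_space borel C"
    and continuous_paths: "\<And>x. x \<in> C \<Longrightarrow> AE w in M. continuous_on {0..} (\<lambda>t. X x t w)"
    and contracting: "\<And>x y t. x \<in> C \<Longrightarrow> y \<in> C \<Longrightarrow> 0 \<le> t \<Longrightarrow>
          AE w in M. dist (X x t w) (X y t w) \<le> exp (- c * t) * dist x y"
    and markov: "\<And>x s t f. x \<in> C \<Longrightarrow> 0 \<le> s \<Longrightarrow> 0 \<le> t \<Longrightarrow> bounded_lipschitz f \<Longrightarrow>
          expectation (\<lambda>w. f (X x (s + t) w)) =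
          expectation (\<lambda>w. expectation (\<lambda>w'. f (X (X x s w) t w')))"
    and first_moment: "\<exists>x\<in>C. integrable M (\<lambda>w. dist x (X x 1 w))"
begin

abbreviation states :: "'s measure" where "states \<equiv> restrict_space borel C"

lemma space_states: "space states = C" by (simp add: space_restrict_space)

lemma state_borel: "x \<in> C \<Longrightarrow> 0 \<le> t \<Longrightarrow> X x t \<in> M \<rightarrow>\<^sub>M borel"
  by (rule measurable_compose[OF state_measurable measurable_ident_borel]) auto

lemma state_in: "x \<in> C \<Longrightarrow> 0 \<le> t \<Longrightarrow> w \<in> space M \<Longrightarrow> X x t w \<in> C"
  using measurable_space[OF state_measurable] by (simp add: space_states)

text \<open>Extending the time parameter by the constant value at \<open>0\<close> gives a kernel on the whole real line,
  so that joint measurability in time and state can be stated for products of standard spaces.\<close>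

definition kern :: "real \<Rightarrow> 's \<Rightarrow> 's measure" where
  "kern t x = distr M states (X x (max 0 t))"

lemma integral_kern:
  fixes f :: "'s \<Rightarrow> real"
  assumes "x \<in> C" "0 \<le> t" "f \<in> borel_measurable states"
  shows "(\<integral>y. f y \<partial>kern t x) = expectation (\<lambda>w. f (X x t w))"
  unfolding kern_def using assms by (subst integral_distr[OF state_measurable]) auto

lemma integrable_kern_iff:
  fixes f :: "'s \<Rightarrow> real"
  assumes "x \<in> C" "0 \<le> t" "f \<in> borel_measurable states"
  shows "integrable (kern t x) f \<longleftrightarrow> integrable M (\<lambda>w. f (X x t w))"
  unfolding kern_def using assms by (subst integrable_distr_eq[OF state_measurable]) auto

lemma prob_space_kern: "x \<in> C \<Longrightarrow> prob_space (kern t x)"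
  unfolding kern_def by (intro prob_space_distr state_measurable) auto

lemma sets_kern[simp]: "sets (kern t x) = sets states"
  by (simp add: kern_def)

lemma expectation_contracting:
  assumes f: "bounded_lipschitz f" "\<And>u v. \<bar>f u - f v\<bar> \<le> L * dist u v" "0 \<le> L"
    and x: "x \<in> C" "y \<in> C" "0 \<le> t"
  shows "\<bar>expectation (\<lambda>w. f (X x t w)) - expectation (\<lambda>w. f (X y t w))\<bar> \<le> L * (exp (- c * t) * dist x y)"
proof -
  have i: "integrable M (\<lambda>w. f (X x t w))" "integrable M (\<lambda>w. f (X y t w))"
    using x by (auto intro!: bounded_lipschitz_integrable[OF _ state_borel f(1)] finite_measure_axioms)
  have "\<bar>expectation (\<lambda>w. f (X x t w) - f (X y t w))\<bar> \<le> expectation (\<lambda>w. \<bar>f (X x t w) - f (X y t w)\<bar>)"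
    by (rule integral_abs_bound)
  also have "\<dots> \<le> expectation (\<lambda>w. L * (exp (- c * t) * dist x y))"
  proof (rule integral_mono_AE)
    show "AE w in M. \<bar>f (X x t w) - f (X y t w)\<bar> \<le> L * (exp (- c * t) * dist x y)"
      using contracting[OF x]
    proof eventually_elim
      case (elim w)
      then show ?case using f(2)[of "X x t w" "X y t w"] mult_left_mono[OF elim f(3)] by linarith
    qed
  qed (use i in auto)
  also have "\<dots> = L * (exp (- c * t) * dist x y)" by (simp add: prob_space)
  finally show ?thesis using i by simp
qed

text \<open>Contraction makes the expectations equicontinuous in the state, uniformly in time, and path
  continuity makes them continuous in time.\<close>

lemma expectation_continuous:
  assumes f: "bounded_lipschitz f"
  shows "continuous_on (UNIV \<times> C) (\<lambda>p. expectation (\<lambda>w. f (X (snd p) (max 0 (fst p)) w)))"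
proof (rule continuous_on_sequentiallyI)
  obtain b L where bL: "\<And>x. \<bar>f x\<bar> \<le> b" "\<And>x y. \<bar>f x - f y\<bar> \<le> L * dist x y" "0 \<le> L"
    using bounded_lipschitzE[OF f] by metis
  fix u :: "nat \<Rightarrow> real \<times> 's" and a
  assume u: "\<forall>n. u n \<in> UNIV \<times> C" and a: "a \<in> UNIV \<times> C" and lim: "u \<longlonglongrightarrow> a"
  define s where "s n = max 0 (fst (u n))" for n
  define x where "x n = snd (u n)" for n
  define t where "t = max 0 (fst a)"
  define y where "y = snd a"
  have xC: "x n \<in> C" "y \<in> C" for n using u a by (auto simp: x_def y_def mem_Times_iff)
  have s0: "0 \<le> s n" "0 \<le> t" for n by (auto simp: s_def t_def)
  have st: "s \<longlonglongrightarrow> t" unfolding s_def t_def by (intro tendsto_intros lim)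
  have xy: "x \<longlonglongrightarrow> y" unfolding x_def y_def by (intro tendsto_intros lim)
  have f_cont: "isCont f z" for z
    using bounded_lipschitz_continuous[OF f] by (simp add: continuous_on_eq_continuous_at)
  have A: "(\<lambda>n. expectation (\<lambda>w. f (X y (s n) w))) \<longlonglongrightarrow> expectation (\<lambda>w. f (X y t w))"
  proof (rule integral_dominated_convergence[where w = "\<lambda>_. b"])
    show "AE w in M. (\<lambda>n. f (X y (s n) w)) \<longlonglongrightarrow> f (X y t w)"
      using continuous_paths[OF xC(2)]
    proof eventually_elim
      case (elim w)
      have "(\<lambda>n. X y (s n) w) \<longlonglongrightarrow> X y t w"
        using continuous_on_tendsto_compose[OF elim st] s0 by (simp add: always_eventually)
      then show ?case by (rule isCont_tendsto_compose[OF f_cont])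
    qed
  qed (use bL xC s0 in \<open>auto intro!: measurable_compose[OF state_borel bounded_lipschitz_borel[OF f]]\<close>)
  let ?d = "\<lambda>n. expectation (\<lambda>w. f (X (x n) (s n) w)) - expectation (\<lambda>w. f (X y (s n) w))"
  have "(\<lambda>n. ?d n) \<longlonglongrightarrow> 0"
  proof (rule tendsto_rabs_zero_cancel, rule tendsto_sandwich[OF _ _ tendsto_const])
    show "(\<lambda>n. L * dist (x n) y) \<longlonglongrightarrow> 0"
      using tendsto_mult_right_zero[OF xy[unfolded tendsto_dist_iff[of _ y]]] by simp
    show "\<forall>\<^sub>F n in sequentially. \<bar>?d n\<bar>
        \<le> L * dist (x n) y"
    proof (intro always_eventually allI)
      fix n
      have "exp (- c * s n) * dist (x n) y \<le> 1 * dist (x n) y"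
        using rate_pos s0(1)[of n] by (intro mult_right_mono) auto
      from order_trans[OF expectation_contracting[OF f bL(2,3) xC s0(1)[of n]] mult_left_mono[OF this bL(3)]]
      show "\<bar>?d n\<bar> \<le> L * dist (x n) y"
        by simp
    qed
  qed simp
  from tendsto_add[OF this A]
  show "(\<lambda>n. expectation (\<lambda>w. f (X (snd (u n)) (max 0 (fst (u n))) w)))
      \<longlonglongrightarrow> expectation (\<lambda>w. f (X (snd a) (max 0 (fst a)) w))"
    by (simp add: s_def x_def t_def y_def)
qed

lemma kern_measurable[measurable]:
  "(\<lambda>p. kern (fst p) (snd p)) \<in> borel \<Otimes>\<^sub>M states \<rightarrow>\<^sub>M prob_algebra states"
proof (rule kernel_measurableI_bounded_lipschitz[OF closed])
  fix f :: "'s \<Rightarrow> real" assume f: "bounded_lipschitz f"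
  have m: "(\<lambda>p. (fst p, snd p)) \<in> borel \<Otimes>\<^sub>M states \<rightarrow>\<^sub>M (borel :: (real \<times> 's) measure)"
    unfolding borel_prod[symmetric]
    by (intro measurable_Pair measurable_fst measurable_compose[OF measurable_snd measurable_ident_borel]) auto
  have "(\<lambda>p::real \<times> 's. p) \<in> borel \<Otimes>\<^sub>M states \<rightarrow>\<^sub>M restrict_space borel (UNIV \<times> C)"
    by (rule measurable_restrict_space2) (use m in \<open>auto simp: space_pair_measure space_states\<close>)
  from measurable_compose[OF this borel_measurable_continuous_on_restrict[OF expectation_continuous[OF f]]]
  have "(\<lambda>p. expectation (\<lambda>w. f (X (snd p) (max 0 (fst p)) w))) \<in> borel_measurable (borel \<Otimes>\<^sub>M states)" .
  moreover have "(\<integral>x. f x \<partial>kern (fst p) (snd p)) = expectation (\<lambda>w. f (X (snd p) (max 0 (fst p)) w))"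
    if "p \<in> space (borel \<Otimes>\<^sub>M states)" for p
    using that integral_kern[OF _ _ bounded_lipschitz_borel_on[OF f], of "snd p" "max 0 (fst p)"]
    by (simp add: space_pair_measure space_states kern_def mem_Times_iff)
  ultimately show "(\<lambda>p. \<integral>x. f x \<partial>kern (fst p) (snd p)) \<in> borel_measurable (borel \<Otimes>\<^sub>M states)"
    by (simp cong: measurable_cong)
qed (auto simp: space_pair_measure space_states intro: prob_space_kern)

lemma kern_measurable_state[measurable]: "kern t \<in> states \<rightarrow>\<^sub>M prob_algebra states"
  using measurable_compose[OF measurable_Pair1'[of t borel states] kern_measurable] by simp

lemma kern_semigroup:
  assumes x: "x \<in> C" and t: "0 \<le> s" "0 \<le> t"
  shows "kern s x \<bind> kern t = kern (s + t) x"
proof (rule measure_eqI_bounded_lipschitz[OF closed])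
  have A: "kern s x \<in> space (prob_algebra states)"
    using prob_space_kern[OF x] by (simp add: space_prob_algebra)
  show ps: "prob_space (kern s x \<bind> kern t)" by (rule prob_space_bind'[OF A kern_measurable_state])
  show st: "sets (kern s x \<bind> kern t) = sets states" by (rule sets_bind'[OF A kern_measurable_state])
  show "prob_space (kern (s + t) x)" by (rule prob_space_kern[OF x])
  fix f :: "'s \<Rightarrow> real" assume f: "bounded_lipschitz f"
  note fS = bounded_lipschitz_borel_on[OF f, of C]
  have i: "integrable (kern s x \<bind> kern t) f"
    using bounded_lipschitz_integrable[OF prob_space.finite_measure[OF ps] measurable_ident_borel[OF st] f]
    by simp
  have km: "kern t \<in> kern s x \<rightarrow>\<^sub>M prob_algebra states"
    unfolding measurable_cong_sets[OF sets_kern refl] by (rule kern_measurable_state)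
  have "(\<integral>y. f y \<partial>(kern s x \<bind> kern t)) = (\<integral>y. (\<integral>z. f z \<partial>kern t y) \<partial>kern s x)"
    by (rule kernel_integral[OF km refl st i, symmetric])
  also have "\<dots> = (\<integral>w. (\<integral>z. f z \<partial>kern t (X x s w)) \<partial>M)"
    by (intro integral_kern x t measurable_compose[OF kern_measurable_state]
      measurable_compose[OF measurable_prob_algebraD[OF kern_measurable_state] integral_measurable_subprob_algebra] fS)
  also have "\<dots> = expectation (\<lambda>w. expectation (\<lambda>w'. f (X (X x s w) t w')))"
    by (intro Bochner_Integration.integral_cong refl integral_kern state_in x t fS)
  also have "\<dots> = expectation (\<lambda>w. f (X x (s + t) w))"
    by (rule markov[OF x t f, symmetric])
  also have "\<dots> = (\<integral>y. f y \<partial>kern (s + t) x)"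
    using t by (intro integral_kern[symmetric] x fS) auto
  finally show "(\<integral>y. f y \<partial>(kern s x \<bind> kern t)) = (\<integral>y. f y \<partial>kern (s + t) x)" .
qed simp

text \<open>For a countable dense set of initial states the contraction estimates hold simultaneously off one
  null set. There the states at time 1 extend uniquely to a contraction of all of \<open>C\<close>, which is jointly
  measurable as a limit of maps that are piecewise constant in the initial state.\<close>

lemma random_contraction_version:
  obtains R where "case_prod R \<in> M \<Otimes>\<^sub>M states \<rightarrow>\<^sub>M states"
    "\<And>w x y. w \<in> space M \<Longrightarrow> x \<in> C \<Longrightarrow> y \<in> C \<Longrightarrow> dist (R w x) (R w y) \<le> exp (- c) * dist x y"
    "\<And>x. x \<in> C \<Longrightarrow> AE w in M. R w x = X x 1 w"
proof -
  obtain d where dC: "\<And>k. d k \<in> C" and d: "\<And>x \<epsilon>. x \<in> C \<Longrightarrow> 0 < \<epsilon> \<Longrightarrow> \<exists>k::nat. dist (d k) x < \<epsilon>"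
    using countable_dense_subset[OF nonempty] by metis
  obtain x0 where x0: "x0 \<in> C" using nonempty by auto
  \<comment> \<open>\<open>d (a j x)\<close> is the first point of the dense sequence within \<open>(1/2) ^ j\<close> of \<open>x\<close>.\<close>
  define a where "a j x = (LEAST k. dist (d k) x < (1/2) ^ j)" for j :: nat and x
  have a: "dist (d (a j x)) x < (1/2) ^ j" if "x \<in> C" for j x
    unfolding a_def by (rule LeastI_ex, rule d[OF that]) simp
  have da: "(\<lambda>j. d (a j x)) \<longlonglongrightarrow> x" if "x \<in> C" for x
    unfolding tendsto_dist_iff[of _ x]
  proof (rule tendsto_sandwich[OF _ _ tendsto_const])
    show "(\<lambda>j. (1/2 :: real) ^ j) \<longlonglongrightarrow> 0" by (rule LIMSEQ_power_zero) simp
    show "\<forall>\<^sub>F j in sequentially. dist (d (a j x)) x \<le> (1/2) ^ j"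
      by (intro always_eventually allI less_imp_le a that)
  qed simp
  have [measurable]: "X (d k) 1 \<in> M \<rightarrow>\<^sub>M borel" for k by (rule state_borel[OF dC]) simp
  define G where "G = {w \<in> space M. \<forall>k l. dist (X (d k) 1 w) (X (d l) 1 w) \<le> exp (- c) * dist (d k) (d l)}"
  have G[measurable]: "G \<in> sets M" unfolding G_def by measurable
  have AEG: "AE w in M. w \<in> G"
  proof -
    have "AE w in M. \<forall>k l. dist (X (d k) 1 w) (X (d l) 1 w) \<le> exp (- c) * dist (d k) (d l)"
      using contracting[OF dC dC, of 1] by (simp add: AE_all_countable)
    with AE_space show ?thesis by eventually_elim (auto simp: G_def)
  qed
  \<comment> \<open>The default value \<open>x0\<close> off the good event \<open>G\<close> gives limits that are contractions for every \<open>w\<close>.\<close>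
  define g where "g j w x = (if w \<in> G then X (d (a j x)) 1 w else x0)" for j w x
  define R where "R w x = lim (\<lambda>j. g j w x)" for w x
  have gC: "g j w x \<in> C" if "w \<in> space M" for j w x
    using that by (auto simp: g_def x0 state_in dC)
  have conv: "(\<lambda>j. g j w x) \<longlonglongrightarrow> R w x" if x: "x \<in> C" for w x
  proof -
    have "Cauchy (\<lambda>j. g j w x)"
    proof (cases "w \<in> G")
      case True
      show ?thesis
      proof (rule metric_CauchyI)
        fix \<epsilon> :: real assume "0 < \<epsilon>"
        then obtain J where J: "\<And>m n. m \<ge> J \<Longrightarrow> n \<ge> J \<Longrightarrow> dist (d (a m x)) (d (a n x)) < \<epsilon>"
          using metric_CauchyD[OF LIMSEQ_imp_Cauchy[OF da[OF x]]] by metis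
        have "dist (g m w x) (g n w x) < \<epsilon>" if "m \<ge> J" "n \<ge> J" for m n
        proof -
          have "dist (g m w x) (g n w x) \<le> exp (- c) * dist (d (a m x)) (d (a n x))"
            using True by (simp add: g_def G_def)
          also have "\<dots> \<le> 1 * dist (d (a m x)) (d (a n x))"
            using rate_pos by (intro mult_right_mono) auto
          finally show ?thesis using J[OF that] by simp
        qed
        then show "\<exists>J. \<forall>m\<ge>J. \<forall>n\<ge>J. dist (g m w x) (g n w x) < \<epsilon>" by blast
      qed
    qed (simp add: g_def convergent_Cauchy convergent_const)
    then show ?thesis unfolding R_def by (simp add: Cauchy_convergent_iff convergent_LIMSEQ_iff)
  qed
  show ?thesis
  proof (rule that[of R])
    have am: "a j \<in> states \<rightarrow>\<^sub>M count_space UNIV" for j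
      unfolding a_def
    proof (rule measurable_Least)
      fix k
      have "(\<lambda>x. dist (d k) x) \<in> borel_measurable states"
        by (rule measurable_restrict_space1) measurable
      then show "(\<lambda>x. dist (d k) x < (1/2) ^ j) \<in> states \<rightarrow>\<^sub>M count_space UNIV" by measurable
    qed
    have gm: "(\<lambda>p. g j (fst p) (snd p)) \<in> M \<Otimes>\<^sub>M states \<rightarrow>\<^sub>M borel" for j
    proof -
      have "(\<lambda>p. X (d (a j (snd p))) 1 (fst p)) \<in> M \<Otimes>\<^sub>M states \<rightarrow>\<^sub>M borel"
        by (rule measurable_compose_countable[where f = "\<lambda>k p. X (d k) 1 (fst p)"])
          (use measurable_compose[OF measurable_snd am] in measurable)
      then show ?thesis unfolding g_def by measurable
    qed
    have "(\<lambda>p. R (fst p) (snd p)) \<in> M \<Otimes>\<^sub>M states \<rightarrow>\<^sub>M borel"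
      by (rule borel_measurable_LIMSEQ_metric[OF gm]) (auto intro!: conv simp: space_pair_measure space_states)
    moreover have "R w x \<in> C" if "w \<in> space M" "x \<in> C" for w x
      by (rule closed_sequentially[OF closed _ conv[OF that(2)]]) (rule gC[OF that(1)])
    ultimately show "case_prod R \<in> M \<Otimes>\<^sub>M states \<rightarrow>\<^sub>M states"
      by (intro measurable_restrict_space2) (auto simp: case_prod_unfold space_pair_measure space_states)
    show "dist (R w x) (R w y) \<le> exp (- c) * dist x y" if "w \<in> space M" "x \<in> C" "y \<in> C" for w x y
    proof (rule LIMSEQ_le[OF tendsto_dist[OF conv[OF that(2)] conv[OF that(3)]]])
      show "(\<lambda>j. exp (- c) * dist (d (a j x)) (d (a j y))) \<longlonglongrightarrow> exp (- c) * dist x y"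
        by (intro tendsto_intros da that)
      show "\<exists>N. \<forall>j\<ge>N. dist (g j w x) (g j w y) \<le> exp (- c) * dist (d (a j x)) (d (a j y))"
        by (auto simp: g_def G_def)
    qed
    show "AE w in M. R w x = X x 1 w" if x: "x \<in> C" for x
    proof -
      have "AE w in M. \<forall>k. dist (X (d k) 1 w) (X x 1 w) \<le> exp (- c) * dist (d k) x"
        using contracting[OF dC x, of 1] by (simp add: AE_all_countable)
      with AEG show ?thesis
      proof eventually_elim
        case (elim w)
        have "(\<lambda>j. X (d (a j x)) 1 w) \<longlonglongrightarrow> X x 1 w"
          unfolding tendsto_dist_iff[of _ "X x 1 w"]
        proof (rule tendsto_sandwich[OF _ _ tendsto_const])
          show "(\<lambda>j. exp (- c) * dist (d (a j x)) x) \<longlonglongrightarrow> 0"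
            using da[OF x, unfolded tendsto_dist_iff[of _ x]] by (intro tendsto_mult_right_zero)
        qed (use elim(2) in \<open>auto intro!: always_eventually\<close>)
        then show ?case using conv[OF x, of w] elim(1) by (auto simp: g_def intro: LIMSEQ_unique)
      qed
    qed
  qed
qed

definition stationary_at :: "real \<Rightarrow> 's measure \<Rightarrow> bool" where
  "stationary_at t \<nu> \<longleftrightarrow> prob_space \<nu> \<and> sets \<nu> = sets states \<and> \<nu> \<bind> kern t = \<nu>"

lemma stationary_at_one_exists: "\<exists>\<nu>. stationary_at 1 \<nu>"
proof -
  obtain R where R: "case_prod R \<in> M \<Otimes>\<^sub>M states \<rightarrow>\<^sub>M states"
    "\<And>w x y. w \<in> space M \<Longrightarrow> x \<in> C \<Longrightarrow> y \<in> C \<Longrightarrow> dist (R w x) (R w y) \<le> exp (- c) * dist x y"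
    "\<And>x. x \<in> C \<Longrightarrow> AE w in M. R w x = X x 1 w"
    by (rule random_contraction_version) (rule that)
  obtain x0 where x0: "x0 \<in> C" "integrable M (\<lambda>w. dist x0 (X x0 1 w))" using first_moment by auto
  have Rx: "(\<lambda>w. R w x) \<in> M \<rightarrow>\<^sub>M states" if "x \<in> C" for x
    using measurable_compose[OF measurable_Pair2'[of x states M] R(1)] that by (simp add: space_states)
  have "(\<lambda>w. R w x0) \<in> M \<rightarrow>\<^sub>M borel"
    by (rule measurable_compose[OF Rx[OF x0(1)] measurable_ident_borel]) simp
  then have dm: "(\<lambda>w. dist x0 (R w x0)) \<in> borel_measurable M" by measurable
  have mom: "integrable M (\<lambda>w. dist x0 (R w x0))"
  proof (rule integrable_cong_AE_imp[OF x0(2) dm])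
    show "AE w in M. dist x0 (X x0 1 w) = dist x0 (R w x0)"
      using R(3)[OF x0(1)] by eventually_elim simp
  qed
  obtain \<nu> where \<nu>: "prob_space \<nu>" "sets \<nu> = sets states" "\<nu> \<bind> (\<lambda>x. distr M states (\<lambda>w. R w x)) = \<nu>"
    by (rule random_contraction_stationary[OF prob_space_axioms closed x0(1) R(1) R(2) _ _ mom])
      (use rate_pos in auto)
  have "\<nu> \<bind> kern 1 = \<nu> \<bind> (\<lambda>x. distr M states (\<lambda>w. R w x))"
  proof (rule bind_cong[OF refl])
    fix x assume "x \<in> space \<nu>"
    then have x: "x \<in> C" using sets_eq_imp_space_eq[OF \<nu>(2)] by (simp add: space_states)
    show "kern 1 x = distr M states (\<lambda>w. R w x)"
      unfolding kern_def
      by (rule distr_cong_AE) (use R(3)[OF x] Rx[OF x] state_measurable[OF x, of 1] in \<open>auto simp: eq_commute\<close>)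
  qed
  then show ?thesis using \<nu> unfolding stationary_at_def by auto
qed

lemma stationary_kern_measurable:
  "stationary_at t \<nu> \<Longrightarrow> kern u \<in> \<nu> \<rightarrow>\<^sub>M prob_algebra states"
  unfolding stationary_at_def by (simp cong: measurable_cong_sets)

text \<open>By stationarity the integral of \<open>f\<close> is the \<open>\<nu>\<close>-average over \<open>y\<close> of the expectations started at
  \<open>y\<close>, and contraction makes each of them asymptotically equal to the one started at \<open>x\<close>. The times
  \<open>\<tau> k\<close> are arbitrary because this is used both along the integers, for uniqueness, and along
  arbitrary divergent sequences, for ergodicity.\<close>

lemma stationary_mixing:
  assumes \<nu>: "\<And>k. stationary_at (\<tau> k) \<nu>" and \<tau>: "\<And>k. 0 \<le> \<tau> k" "filterlim \<tau> at_top sequentially"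
    and f: "bounded_lipschitz f" and x: "x \<in> C"
  shows "(\<lambda>k. expectation (\<lambda>w. f (X x (\<tau> k) w))) \<longlonglongrightarrow> (\<integral>y. f y \<partial>\<nu>)"
proof -
  obtain b L where bL: "\<And>x. \<bar>f x\<bar> \<le> b" "\<And>x y. \<bar>f x - f y\<bar> \<le> L * dist x y" "0 \<le> L" "0 \<le> b"
    using bounded_lipschitzE[OF f] by metis
  interpret \<nu>: prob_space \<nu> using \<nu>[of 0] by (simp add: stationary_at_def)
  have sets: "sets \<nu> = sets states" using \<nu>[of 0] by (simp add: stationary_at_def)
  have sp: "space \<nu> = C" using sets_eq_imp_space_eq[OF sets] by (simp add: space_states)
  note fS = bounded_lipschitz_borel_on[OF f, of C]
  have fi: "integrable \<nu> f"
    using bounded_lipschitz_integrable[OF \<nu>.finite_measure_axioms measurable_ident_borel[OF sets] f] by simp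
  define u where "u k y = expectation (\<lambda>w. f (X y (\<tau> k) w))" for k y
  have ub: "\<bar>u k y\<bar> \<le> b" if "y \<in> C" for k y
  proof -
    have "\<bar>u k y\<bar> \<le> expectation (\<lambda>w. \<bar>f (X y (\<tau> k) w)\<bar>)" unfolding u_def by (rule integral_abs_bound)
    also have "\<dots> \<le> expectation (\<lambda>w. b)"
      by (intro integral_mono integrable_abs bounded_lipschitz_integrable[OF finite_measure_axioms state_borel f] bL that \<tau>) simp
    finally show ?thesis by (simp add: prob_space)
  qed
  have ueq: "u k y = (\<integral>z. f z \<partial>kern (\<tau> k) y)" if "y \<in> C" for k y
    unfolding u_def by (rule integral_kern[OF that \<tau>(1) fS, symmetric])
  have um: "u k \<in> borel_measurable \<nu>" for k
  proof -
    have "(\<lambda>y. \<integral>z. f z \<partial>kern (\<tau> k) y) \<in> borel_measurable \<nu>"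
      by (rule measurable_compose[OF measurable_prob_algebraD[OF stationary_kern_measurable[OF \<nu>]]
          integral_measurable_subprob_algebra[OF fS]])
    then show ?thesis by (rule measurable_cong[THEN iffD2, rotated]) (simp add: ueq sp)
  qed
  have int_u: "(\<integral>y. u k y \<partial>\<nu>) = (\<integral>y. f y \<partial>\<nu>)" for k
  proof -
    have "(\<integral>y. u k y \<partial>\<nu>) = (\<integral>y. (\<integral>z. f z \<partial>kern (\<tau> k) y) \<partial>\<nu>)"
      by (intro Bochner_Integration.integral_cong refl ueq) (simp add: sp)
    also have "\<dots> = (\<integral>y. f y \<partial>\<nu>)"
      using \<nu>[of k] sets fi by (intro kernel_integral stationary_kern_measurable[OF \<nu>[of k]]) (auto simp: stationary_at_def)
    finally show ?thesis .
  qed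
  have "(\<lambda>k. \<integral>y. u k x - u k y \<partial>\<nu>) \<longlonglongrightarrow> (\<integral>y. 0 \<partial>\<nu>)"
  proof (rule integral_dominated_convergence[where w = "\<lambda>_. 2 * b"])
    show "AE y in \<nu>. (\<lambda>k. u k x - u k y) \<longlonglongrightarrow> 0"
    proof (rule AE_I2)
      fix y assume "y \<in> space \<nu>"
      then have y: "y \<in> C" by (simp add: sp)
      have "filterlim (\<lambda>k. c * \<tau> k) at_top sequentially"
        using \<tau>(2) rate_pos by (rule filterlim_tendsto_pos_mult_at_top[OF tendsto_const, rotated])
      then have "(\<lambda>k. exp (- (c * \<tau> k))) \<longlonglongrightarrow> 0"
        by (intro filterlim_compose[OF exp_at_bot] filterlim_compose[OF filterlim_uminus_at_bot_at_top])
      then have e: "(\<lambda>k. L * (exp (- c * \<tau> k) * dist x y)) \<longlonglongrightarrow> 0"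
        by (intro tendsto_mult_right_zero tendsto_mult_left_zero) simp
      show "(\<lambda>k. u k x - u k y) \<longlonglongrightarrow> 0"
      proof (rule tendsto_rabs_zero_cancel, rule tendsto_sandwich[OF _ _ tendsto_const e])
        show "\<forall>\<^sub>F k in sequentially. \<bar>u k x - u k y\<bar> \<le> L * (exp (- c * \<tau> k) * dist x y)"
          unfolding u_def
          by (intro always_eventually allI expectation_contracting[OF f bL(2,3) x y \<tau>(1)])
      qed simp
    qed
    show "AE y in \<nu>. norm (u k x - u k y) \<le> 2 * b" for k
    proof (rule AE_I2)
      fix y assume "y \<in> space \<nu>"
      then show "norm (u k x - u k y) \<le> 2 * b" using ub[OF x, of k] ub[of y k] by (simp add: sp)
    qed
  qed (use um in auto)
  moreover have "(\<integral>y. u k x - u k y \<partial>\<nu>) = u k x - (\<integral>y. f y \<partial>\<nu>)" for k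
  proof -
    have "integrable \<nu> (u k)"
      by (rule \<nu>.integrable_const_bound[where B = b]) (use ub um sp in \<open>auto intro!: AE_I2\<close>)
    then show ?thesis by (simp add: int_u \<nu>.prob_space)
  qed
  ultimately have "(\<lambda>k. u k x - (\<integral>y. f y \<partial>\<nu>)) \<longlonglongrightarrow> 0" by simp
  then show ?thesis unfolding u_def[symmetric] by (rule LIM_zero_cancel)
qed

lemma stationary_bind_kern:
  assumes "prob_space \<nu>" "sets \<nu> = sets states" "0 \<le> s" "0 \<le> t"
  shows "(\<nu> \<bind> kern s) \<bind> kern t = \<nu> \<bind> kern (s + t)"
proof -
  have "kern s \<in> \<nu> \<rightarrow>\<^sub>M subprob_algebra states"
    unfolding measurable_cong_sets[OF assms(2) refl]
    by (rule measurable_prob_algebraD[OF kern_measurable_state])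
  then have "(\<nu> \<bind> kern s) \<bind> kern t = \<nu> \<bind> (\<lambda>x. kern s x \<bind> kern t)"
    by (rule bind_assoc) (rule measurable_prob_algebraD[OF kern_measurable_state])
  also have "\<dots> = \<nu> \<bind> kern (s + t)"
  proof (rule bind_cong[OF refl])
    fix x assume "x \<in> space \<nu>"
    then have "x \<in> C" using sets_eq_imp_space_eq[OF assms(2)] by (simp add: space_states)
    then show "kern s x \<bind> kern t = kern (s + t) x" by (rule kern_semigroup) fact+
  qed
  finally show ?thesis .
qed

lemma stationary_at_Suc:
  assumes "stationary_at 1 \<nu>"
  shows "stationary_at (real (Suc k)) \<nu>"
proof (induction k)
  case 0
  show ?case using assms by simp
next
  case (Suc k)
  then show ?case
    using assms stationary_bind_kern[of \<nu> "real (Suc k)" 1]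
    by (simp add: stationary_at_def add.commute)
qed

text \<open>Mixing computes the integrals of all test functions from the process alone.\<close>

lemma stationary_at_one_unique:
  assumes \<mu>: "stationary_at 1 \<mu>" and \<nu>: "stationary_at 1 \<nu>"
  shows "\<mu> = \<nu>"
proof (rule measure_eqI_bounded_lipschitz[OF closed])
  fix f :: "'s \<Rightarrow> real" assume f: "bounded_lipschitz f"
  obtain x where x: "x \<in> C" using nonempty by auto
  have lim: "filterlim (\<lambda>k. real (Suc k)) at_top sequentially"
    using filterlim_real_sequentially by (subst filterlim_sequentially_Suc)
  show "(\<integral>x. f x \<partial>\<mu>) = (\<integral>x. f x \<partial>\<nu>)"
    by (rule LIMSEQ_unique[OF stationary_mixing[OF stationary_at_Suc[OF \<mu>] _ lim f x]
          stationary_mixing[OF stationary_at_Suc[OF \<nu>] _ lim f x]]) auto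
qed (use assms in \<open>auto simp: stationary_at_def\<close>)

text \<open>The time-\<open>t\<close> kernel commutes with the time-1 kernel and therefore maps the unique time-1 stationary
  law to itself.\<close>

lemma stationary_at_all_times:
  assumes \<nu>: "stationary_at 1 \<nu>" and t: "0 \<le> t"
  shows "stationary_at t \<nu>"
proof -
  have p: "prob_space \<nu>" "sets \<nu> = sets states" "\<nu> \<bind> kern 1 = \<nu>"
    using \<nu> by (auto simp: stationary_at_def)
  have A: "\<nu> \<in> space (prob_algebra states)" using p by (simp add: space_prob_algebra)
  note q = prob_space_bind'[OF A kern_measurable_state] sets_bind'[OF A kern_measurable_state]
  have "stationary_at 1 (\<nu> \<bind> kern t)"
    using stationary_bind_kern[OF p(1,2) t, of 1] stationary_bind_kern[OF p(1,2) _ t, of 1] p(3) q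
    by (simp add: stationary_at_def add.commute)
  then have "\<nu> \<bind> kern t = \<nu>" by (rule stationary_at_one_unique[OF _ \<nu>])
  then show ?thesis using p by (simp add: stationary_at_def)
qed

lemma transition_op_kern:
  assumes "x \<in> C" "0 \<le> t" "f \<in> borel_measurable states"
  shows "transition_op M X t f x = (\<integral>y. f y \<partial>kern t x)"
  unfolding transition_op_def by (rule integral_kern[OF assms, symmetric])

lemma stationary_integral_transition_op:
  assumes \<nu>: "prob_space \<nu>" "sets \<nu> = sets states" and t: "0 \<le> t"
    and f: "f \<in> borel_measurable states" "\<And>x. x \<in> C \<Longrightarrow> \<bar>f x\<bar> \<le> b"
  shows "(\<integral>x. transition_op M X t f x \<partial>\<nu>) = (\<integral>x. f x \<partial>(\<nu> \<bind> kern t))"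
proof -
  have sp: "space \<nu> = C" using sets_eq_imp_space_eq[OF \<nu>(2)] by (simp add: space_states)
  have A: "\<nu> \<in> space (prob_algebra states)" using \<nu> by (simp add: space_prob_algebra)
  have k: "kern t \<in> \<nu> \<rightarrow>\<^sub>M prob_algebra states"
    unfolding measurable_cong_sets[OF \<nu>(2) refl] by (rule kern_measurable_state)
  note q = prob_space_bind'[OF A kern_measurable_state] sets_bind'[OF A kern_measurable_state]
  interpret B: prob_space "\<nu> \<bind> kern t" by (rule q)
  have fB: "f \<in> borel_measurable (\<nu> \<bind> kern t)"
    unfolding measurable_cong_sets[OF q(2) refl] by (rule f)
  have i: "integrable (\<nu> \<bind> kern t) f"
    by (rule B.integrable_const_bound[where B = b, OF AE_I2 fB])
      (use f(2) sets_eq_imp_space_eq[OF q(2)] in \<open>simp add: space_states\<close>)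
  have "(\<integral>x. transition_op M X t f x \<partial>\<nu>) = (\<integral>x. (\<integral>y. f y \<partial>kern t x) \<partial>\<nu>)"
    by (intro Bochner_Integration.integral_cong refl transition_op_kern t f) (simp add: sp)
  also have "\<dots> = (\<integral>x. f x \<partial>(\<nu> \<bind> kern t))"
    by (rule kernel_integral[OF k refl q(2) i])
  finally show ?thesis .
qed

lemma invariant_measure_iff_stationary:
  "invariant_measure M states X \<nu> \<longleftrightarrow> (\<forall>t\<ge>0. stationary_at t \<nu>)"
proof
  assume inv: "invariant_measure M states X \<nu>"
  then have \<nu>: "prob_space \<nu>" "sets \<nu> = sets states" by (auto simp: invariant_measure_def)
  interpret \<nu>: prob_space \<nu> by fact
  show "\<forall>t\<ge>0. stationary_at t \<nu>"
  proof (intro allI impI)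
    fix t :: real assume t: "0 \<le> t"
    have A: "\<nu> \<in> space (prob_algebra states)" using \<nu> by (simp add: space_prob_algebra)
    note q = prob_space_bind'[OF A kern_measurable_state[of t]] sets_bind'[OF A kern_measurable_state[of t]]
    interpret B: prob_space "\<nu> \<bind> kern t" by (rule q)
    have "\<nu> \<bind> kern t = \<nu>"
    proof (rule measure_eqI)
      show "sets (\<nu> \<bind> kern t) = sets \<nu>" using q(2) \<nu>(2) by simp
      fix A assume "A \<in> sets (\<nu> \<bind> kern t)"
      then have A: "A \<in> sets states" using q(2) by simp
      have m: "(indicator A :: 's \<Rightarrow> real) \<in> borel_measurable states" using A by simp
      have bd: "\<exists>K. \<forall>x\<in>space states. \<bar>indicator A x :: real\<bar> \<le> K"
        by (auto intro!: exI[of _ 1] simp: indicator_def)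
      have "(\<integral>x. indicator A x \<partial>(\<nu> \<bind> kern t)) = (\<integral>x. transition_op M X t (indicator A) x \<partial>\<nu>)"
        by (rule stationary_integral_transition_op[OF \<nu> t m, of 1, symmetric]) (auto simp: indicator_def)
      also have "\<dots> = (\<integral>x. indicator A x \<partial>\<nu>)"
        using inv t m bd unfolding invariant_measure_def by blast
      finally have "measure (\<nu> \<bind> kern t) A = measure \<nu> A"
        using A q(2) \<nu>(2) by simp
      then show "emeasure (\<nu> \<bind> kern t) A = emeasure \<nu> A"
        by (simp add: B.emeasure_eq_measure \<nu>.emeasure_eq_measure)
    qed
    with \<nu> show "stationary_at t \<nu>" by (simp add: stationary_at_def)
  qed
next
  assume st: "\<forall>t\<ge>0. stationary_at t \<nu>"
  then have \<nu>: "prob_space \<nu>" "sets \<nu> = sets states" by (auto simp: stationary_at_def)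
  show "invariant_measure M states X \<nu>"
    unfolding invariant_measure_def
  proof (intro conjI \<nu> ballI impI allI)
    fix f :: "'s \<Rightarrow> real" and t :: real
    assume f: "f \<in> borel_measurable states" "\<exists>K. \<forall>x\<in>space states. \<bar>f x\<bar> \<le> K" and t: "0 \<le> t"
    obtain K where "\<And>x. x \<in> C \<Longrightarrow> \<bar>f x\<bar> \<le> K" using f(2) by (auto simp: space_states)
    from stationary_integral_transition_op[OF \<nu> t f(1) this] st t
    show "(\<integral>x. transition_op M X t f x \<partial>\<nu>) = (\<integral>x. f x \<partial>\<nu>)"
      by (simp add: stationary_at_def)
  qed
qed

end


section \<open>Ergodicity of contracting Markov families\<close>

text \<open>Jensen's inequality for averaging over the second coordinate.\<close>

lemma (in pair_prob_space) square_integral_section_le: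
  fixes h :: "'a \<times> 'b \<Rightarrow> real"
  assumes h: "h \<in> borel_measurable (M1 \<Otimes>\<^sub>M M2)" "integrable (M1 \<Otimes>\<^sub>M M2) (\<lambda>p. (h p)\<^sup>2)"
  shows "AE x in M1. integrable M2 (\<lambda>y. h (x, y))"
    and "integrable M1 (\<lambda>x. (\<integral>y. h (x, y) \<partial>M2)\<^sup>2)"
    and "(\<integral>x. (\<integral>y. h (x, y) \<partial>M2)\<^sup>2 \<partial>M1) \<le> (\<integral>p. (h p)\<^sup>2 \<partial>(M1 \<Otimes>\<^sub>M M2))"
proof -
  have hi: "integrable (M1 \<Otimes>\<^sub>M M2) h" by (rule square_expectation_le(1)[OF h])
  show 1: "AE x in M1. integrable M2 (\<lambda>y. h (x, y))" by (rule AE_integrable_fst'[OF hi])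
  have m: "(\<lambda>x. \<integral>y. h (x, y) \<partial>M2) \<in> borel_measurable M1"
    using integrable_fst'[OF hi] by (rule borel_measurable_integrable)
  note 2 = AE_integrable_fst'[OF h(2)] and 3 = integrable_fst'[OF h(2)]
  have le: "AE x in M1. (\<integral>y. h (x, y) \<partial>M2)\<^sup>2 \<le> (\<integral>y. (h (x, y))\<^sup>2 \<partial>M2)"
    using 1 2
  proof eventually_elim
    case (elim x)
    show ?case by (rule M2.square_expectation_le(2)[OF borel_measurable_integrable[OF elim(1)] elim(2)])
  qed
  show 4: "integrable M1 (\<lambda>x. (\<integral>y. h (x, y) \<partial>M2)\<^sup>2)"
  proof (rule Bochner_Integration.integrable_bound[OF 3])
    show "AE x in M1. norm ((\<integral>y. h (x, y) \<partial>M2)\<^sup>2) \<le> norm (\<integral>y. (h (x, y))\<^sup>2 \<partial>M2)"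
      using le by eventually_elim (simp add: order_trans[OF _ abs_ge_self])
  qed (use m in measurable)
  show "(\<integral>x. (\<integral>y. h (x, y) \<partial>M2)\<^sup>2 \<partial>M1) \<le> (\<integral>p. (h p)\<^sup>2 \<partial>(M1 \<Otimes>\<^sub>M M2))"
    using integral_mono_AE[OF 4 3 le] integral_fst'[OF h(2)] by simp
qed

text \<open>Time averages over \<open>{0..T}\<close> become averages over this fixed probability space after rescaling
  time by \<open>T\<close>, so that the limit \<open>T \<rightarrow> \<infinity>\<close> falls under dominated convergence.\<close>

definition unit_uniform :: "real measure" where
  "unit_uniform = restrict_space lborel {0..1}"

lemma space_unit_uniform: "space unit_uniform = {0..1}"
  by (simp add: unit_uniform_def space_restrict_space)

lemma prob_space_unit_uniform: "prob_space unit_uniform"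
  by (rule prob_spaceI) (simp add: unit_uniform_def emeasure_restrict_space space_restrict_space)

lemma unit_uniform_to_borel: "(\<lambda>s. s) \<in> unit_uniform \<rightarrow>\<^sub>M borel"
  unfolding unit_uniform_def by (rule measurable_restrict_space1) simp

lemma unit_uniform_rescale:
  fixes g :: "real \<Rightarrow> real"
  assumes T: "0 < T"
  shows "set_integrable lborel {0..T} g \<longleftrightarrow> integrable unit_uniform (\<lambda>s. g (T * s))"
    and "(1 / T) * (LBINT t:{0..T}. g t) = (\<integral>s. g (T * s) \<partial>unit_uniform)"
proof -
  have ind: "indicator {0..T} (0 + T * s) *\<^sub>R g (0 + T * s) = indicator {0..1} s *\<^sub>R g (T * s)" for s
    using T by (auto simp: indicator_def zero_le_mult_iff)
  show "set_integrable lborel {0..T} g \<longleftrightarrow> integrable unit_uniform (\<lambda>s. g (T * s))"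
    unfolding set_integrable_def unit_uniform_def
    using lborel_integrable_real_affine_iff[of T "\<lambda>t. indicator {0..T} t *\<^sub>R g t" 0] T
    by (simp only: ind) (simp add: integrable_restrict_space)
  have "(LBINT t:{0..T}. g t) = T *\<^sub>R (\<integral>s. indicator {0..1} s *\<^sub>R g (T * s) \<partial>lborel)"
    unfolding set_lebesgue_integral_def
    using lborel_integral_real_affine[of T "\<lambda>t. indicator {0..T} t *\<^sub>R g t" 0] T
    by (simp only: ind)
  also have "(\<integral>s. indicator {0..1} s *\<^sub>R g (T * s) \<partial>lborel) = (\<integral>s. g (T * s) \<partial>unit_uniform)"
    unfolding unit_uniform_def by (simp add: integral_restrict_space)
  finally show "(1 / T) * (LBINT t:{0..T}. g t) = (\<integral>s. g (T * s) \<partial>unit_uniform)"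
    using T by simp
qed

lemma AE_unit_uniform_pos: "AE s in unit_uniform. 0 < s"
proof -
  have "AE s in lborel. s \<noteq> (0::real)" by (rule AE_lborel_singleton)
  then have "AE s in lborel. s \<in> {0..1} \<longrightarrow> (0::real) < s" by eventually_elim auto
  then show ?thesis unfolding unit_uniform_def by (subst AE_restrict_space_iff) auto
qed

context contracting_markov_family
begin

definition time_kern :: "real \<Rightarrow> 's \<times> real \<Rightarrow> 's measure" where
  "time_kern T p = kern (T * snd p) (fst p)"

definition time_op :: "real \<Rightarrow> ('s \<Rightarrow> real) \<Rightarrow> 's \<times> real \<Rightarrow> real" where
  "time_op T f p = (\<integral>y. f y \<partial>time_kern T p)"

text \<open>Draw the initial state from \<open>\<nu>\<close> and an independent uniform time \<open>s\<close> in \<open>{0..1}\<close>. The kernel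
  \<open>time_kern T\<close> then reproduces \<open>\<nu>\<close>, so \<open>time_op T\<close> is a contraction of square-integrable functions,
  and averaging it over \<open>s\<close> gives the time average. The mean square error of the time average is at
  most that of \<open>time_op T\<close>, which tends to 0 for test functions and hence, by density, in general.\<close>

lemma ergodic_if_stationary:
  assumes st: "\<And>t. 0 \<le> t \<Longrightarrow> stationary_at t \<nu>"
  shows "ergodic M X \<nu>"
proof -
  have \<nu>: "prob_space \<nu>" and sets: "sets \<nu> = sets states" using st[of 0] by (auto simp: stationary_at_def)
  have sp: "space \<nu> = C" using sets_eq_imp_space_eq[OF sets] by (simp add: space_states)
  interpret \<nu>: prob_space \<nu> by fact
  interpret U: prob_space unit_uniform by (rule prob_space_unit_uniform)
  interpret N: pair_prob_space \<nu> unit_uniform by unfold_locales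
  let ?N = "\<nu> \<Otimes>\<^sub>M unit_uniform"
  have spN: "p \<in> space ?N \<longleftrightarrow> fst p \<in> C \<and> 0 \<le> snd p \<and> snd p \<le> 1" for p
    by (cases p) (auto simp: space_pair_measure sp space_unit_uniform)
  have J: "time_kern T \<in> ?N \<rightarrow>\<^sub>M prob_algebra states" for T
  proof -
    have "snd \<in> ?N \<rightarrow>\<^sub>M (borel :: real measure)"
      by (rule measurable_compose[OF measurable_snd unit_uniform_to_borel])
    then have 1: "(\<lambda>p. T * snd p) \<in> ?N \<rightarrow>\<^sub>M borel" by measurable
    have 2: "fst \<in> ?N \<rightarrow>\<^sub>M states"
      using measurable_fst[of \<nu> unit_uniform] unfolding measurable_cong_sets[OF refl sets] .
    from measurable_compose[OF measurable_Pair[OF 1 2] kern_measurable] show ?thesis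
      by (simp add: time_kern_def[abs_def])
  qed
  have bind: "?N \<bind> time_kern T = \<nu>" if T: "0 \<le> T" for T
  proof (rule measure_eqI)
    note J' = measurable_prob_algebraD[OF J[of T]]
    have ne: "space ?N \<noteq> {}" by (rule N.not_empty)
    show s: "sets (?N \<bind> time_kern T) = sets \<nu>" using sets_kernel[OF J'] ne sets by simp
    fix A assume "A \<in> sets (?N \<bind> time_kern T)"
    then have A: "A \<in> sets states" using s sets by simp
    have m: "(\<lambda>p. emeasure (time_kern T p) A) \<in> borel_measurable ?N"
      by (rule measurable_compose[OF J' measurable_emeasure_subprob_algebra[OF A]])
    have "emeasure (?N \<bind> time_kern T) A = (\<integral>\<^sup>+p. emeasure (time_kern T p) A \<partial>?N)"
      by (rule emeasure_bind[OF ne J' A])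
    also have "\<dots> = (\<integral>\<^sup>+s. \<integral>\<^sup>+x. emeasure (time_kern T (x, s)) A \<partial>\<nu> \<partial>unit_uniform)"
      by (rule N.nn_integral_snd[symmetric]) (use m in \<open>simp add: case_prod_unfold\<close>)
    also have "\<dots> = (\<integral>\<^sup>+s. emeasure \<nu> A \<partial>unit_uniform)"
    proof (rule nn_integral_cong)
      fix s assume "s \<in> space unit_uniform"
      then have s: "stationary_at (T * s) \<nu>" using T by (auto simp: space_unit_uniform intro!: st)
      have "emeasure \<nu> A = emeasure (\<nu> \<bind> kern (T * s)) A" using s by (simp add: stationary_at_def)
      also have "\<dots> = (\<integral>\<^sup>+x. emeasure (kern (T * s) x) A \<partial>\<nu>)"
        by (rule emeasure_bind[OF \<nu>.not_empty measurable_prob_algebraD[OF stationary_kern_measurable[OF s]] A])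
      finally show "(\<integral>\<^sup>+x. emeasure (time_kern T (x, s)) A \<partial>\<nu>) = emeasure \<nu> A"
        by (simp add: time_kern_def)
    qed
    also have "\<dots> = emeasure \<nu> A" by (simp add: U.emeasure_space_1)
    finally show "emeasure (?N \<bind> time_kern T) A = emeasure \<nu> A" .
  qed
  have borel_states: "f \<in> borel_measurable states" if "f \<in> borel_measurable \<nu>" for f :: "'s \<Rightarrow> real"
    using that unfolding measurable_cong_sets[OF sets refl] .
  note L2 = kernel_L2[OF N.prob_space_axioms \<nu> J bind sets, folded time_op_def]
  have op: "time_op T f (x, s) = transition_op M X (T * s) f x"
    if "f \<in> borel_measurable \<nu>" "0 \<le> T" "x \<in> C" "0 \<le> s" for T f x s
    using transition_op_kern[OF that(3) _ borel_states[OF that(1)], of "T * s"] that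
    by (simp add: time_op_def time_kern_def)
  have avg: "time_average M X T f x = (\<integral>s. time_op T f (x, s) \<partial>unit_uniform)"
    if "f \<in> borel_measurable \<nu>" "0 < T" "x \<in> C" for T f x
    unfolding time_average_def unit_uniform_rescale(2)[OF that(2)]
    using that by (intro Bochner_Integration.integral_cong refl op[symmetric]) (auto simp: space_unit_uniform)

  have err_lipschitz: "((\<lambda>T. \<integral>p. (time_op T f p - (\<integral>y. f y \<partial>\<nu>))\<^sup>2 \<partial>?N) \<longlongrightarrow> 0) at_top"
    if f: "bounded_lipschitz f" for f
  proof (rule tendsto_at_topI_sequentially)
    fix \<tau> :: "nat \<Rightarrow> real" assume \<tau>: "filterlim \<tau> at_top sequentially"
    obtain b L where b: "\<And>x. \<bar>f x\<bar> \<le> b" "0 \<le> b" using bounded_lipschitzE[OF f] by metis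
    note fS = bounded_lipschitz_borel_on[OF f, of C]
    let ?m = "\<integral>y. f y \<partial>\<nu>"
    have mb: "\<bar>?m\<bar> \<le> b"
    proof -
      have "\<bar>?m\<bar> \<le> (\<integral>y. \<bar>f y\<bar> \<partial>\<nu>)" by (rule integral_abs_bound)
      also have "\<dots> \<le> (\<integral>y. b \<partial>\<nu>)"
        using b by (intro integral_mono integrable_abs bounded_lipschitz_integrable[OF \<nu>.finite_measure_axioms
              measurable_ident_borel[OF sets] f]) auto
      finally show ?thesis by (simp add: \<nu>.prob_space)
    qed
    have m: "time_op T f \<in> borel_measurable ?N" for T
      unfolding time_op_def
      by (rule measurable_compose[OF measurable_prob_algebraD[OF J] integral_measurable_subprob_algebra[OF fS]])
    have opE: "time_op T f (x, s) = expectation (\<lambda>w. f (X x (max 0 (T * s)) w))" if "x \<in> C" for T x s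
      using integral_kern[OF that _ fS, of "max 0 (T * s)"] by (simp add: time_op_def time_kern_def kern_def)
    have ob: "\<bar>time_op T f p\<bar> \<le> b" if pN: "p \<in> space ?N" for T p
    proof -
      obtain x s where p: "p = (x, s)" "x \<in> C" using pN spN by (cases p) auto
      have "\<bar>time_op T f p\<bar> \<le> expectation (\<lambda>w. \<bar>f (X x (max 0 (T * s)) w)\<bar>)"
        unfolding p(1) opE[OF p(2)] by (rule integral_abs_bound)
      also have "\<dots> \<le> expectation (\<lambda>w. b)"
        by (intro integral_mono integrable_abs bounded_lipschitz_integrable[OF finite_measure_axioms state_borel f] b p) auto
      finally show ?thesis by (simp add: prob_space)
    qed
    have "(\<lambda>k. \<integral>p. (time_op (\<tau> k) f p - ?m)\<^sup>2 \<partial>?N) \<longlonglongrightarrow> (\<integral>p. 0 \<partial>?N)"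
    proof (rule integral_dominated_convergence[where w = "\<lambda>_. (2 * b)\<^sup>2"])
      have pos: "AE p in ?N. 0 < snd p"
      proof (rule N.AE_pair_measure)
        show "{p \<in> space ?N. 0 < snd p} \<in> sets ?N"
          using measurable_compose[OF measurable_snd[of \<nu>] unit_uniform_to_borel] by measurable
      qed (use AE_unit_uniform_pos in simp)
      show "AE p in ?N. (\<lambda>k. (time_op (\<tau> k) f p - ?m)\<^sup>2) \<longlonglongrightarrow> 0"
        using pos AE_space
      proof eventually_elim
        case (elim p)
        obtain x s where p: "p = (x, s)" "x \<in> C" "0 < s" using elim spN by (cases p) auto
        have "filterlim (\<lambda>k. s * \<tau> k) at_top sequentially"
          by (rule filterlim_tendsto_pos_mult_at_top[OF tendsto_const p(3) \<tau>])
        then have lim: "filterlim (\<lambda>k. max 0 (\<tau> k * s)) at_top sequentially"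
          by (rule filterlim_at_top_mono) (auto simp: mult.commute intro!: always_eventually)
        have "(\<lambda>k. time_op (\<tau> k) f p) \<longlonglongrightarrow> ?m"
          unfolding p(1) opE[OF p(2)] by (rule stationary_mixing[OF st _ lim f p(2)]) auto
        from tendsto_power[OF tendsto_diff[OF this tendsto_const[of ?m]], of 2] show ?case by simp
      qed
      show "AE p in ?N. norm ((time_op (\<tau> k) f p - ?m)\<^sup>2) \<le> (2 * b)\<^sup>2" for k
      proof (rule AE_I2)
        fix p assume "p \<in> space ?N"
        then have "\<bar>time_op (\<tau> k) f p - ?m\<bar> \<le> \<bar>2 * b\<bar>" using ob[of p "\<tau> k"] mb b(2) by linarith
        then show "norm ((time_op (\<tau> k) f p - ?m)\<^sup>2) \<le> (2 * b)\<^sup>2"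
          unfolding abs_le_square_iff by simp
      qed
    qed (use m in auto)
    then show "(\<lambda>k. \<integral>p. (time_op (\<tau> k) f p - ?m)\<^sup>2 \<partial>?N) \<longlonglongrightarrow> 0" by simp
  qed

  show ?thesis
    unfolding ergodic_def
  proof (intro ballI conjI allI impI)
    fix f :: "'s \<Rightarrow> real" assume "f \<in> L2 \<nu>"
    then have f: "f \<in> borel_measurable \<nu>" "integrable \<nu> (\<lambda>x. (f x)\<^sup>2)" by (auto simp: L2_def)
    have fi: "integrable \<nu> f" by (rule \<nu>.square_expectation_le(1)[OF f])
    let ?m = "\<integral>y. f y \<partial>\<nu>"
    show "AE x in \<nu>. integrable M (\<lambda>w. f (X x t w))" if t: "0 \<le> t" for t
    proof -
      have "AE x in \<nu>. integrable (kern t x) f"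
        using st[OF t] by (intro kernel_L2(1)[OF \<nu> \<nu> stationary_kern_measurable[OF st[OF t]] _ sets f])
          (simp add: stationary_at_def)
      with AE_space show ?thesis
        by eventually_elim (simp add: sp integrable_kern_iff[OF _ t borel_states[OF f(1)]])
    qed
    have sq: "time_op T f \<in> borel_measurable ?N" "integrable ?N (\<lambda>p. (time_op T f p)\<^sup>2)" if "0 < T" for T
      using L2(2,3)[of T f] f that by auto
    have sqi: "integrable ?N (time_op T f)" if "0 < T" for T
      by (rule N.square_expectation_le(1)[OF sq[OF that]])
    have sq0: "(\<lambda>p. time_op T f p - ?m) \<in> borel_measurable ?N" "integrable ?N (\<lambda>p. (time_op T f p - ?m)\<^sup>2)"
      if "0 < T" for T
      using sq[OF that] sqi[OF that] by (auto simp: power2_diff intro!: Bochner_Integration.integrable_diff)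
    note sect = N.square_integral_section_le[OF sq] and sect0 = N.square_integral_section_le[OF sq0]
    show "AE x in \<nu>. set_integrable lborel {0..T} (\<lambda>t. transition_op M X t f x)" if T: "0 < T" for T
      using sect(1)[OF T T] AE_space
    proof eventually_elim
      case (elim x)
      have "integrable unit_uniform (\<lambda>s. transition_op M X (T * s) f x)"
        by (rule Bochner_Integration.integrable_cong[OF refl, THEN iffD1, OF _ elim(1)])
          (use T elim(2) in \<open>auto simp: space_unit_uniform sp intro!: op f\<close>)
      then show ?case by (simp add: unit_uniform_rescale(1)[OF T])
    qed
    have avg_meas: "time_average M X T f \<in> borel_measurable \<nu>" if T: "0 < T" for T
    proof -
      have "(\<lambda>x. \<integral>s. time_op T f (x, s) \<partial>unit_uniform) \<in> borel_measurable \<nu>"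
        by (rule borel_measurable_integrable[OF N.integrable_fst'[OF sqi[OF T]]])
      then show ?thesis
        by (rule measurable_cong[THEN iffD2, rotated]) (simp add: sp avg[OF f(1) T])
    qed
    show "time_average M X T f \<in> L2 \<nu>" if T: "0 < T" for T
    proof -
      have "integrable \<nu> (\<lambda>x. (time_average M X T f x)\<^sup>2)"
        by (rule Bochner_Integration.integrable_cong[OF refl, THEN iffD2, OF _ sect(2)[OF T T]]) (simp add: sp avg[OF f(1) T])
      then show ?thesis using avg_meas[OF T] by (simp add: L2_def)
    qed
    have err: "(\<integral>x. (time_average M X T f x - ?m)\<^sup>2 \<partial>\<nu>) \<le> (\<integral>p. (time_op T f p - ?m)\<^sup>2 \<partial>?N)"
      if T: "0 < T" for T
    proof -
      have "(\<integral>x. (time_average M X T f x - ?m)\<^sup>2 \<partial>\<nu>)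
          = (\<integral>x. (\<integral>s. time_op T f (x, s) - ?m \<partial>unit_uniform)\<^sup>2 \<partial>\<nu>)"
      proof (rule integral_cong_AE)
        show "AE x in \<nu>. (time_average M X T f x - ?m)\<^sup>2 = (\<integral>s. time_op T f (x, s) - ?m \<partial>unit_uniform)\<^sup>2"
          using sect(1)[OF T T] AE_space
          by eventually_elim (simp add: avg[OF f(1) T] sp U.prob_space)
      qed (use avg_meas[OF T] borel_measurable_integrable[OF sect0(2)[OF T T]] in auto)
      also have "\<dots> \<le> (\<integral>p. (time_op T f p - ?m)\<^sup>2 \<partial>?N)" by (rule sect0(3)[OF T T])
      finally show ?thesis .
    qed
    show "((\<lambda>T. \<integral>x. (time_average M X T f x - ?m)\<^sup>2 \<partial>\<nu>) \<longlongrightarrow> 0) at_top"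
    proof (rule tendstoI)
      fix \<epsilon> :: real assume \<epsilon>: "0 < \<epsilon>"
      then have "0 < \<epsilon> / 9" by simp
      then obtain g where g: "bounded_lipschitz g" "integrable \<nu> (\<lambda>x. (f x - g x)\<^sup>2)"
          "(\<integral>x. (f x - g x)\<^sup>2 \<partial>\<nu>) < \<epsilon> / 9"
        by (rule bounded_lipschitz_dense_L2[OF \<nu>.finite_measure_axioms sets closed f]) (rule that)
      have gi: "integrable \<nu> g"
        by (rule bounded_lipschitz_integrable[OF \<nu>.finite_measure_axioms measurable_ident_borel[OF sets] g(1)])
      have gm: "g \<in> borel_measurable \<nu>" using gi by (rule borel_measurable_integrable)
      obtain b where "\<And>x. \<bar>g x\<bar> \<le> b" using bounded_lipschitzE[OF g(1)] by metis
      then have g2: "integrable \<nu> (\<lambda>x. (g x)\<^sup>2)"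
        by (intro \<nu>.integrable_const_bound[where B = "b\<^sup>2"])
          (use gm in \<open>auto intro!: always_eventually abs_le_square_iff[THEN iffD1] order_trans[OF _ abs_ge_self]\<close>)
      let ?h = "\<lambda>x. f x - g x" and ?k = "\<integral>y. g y \<partial>\<nu>"
      have h: "?h \<in> borel_measurable \<nu>" "integrable \<nu> (\<lambda>x. (?h x)\<^sup>2)" using f(1) gm g(2) by auto
      have mk: "(?k - ?m)\<^sup>2 < \<epsilon> / 9"
      proof -
        have "(?k - ?m)\<^sup>2 = (\<integral>x. ?h x \<partial>\<nu>)\<^sup>2" using fi gi by (simp add: power2_commute)
        also have "\<dots> \<le> (\<integral>x. (?h x)\<^sup>2 \<partial>\<nu>)" by (rule \<nu>.square_expectation_le(2)[OF h])
        finally show ?thesis using g(3) by simp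
      qed
      have "\<forall>\<^sub>F T in at_top. (\<integral>p. (time_op T g p - ?k)\<^sup>2 \<partial>?N) < \<epsilon> / 9"
        using \<epsilon> by (intro order_tendstoD(2)[OF err_lipschitz[OF g(1)]]) simp
      then show "\<forall>\<^sub>F T in at_top. dist (\<integral>x. (time_average M X T f x - ?m)\<^sup>2 \<partial>\<nu>) 0 < \<epsilon>"
        using eventually_gt_at_top[of 0]
      proof eventually_elim
        case (elim T)
        then have T: "0 < T" "0 \<le> T" by auto
        note hT = L2[OF T(2) h] and gT = L2[OF T(2) gm g2] and fT = L2[OF T(2) f]
        have gTi: "integrable ?N (time_op T g)" by (rule N.square_expectation_le(1)[OF gT(2,3)])
        have gT0: "integrable ?N (\<lambda>p. (time_op T g p - ?k)\<^sup>2)"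
          using gT(3) gTi by (auto simp: power2_diff intro!: Bochner_Integration.integrable_diff)
        \<comment> \<open>The deviation splits into the parts due to \<open>f - g\<close>, to \<open>g\<close>, and to the difference of the means;
          each has mean square below \<open>\<epsilon> / 9\<close>, and the square of a sum of three is at most three times the
          sum of the squares.\<close>
        have bd: "AE p in ?N. (time_op T f p - ?m)\<^sup>2
            \<le> 3 * (time_op T ?h p)\<^sup>2 + 3 * (time_op T g p - ?k)\<^sup>2 + 3 * (?k - ?m)\<^sup>2"
          using fT(1) gT(1)
        proof eventually_elim
          case (elim p)
          have "time_op T ?h p = time_op T f p - time_op T g p"
            unfolding time_op_def by (rule Bochner_Integration.integral_diff[OF elim])
          then have e: "time_op T f p - ?m = time_op T ?h p + (time_op T g p - ?k) + (?k - ?m)" by simp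
          have "(u + v + w)\<^sup>2 \<le> 3 * u\<^sup>2 + 3 * v\<^sup>2 + 3 * w\<^sup>2" for u v w :: real
            using zero_le_power2[of "u - v"] zero_le_power2[of "v - w"] zero_le_power2[of "u - w"]
            unfolding power2_diff power2_sum by (simp add: algebra_simps)
          then show ?case unfolding e .
        qed
        have "(\<integral>p. (time_op T f p - ?m)\<^sup>2 \<partial>?N)
            \<le> (\<integral>p. 3 * (time_op T ?h p)\<^sup>2 + 3 * (time_op T g p - ?k)\<^sup>2 + 3 * (?k - ?m)\<^sup>2 \<partial>?N)"
          by (intro integral_mono_AE bd sq0 T) (use hT(3) gT0 in auto)
        also have "\<dots> = 3 * (\<integral>p. (time_op T ?h p)\<^sup>2 \<partial>?N) + 3 * (\<integral>p. (time_op T g p - ?k)\<^sup>2 \<partial>?N) + 3 * (?k - ?m)\<^sup>2"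
          using hT(3) gT0 by (simp add: N.prob_space)
        also have "\<dots> < \<epsilon>" using hT(4) g(3) elim(1) mk by linarith
        finally have "(\<integral>x. (time_average M X T f x - ?m)\<^sup>2 \<partial>\<nu>) < \<epsilon>" using err[OF T(1)] by linarith
        then show ?case by (simp add: dist_real_def integral_nonneg_AE)
      qed
    qed
  qed
qed

theorem exists_unique_ergodic_invariant_measure:
  "\<exists>\<nu>. invariant_measure M states X \<nu> \<and> (\<forall>\<mu>. invariant_measure M states X \<mu> \<longrightarrow> \<mu> = \<nu>) \<and> ergodic M X \<nu>"
proof -
  obtain \<nu> where \<nu>: "stationary_at 1 \<nu>" using stationary_at_one_exists by auto
  have "\<mu> = \<nu>" if "invariant_measure M states X \<mu>" for \<mu>
    using that \<nu> by (intro stationary_at_one_unique) (auto simp: invariant_measure_iff_stationary)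
  moreover have "invariant_measure M states X \<nu>"
    using stationary_at_all_times[OF \<nu>] by (simp add: invariant_measure_iff_stationary)
  ultimately show ?thesis using ergodic_if_stationary[OF stationary_at_all_times[OF \<nu>]] by blast
qed

end


section \<open>Dissipative equations with additive noise\<close>

text \<open>The function \<open>exp (2 * c * t) * (norm (u t))\<^sup>2\<close> has nonpositive derivative.\<close>

lemma norm_contracts_if_dissipative:
  fixes u g :: "real \<Rightarrow> 'a::{real_inner, banach}"
  assumes u: "\<And>t. 0 \<le> t \<Longrightarrow> u t = u0 + integral {0..t} g" and g: "continuous_on {0..} g"
    and diss: "\<And>t. 0 \<le> t \<Longrightarrow> u t \<bullet> g t \<le> - c * (norm (u t))\<^sup>2" and t: "0 \<le> t"
  shows "norm (u t) \<le> exp (- c * t) * norm u0"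
proof -
  define \<phi> where "\<phi> s = exp (2 * c * s) * ((u0 + integral {0..s} g) \<bullet> (u0 + integral {0..s} g))" for s
  have gt: "continuous_on {0..t} g" using g by (rule continuous_on_subset) auto
  have ic: "continuous_on {0..t} (\<lambda>s. integral {0..s} g)"
    by (rule indefinite_integral_continuous_1[OF integrable_continuous_real[OF gt]])
  have "\<phi> t \<le> \<phi> 0"
  proof (rule DERIV_nonpos_imp_decreasing_open[OF t])
    show "continuous_on {0..t} \<phi>" unfolding \<phi>_def by (intro continuous_intros ic)
    fix s assume s: "0 < s" "s < t"
    have "((\<lambda>s. integral {0..s} g) has_vector_derivative g s) (at s within {0..t})"
      by (rule integral_has_vector_derivative[OF gt]) (use s in auto)
    then have d: "((\<lambda>s. integral {0..s} g) has_vector_derivative g s) (at s)"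
      using s by (simp add: at_within_Icc_at)
    have us: "u s = u0 + integral {0..s} g" using u s by simp
    have dd: "((\<lambda>s. u0 + integral {0..s} g) has_derivative (\<lambda>h. h *\<^sub>R g s)) (at s)"
      using has_derivative_add[OF has_derivative_const[of u0] d[unfolded has_vector_derivative_def]] by simp
    have "((\<lambda>s. (u0 + integral {0..s} g) \<bullet> (u0 + integral {0..s} g)) has_real_derivative 2 * (u s \<bullet> g s)) (at s)"
      unfolding has_field_derivative_def
      by (rule has_derivative_eq_rhs[OF has_derivative_inner[OF dd dd]]) (simp add: us inner_commute fun_eq_iff)
    moreover have "((\<lambda>s. exp (2 * c * s)) has_real_derivative exp (2 * c * s) * (2 * c)) (at s)"
      by (auto intro!: derivative_eq_intros)
    ultimately have "(\<phi> has_real_derivative 2 * c * exp (2 * c * s) * (u s \<bullet> u s) + exp (2 * c * s) * (2 * (u s \<bullet> g s))) (at s)"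
      unfolding \<phi>_def us by (auto intro!: derivative_eq_intros)
    moreover have "2 * c * exp (2 * c * s) * (u s \<bullet> u s) + exp (2 * c * s) * (2 * (u s \<bullet> g s)) \<le> 0"
    proof -
      have "u s \<bullet> g s \<le> - c * (u s \<bullet> u s)" using diss[of s] s by (simp add: power2_norm_eq_inner)
      then have "exp (2 * c * s) * (2 * (u s \<bullet> g s)) \<le> exp (2 * c * s) * (2 * (- c * (u s \<bullet> u s)))"
        by (intro mult_left_mono) auto
      then show ?thesis by (simp add: algebra_simps)
    qed
    ultimately show "\<exists>y. DERIV \<phi> s :> y \<and> y \<le> 0" by blast
  qed
  then have "exp (2 * c * t) * (norm (u t))\<^sup>2 \<le> (norm u0)\<^sup>2"
    using u[OF t] by (simp add: \<phi>_def power2_norm_eq_inner)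
  moreover have "exp (2 * c * t) * (norm (u t))\<^sup>2 = (exp (c * t) * norm (u t))\<^sup>2"
    by (simp add: power_mult_distrib exp_double[symmetric] mult.assoc)
  ultimately have "(exp (c * t) * norm (u t))\<^sup>2 \<le> (norm u0)\<^sup>2" by simp
  then have "exp (c * t) * norm (u t) \<le> norm u0" by (rule power2_le_imp_le) simp
  then have "exp (- c * t) * (exp (c * t) * norm (u t)) \<le> exp (- c * t) * norm u0"
    by (intro mult_left_mono) auto
  moreover have "exp (- c * t) * exp (c * t) = 1" by (simp flip: exp_add)
  then have "exp (- c * t) * (exp (c * t) * norm (u t)) = norm (u t)"
    by (simp only: mult.assoc[symmetric] mult_1_left)
  ultimately show ?thesis by linarith
qed

primrec euler :: "('a::real_vector \<Rightarrow> 'a) \<Rightarrow> real \<Rightarrow> (nat \<Rightarrow> 'a) \<Rightarrow> 'a \<Rightarrow> nat \<Rightarrow> 'a" where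
  "euler G h \<xi> y 0 = y"
| "euler G h \<xi> y (Suc k) = euler G h \<xi> y k + h *\<^sub>R G (euler G h \<xi> y k) + \<xi> k"

lemma growth_factor_le_exp: "0 \<le> x \<Longrightarrow> (1 + x) ^ n \<le> exp (real n * (x::real))"
  using power_mono[of "1 + x" "exp x" n] by (simp add: exp_of_nat_mult)

text \<open>Over one step the drift is evaluated at the scheme instead of at the solution. The Lipschitz bound
  turns this into the present error plus the oscillation \<open>\<epsilon>\<close> of the solution over a step; since the
  noise is additive, its increments cancel.\<close>

lemma euler_error:
  fixes x W :: "real \<Rightarrow> 'a::banach"
  assumes G: "\<And>u v. norm (G u - G v) \<le> K * norm (u - v)" and K: "0 \<le> K" and h: "0 \<le> h"
    and cont: "continuous_on {a..a + real N * h} (\<lambda>s. G (x s))"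
    and eq: "\<And>r r'. a \<le> r \<Longrightarrow> r \<le> r' \<Longrightarrow> x r' = x r + integral {r..r'} (\<lambda>s. G (x s)) + (W r' - W r)"
    and osc: "\<And>r r'. a \<le> r \<Longrightarrow> r \<le> r' \<Longrightarrow> r' \<le> r + h \<Longrightarrow> r' \<le> a + real N * h \<Longrightarrow> norm (x r' - x r) \<le> \<epsilon>"
    and k: "k \<le> N"
  shows "norm (x (a + real k * h) - euler G h (\<lambda>k. W (a + real (Suc k) * h) - W (a + real k * h)) (x a) k)
    \<le> real k * h * K * \<epsilon> * (1 + h * K) ^ k"
  using k
proof (induction k)
  case (Suc k)
  define y where "y = euler G h (\<lambda>k. W (a + real (Suc k) * h) - W (a + real k * h)) (x a) k"
  define r where "r = a + real k * h"
  have r': "a + real (Suc k) * h = r + h" by (simp add: r_def algebra_simps)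
  have kN: "real (Suc k) * h \<le> real N * h" using Suc(2) h by (intro mult_right_mono) auto
  have rb: "a \<le> r" "r \<le> r + h" "r + h \<le> a + real N * h"
    using h kN by (auto simp: r_def algebra_simps)
  have \<epsilon>: "0 \<le> \<epsilon>" using osc[of r r] rb h by simp
  have IH: "norm (x r - y) \<le> real k * h * K * \<epsilon> * (1 + h * K) ^ k"
    using Suc by (simp add: y_def r_def)
  have c: "continuous_on {r..r + h} (\<lambda>s. G (x s))"
    by (rule continuous_on_subset[OF cont]) (use rb in auto)
  have "x (r + h) - (y + h *\<^sub>R G y + (W (r + h) - W r)) = (x r - y) + (integral {r..r + h} (\<lambda>s. G (x s)) - h *\<^sub>R G y)"
    using eq[OF rb(1,2)] by (simp add: algebra_simps)
  also have "integral {r..r + h} (\<lambda>s. G (x s)) - h *\<^sub>R G y = integral {r..r + h} (\<lambda>s. G (x s) - G y)"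
    using h by (subst integral_diff) (auto intro!: integrable_continuous_real c)
  finally have e: "norm (x (r + h) - (y + h *\<^sub>R G y + (W (r + h) - W r)))
      \<le> norm (x r - y) + norm (integral {r..r + h} (\<lambda>s. G (x s) - G y))"
    by (metis norm_triangle_ineq)
  have "norm (integral {r..r + h} (\<lambda>s. G (x s) - G y)) \<le> (K * (\<epsilon> + norm (x r - y))) * (r + h - r)"
  proof (rule integral_bound)
    fix s assume s: "s \<in> {r..r + h}"
    have "norm (x s - x r) \<le> \<epsilon>" using s rb by (intro osc) auto
    then have "norm (x s - y) \<le> \<epsilon> + norm (x r - y)" using norm_triangle_ineq[of "x s - x r" "x r - y"] by simp
    from order_trans[OF G mult_left_mono[OF this K]]
    show "norm (G (x s) - G y) \<le> K * (\<epsilon> + norm (x r - y))" .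
  qed (use h c in \<open>auto intro!: continuous_intros\<close>)
  with e have "norm (x (r + h) - (y + h *\<^sub>R G y + (W (r + h) - W r))) \<le> (1 + h * K) * norm (x r - y) + h * K * \<epsilon>"
    by (simp add: algebra_simps)
  also have "\<dots> \<le> (1 + h * K) * (real k * h * K * \<epsilon> * (1 + h * K) ^ k) + h * K * \<epsilon> * (1 + h * K) ^ Suc k"
  proof (intro add_mono mult_left_mono IH)
    have "h * K * \<epsilon> * 1 \<le> h * K * \<epsilon> * (1 + h * K) ^ Suc k"
      using h K \<epsilon> by (intro mult_left_mono one_le_power) auto
    then show "h * K * \<epsilon> \<le> h * K * \<epsilon> * (1 + h * K) ^ Suc k" by simp
  qed (use h K in auto)
  also have "\<dots> = real (Suc k) * h * K * \<epsilon> * (1 + h * K) ^ Suc k" by (simp add: algebra_simps)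
  finally show ?case unfolding r' by (simp add: y_def r_def algebra_simps)
qed simp

text \<open>The error bound is uniform in the number of steps up to the oscillation of the path, which vanishes
  with the step size by uniform continuity. The number of steps is \<open>Suc N\<close> so that the step size is
  positive for every \<open>N\<close>.\<close>

lemma euler_tendsto:
  fixes x W :: "real \<Rightarrow> 'a::banach"
  assumes G: "\<And>u v. norm (G u - G v) \<le> K * norm (u - v)" and K: "0 \<le> K" and t: "0 < t"
    and cont: "continuous_on {a..} x"
    and eq: "\<And>r r'. a \<le> r \<Longrightarrow> r \<le> r' \<Longrightarrow> x r' = x r + integral {r..r'} (\<lambda>s. G (x s)) + (W r' - W r)"
  shows "(\<lambda>N. euler G (t / real (Suc N)) (\<lambda>k. W (a + real (Suc k) * (t / real (Suc N))) - W (a + real k * (t / real (Suc N))))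
      (x a) (Suc N)) \<longlonglongrightarrow> x (a + t)"
proof (rule metric_LIMSEQ_I)
  let ?Y = "\<lambda>N. euler G (t / real (Suc N)) (\<lambda>k. W (a + real (Suc k) * (t / real (Suc N))) - W (a + real k * (t / real (Suc N))))
      (x a) (Suc N)"
  fix \<epsilon> :: real assume \<epsilon>: "0 < \<epsilon>"
  have Gc: "continuous_on UNIV G"
  proof (rule lipschitz_on_continuous_on)
    show "K-lipschitz_on UNIV G" using G K by (auto simp: lipschitz_on_def dist_norm)
  qed
  define \<epsilon>' where "\<epsilon>' = \<epsilon> / (t * K * exp (t * K) + 1)"
  have pos: "0 \<le> t * K * exp (t * K)" using t K by auto
  have \<epsilon>': "0 < \<epsilon>'" using \<epsilon> pos by (simp add: \<epsilon>'_def)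
  have "uniformly_continuous_on {a..a + t} x"
    by (intro compact_uniformly_continuous continuous_on_subset[OF cont]) auto
  then obtain \<delta> where \<delta>: "0 < \<delta>" "\<And>r r'. r \<in> {a..a+t} \<Longrightarrow> r' \<in> {a..a+t} \<Longrightarrow> dist r' r < \<delta> \<Longrightarrow> dist (x r') (x r) < \<epsilon>'"
    using \<epsilon>' unfolding uniformly_continuous_on_def by metis
  obtain N0 :: nat where N0: "t / \<delta> < real N0" using reals_Archimedean2 by blast
  have "dist (?Y N) (x (a + t)) < \<epsilon>" if N: "N \<ge> N0" for N
  proof -
    define h where "h = t / real (Suc N)"
    have h: "0 < h" "real (Suc N) * h = t" using t by (auto simp: h_def)
    have "t < \<delta> * real (Suc N)" using N0 N \<delta>(1) by (simp add: field_simps) (smt (verit) mult_left_mono of_nat_mono)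
    then have h\<delta>: "h < \<delta>" by (simp add: h_def field_simps)
    have "norm (x (a + real (Suc N) * h) - euler G h (\<lambda>k. W (a + real (Suc k) * h) - W (a + real k * h)) (x a) (Suc N))
        \<le> real (Suc N) * h * K * \<epsilon>' * (1 + h * K) ^ Suc N"
    proof (rule euler_error[OF G K less_imp_le[OF h(1)] _ eq _ order_refl])
      show "continuous_on {a..a + real (Suc N) * h} (\<lambda>s. G (x s))"
        by (rule continuous_on_compose2[OF Gc continuous_on_subset[OF cont]]) auto
      fix r r' assume "a \<le> r" "r \<le> r'" "r' \<le> r + h" "r' \<le> a + real (Suc N) * h"
      then have "r \<in> {a..a+t}" "r' \<in> {a..a+t}" "dist r' r < \<delta>"
        using h h\<delta> by (auto simp: dist_real_def)
      then show "norm (x r' - x r) \<le> \<epsilon>'" using \<delta>(2)[of r r'] by (simp add: dist_norm)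
    qed
    also have "\<dots> \<le> (t * K * \<epsilon>') * exp (t * K)"
    proof -
      have "(1 + h * K) ^ Suc N \<le> exp (real (Suc N) * (h * K))"
        by (rule growth_factor_le_exp) (use h K in auto)
      also have "real (Suc N) * (h * K) = t * K" using h(2) by (simp add: mult.assoc[symmetric])
      finally show ?thesis unfolding h(2) using t K \<epsilon>' by (intro mult_left_mono) auto
    qed
    also have "\<dots> = (t * K * exp (t * K)) * \<epsilon>'" by simp
    also have "\<dots> < (t * K * exp (t * K) + 1) * \<epsilon>'" using \<epsilon>' by (simp add: distrib_right)
    also have "\<dots> = \<epsilon>" using pos by (simp add: \<epsilon>'_def)
    finally show ?thesis unfolding h(2) by (simp add: h_def dist_norm norm_minus_commute)
  qed
  then show "\<exists>N0. \<forall>N\<ge>N0. dist (?Y N) (x (a + t)) < \<epsilon>" by blast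
qed

text \<open>Subtracting the accumulated noise leaves a recursion of bounded growth in which the noise enters only
  through its values, not through the sum of the norms of its increments; for Brownian noise that sum
  is unbounded as the step size tends to 0.\<close>

lemma euler_norm_le:
  fixes \<xi> :: "nat \<Rightarrow> 'a::real_normed_vector"
  assumes G: "\<And>u v. norm (G u - G v) \<le> K * norm (u - v)" and K: "0 \<le> K" and h: "0 \<le> h"
  shows "norm (euler G h \<xi> y k - (\<Sum>j<k. \<xi> j)) \<le> (1 + h * K) ^ k * (norm y + h * (\<Sum>j<k. norm (G 0) + K * norm (\<Sum>i<j. \<xi> i)))"
proof (induction k)
  case (Suc k)
  define s where "s = (\<Sum>j<k. \<xi> j)"
  define v where "v = euler G h \<xi> y k - s"
  define b where "b = norm (G 0) + K * norm s"
  define r where "r = norm y + h * (\<Sum>j<k. norm (G 0) + K * norm (\<Sum>i<j. \<xi> i))"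
  have IH: "norm v \<le> (1 + h * K) ^ k * r" using Suc by (simp add: v_def s_def r_def)
  have b0: "0 \<le> b" using K by (simp add: b_def)
  have "norm (G (v + s)) \<le> norm (G (v + s) - G 0) + norm (G 0)" by (metis diff_add_cancel norm_triangle_ineq)
  also have "norm (G (v + s) - G 0) \<le> K * norm (v + s)" using G[of "v + s" 0] by simp
  also have "K * norm (v + s) \<le> K * (norm v + norm s)" using K by (intro mult_left_mono norm_triangle_ineq)
  finally have Gb: "norm (G (v + s)) \<le> K * norm v + b" by (simp add: b_def algebra_simps)
  have "euler G h \<xi> y (Suc k) - (\<Sum>j<Suc k. \<xi> j) = v + h *\<^sub>R G (v + s)"
    by (simp add: v_def s_def)
  then have "norm (euler G h \<xi> y (Suc k) - (\<Sum>j<Suc k. \<xi> j)) \<le> norm v + h * norm (G (v + s))"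
    using norm_triangle_ineq[of v "h *\<^sub>R G (v + s)"] h by simp
  also have "\<dots> \<le> norm v + h * (K * norm v + b)" using Gb h by (intro add_left_mono mult_left_mono)
  also have "\<dots> = (1 + h * K) * norm v + h * b" by (simp add: algebra_simps)
  also have "\<dots> \<le> (1 + h * K) * ((1 + h * K) ^ k * r) + (1 + h * K) ^ Suc k * (h * b)"
  proof (intro add_mono mult_left_mono IH)
    have "1 * (h * b) \<le> (1 + h * K) ^ Suc k * (h * b)"
      using h K b0 by (intro mult_right_mono one_le_power) auto
    then show "h * b \<le> (1 + h * K) ^ Suc k * (h * b)" by simp
  qed (use h K in auto)
  also have "\<dots> = (1 + h * K) ^ Suc k * (r + h * b)" by (simp add: algebra_simps)
  finally show ?case by (simp add: r_def b_def s_def algebra_simps)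
qed simp

text \<open>An additive-noise equation in a Hilbert space whose solutions stay in a closed set \<open>C\<close> on which the
  drift is dissipative. Stationarity and independence of the increments of \<open>W\<close> are stated together:
  the pair of a past variable and an increment over a time \<open>h\<close> has a product law with second factor
  \<open>\<gamma> h\<close>.\<close>

locale dissipative_additive_noise =
  fixes M :: "'w measure" and Ft :: "real \<Rightarrow> 'w measure"
    and W :: "real \<Rightarrow> 'w \<Rightarrow> 'h::{real_inner, banach, second_countable_topology}"
    and \<gamma> :: "real \<Rightarrow> 'h measure" and G :: "'h \<Rightarrow> 'h" and K c b :: real
    and C :: "'h set" and X :: "'h \<Rightarrow> real \<Rightarrow> 'w \<Rightarrow> 'h"
  assumes filtered: "filtered_prob_space M Ft"
    and noise_adapted: "\<And>t. 0 \<le> t \<Longrightarrow> W t \<in> Ft t \<rightarrow>\<^sub>M borel"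
    and noise_start: "AE w in M. W 0 w = 0"
    and increment_law: "\<And>h. 0 < h \<Longrightarrow> prob_space (\<gamma> h)" "\<And>h. 0 < h \<Longrightarrow> sets (\<gamma> h) = sets borel"
    and increment_independent: "\<And>s t (Z :: 'w \<Rightarrow> 'h). 0 \<le> s \<Longrightarrow> s < t \<Longrightarrow> Z \<in> Ft s \<rightarrow>\<^sub>M borel \<Longrightarrow>
        distr M (borel \<Otimes>\<^sub>M borel) (\<lambda>w. (Z w, W t w - W s w)) = distr M borel Z \<Otimes>\<^sub>M \<gamma> (t - s)"
    and noise_moment: "\<And>t. 0 \<le> t \<Longrightarrow> t \<le> 1 \<Longrightarrow> (\<integral>\<^sup>+w. ennreal (norm (W t w)) \<partial>M) \<le> ennreal b" "0 \<le> b"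
    and drift_lipschitz: "\<And>u v. norm (G u - G v) \<le> K * norm (u - v)" "0 \<le> K"
    and dissipative: "\<And>u v. u \<in> C \<Longrightarrow> v \<in> C \<Longrightarrow> (u - v) \<bullet> (G u - G v) \<le> - c * (norm (u - v))\<^sup>2"
    and rate: "0 < c" and state_space: "closed C" "0 \<in> C"
    and sol_adapted: "\<And>x t. x \<in> C \<Longrightarrow> 0 \<le> t \<Longrightarrow> X x t \<in> Ft t \<rightarrow>\<^sub>M restrict_space borel C"
    and sol_continuous: "\<And>x. x \<in> C \<Longrightarrow> AE w in M. continuous_on {0..} (\<lambda>t. X x t w)"
    and sol_equation: "\<And>x. x \<in> C \<Longrightarrow>
        AE w in M. \<forall>t\<ge>0. X x t w = x + integral {0..t} (\<lambda>s. G (X x s w)) + W t w"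
begin

sublocale prob_space M using filtered by (simp add: filtered_prob_space_def)

lemma filtration_measurable: "f \<in> Ft s \<rightarrow>\<^sub>M N \<Longrightarrow> f \<in> M \<rightarrow>\<^sub>M N"
  using filtered by (auto simp: filtered_prob_space_def intro: measurable_from_subalg)

lemma filtration_measurable_mono: "f \<in> Ft s \<rightarrow>\<^sub>M N \<Longrightarrow> s \<le> t \<Longrightarrow> f \<in> Ft t \<rightarrow>\<^sub>M N"
proof (rule measurable_from_subalg[rotated])
  assume st: "s \<le> t"
  interpret F: filtration "space M" Ft using filtered by (simp add: filtered_prob_space_def)
  show "subalgebra (Ft t) (Ft s)" using F.space_F F.sets_F_mono[OF st] by (simp add: subalgebra_def)
qed

lemma space_filtration: "space (Ft t) = space M"
  using filtered by (auto simp: filtered_prob_space_def subalgebra_def)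

lemma sol_borel: "x \<in> C \<Longrightarrow> 0 \<le> t \<Longrightarrow> X x t \<in> Ft t \<rightarrow>\<^sub>M borel"
  by (rule measurable_compose[OF sol_adapted measurable_ident_borel]) auto

lemma sol_in: "x \<in> C \<Longrightarrow> 0 \<le> t \<Longrightarrow> w \<in> space M \<Longrightarrow> X x t w \<in> C"
  using measurable_space[OF sol_adapted] by (simp add: space_filtration space_restrict_space)

lemma drift_continuous: "continuous_on UNIV G"
proof (rule lipschitz_on_continuous_on)
  show "K-lipschitz_on UNIV G" using drift_lipschitz by (auto simp: lipschitz_on_def dist_norm)
qed

lemma drift_borel: "G \<in> borel_measurable borel"
  by (rule borel_measurable_continuous_onI[OF drift_continuous])

lemma drift_continuous_path: "continuous_on {0..} (\<lambda>t. X x t w) \<Longrightarrow> continuous_on {0..} (\<lambda>t. G (X x t w))"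
  by (rule continuous_on_compose2[OF drift_continuous]) auto

lemma sol_contracting:
  assumes x: "x \<in> C" "y \<in> C"
  shows "AE w in M. \<forall>t\<ge>0. dist (X x t w) (X y t w) \<le> exp (- c * t) * dist x y"
  using sol_continuous[OF x(1)] sol_continuous[OF x(2)] sol_equation[OF x(1)] sol_equation[OF x(2)] AE_space
proof eventually_elim
  case (elim w)
  note gx = drift_continuous_path[OF elim(1)] and gy = drift_continuous_path[OF elim(2)]
  show ?case
  proof (intro allI impI)
    fix t :: real assume t: "0 \<le> t"
    have "norm (X x t w - X y t w) \<le> exp (- c * t) * norm (x - y)"
    proof (rule norm_contracts_if_dissipative[where u = "\<lambda>t. X x t w - X y t w" and g = "\<lambda>t. G (X x t w) - G (X y t w)"])
      fix s :: real assume s: "0 \<le> s"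
      have "integral {0..s} (\<lambda>t. G (X x t w) - G (X y t w))
          = integral {0..s} (\<lambda>t. G (X x t w)) - integral {0..s} (\<lambda>t. G (X y t w))"
        by (intro integral_diff integrable_continuous_real continuous_on_subset[OF gx] continuous_on_subset[OF gy]) auto
      then show "X x s w - X y s w = x - y + integral {0..s} (\<lambda>t. G (X x t w) - G (X y t w))"
        using elim(3,4) s by simp
      show "(X x s w - X y s w) \<bullet> (G (X x s w) - G (X y s w)) \<le> - c * (norm (X x s w - X y s w))\<^sup>2"
        by (rule dissipative[OF sol_in[OF x(1) s elim(5)] sol_in[OF x(2) s elim(5)]])
    qed (use gx gy t in \<open>auto intro!: continuous_intros\<close>)
    then show "dist (X x t w) (X y t w) \<le> exp (- c * t) * dist x y" by (simp add: dist_norm)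
  qed
qed

definition scheme :: "real \<Rightarrow> real \<Rightarrow> 'h \<Rightarrow> nat \<Rightarrow> 'w \<Rightarrow> 'h" where
  "scheme a h y k w = euler G h (\<lambda>k. W (a + real (Suc k) * h) w - W (a + real k * h) w) y k"

lemma scheme_tendsto_sol:
  assumes x: "x \<in> C" and a: "0 \<le> a" and t: "0 < t"
  shows "AE w in M. (\<lambda>N. scheme a (t / real (Suc N)) (X x a w) (Suc N) w) \<longlonglongrightarrow> X x (a + t) w"
  using sol_continuous[OF x] sol_equation[OF x]
proof eventually_elim
  case (elim w)
  note g = drift_continuous_path[OF elim(1)]
  show ?case unfolding scheme_def
  proof (rule euler_tendsto[where x = "\<lambda>t. X x t w" and W = "\<lambda>t. W t w", OF drift_lipschitz t])
    show "continuous_on {a..} (\<lambda>t. X x t w)" by (rule continuous_on_subset[OF elim(1)]) (use a in auto)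
    fix r r' assume r: "a \<le> r" "r \<le> r'"
    have "integral {0..r} (\<lambda>s. G (X x s w)) + integral {r..r'} (\<lambda>s. G (X x s w)) = integral {0..r'} (\<lambda>s. G (X x s w))"
      using a r by (intro Henstock_Kurzweil_Integration.integral_combine integrable_continuous_real continuous_on_subset[OF g]) auto
    then show "X x r' w = X x r w + integral {r..r'} (\<lambda>s. G (X x s w)) + (W r' w - W r w)"
      using elim(2)[rule_format, of r] elim(2)[rule_format, of r'] a r by (simp add: algebra_simps)
  qed
qed

lemma scheme_measurable:
  assumes Z: "Z \<in> Ft a \<rightarrow>\<^sub>M borel" and a: "0 \<le> a" and h: "0 < h"
  shows "(\<lambda>w. scheme a h (Z w) k w) \<in> Ft (a + real k * h) \<rightarrow>\<^sub>M borel"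
proof (induction k)
  case (Suc k)
  have le: "a + real k * h \<le> a + real (Suc k) * h" using h by (simp add: algebra_simps)
  have 0: "0 \<le> a + real k * h" "0 \<le> a + real (Suc k) * h" using a h by auto
  note 1 = filtration_measurable_mono[OF Suc le]
  note 2 = measurable_compose[OF 1 drift_borel]
  note 3 = noise_adapted[OF 0(2)] and 4 = filtration_measurable_mono[OF noise_adapted[OF 0(1)] le]
  show ?case using 1 2 3 4 unfolding scheme_def euler.simps by measurable
qed (use Z in \<open>simp add: scheme_def\<close>)

text \<open>The transition operator of one Euler step; it depends on the step size only.\<close>

definition step_op :: "real \<Rightarrow> ('h \<Rightarrow> real) \<Rightarrow> 'h \<Rightarrow> real" where
  "step_op h f y = (\<integral>\<xi>. f (y + h *\<^sub>R G y + \<xi>) \<partial>\<gamma> h)"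

lemma step_op_borel:
  assumes f: "f \<in> borel_measurable borel" and h: "0 < h"
  shows "step_op h f \<in> borel_measurable borel"
proof -
  interpret g: prob_space "\<gamma> h" by (rule increment_law(1)[OF h])
  have s: "sets (borel \<Otimes>\<^sub>M \<gamma> h) = sets (borel \<Otimes>\<^sub>M borel)" using increment_law(2)[OF h] by (rule sets_pair_measure_cong[OF refl])
  have "(\<lambda>p. f (fst p + h *\<^sub>R G (fst p) + snd p)) \<in> borel_measurable (borel \<Otimes>\<^sub>M borel)"
    by (rule measurable_compose[OF _ f]) (use measurable_compose[OF measurable_fst drift_borel] in measurable)
  then have "(\<lambda>p. f (fst p + h *\<^sub>R G (fst p) + snd p)) \<in> borel_measurable (borel \<Otimes>\<^sub>M \<gamma> h)"
    unfolding measurable_cong_sets[OF s refl] .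
  then show ?thesis unfolding step_op_def[abs_def]
    by (intro g.borel_measurable_lebesgue_integral) (simp add: case_prod_unfold)
qed

lemma step_op_bounded:
  assumes f: "\<And>x. \<bar>f x\<bar> \<le> B" "f \<in> borel_measurable borel" and h: "0 < h"
  shows "\<bar>step_op h f y\<bar> \<le> B"
proof -
  interpret g: prob_space "\<gamma> h" by (rule increment_law(1)[OF h])
  have "(\<lambda>\<xi>. f (y + h *\<^sub>R G y + \<xi>)) \<in> borel_measurable borel"
    by (rule measurable_compose[OF _ f(2)]) measurable
  then have m: "(\<lambda>\<xi>. f (y + h *\<^sub>R G y + \<xi>)) \<in> borel_measurable (\<gamma> h)"
    unfolding measurable_cong_sets[OF increment_law(2)[OF h] refl] .
  have "\<bar>step_op h f y\<bar> \<le> (\<integral>\<xi>. \<bar>f (y + h *\<^sub>R G y + \<xi>)\<bar> \<partial>\<gamma> h)"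
    unfolding step_op_def by (rule integral_abs_bound)
  also have "\<dots> \<le> (\<integral>\<xi>. B \<partial>\<gamma> h)"
    by (intro integral_mono integrable_abs g.integrable_const_bound[where B = B] m f) (use f order_trans[OF abs_ge_zero f(1)] in auto)
  finally show ?thesis by (simp add: g.prob_space)
qed

lemma expectation_step:
  assumes Z: "Z \<in> Ft s \<rightarrow>\<^sub>M borel" and s: "0 \<le> s" and h: "0 < h"
    and f: "f \<in> borel_measurable borel" "\<And>x. \<bar>f x\<bar> \<le> B"
  shows "expectation (\<lambda>w. f (Z w + h *\<^sub>R G (Z w) + (W (s + h) w - W s w))) = expectation (\<lambda>w. step_op h f (Z w))"
proof -
  interpret g: prob_space "\<gamma> h" by (rule increment_law(1)[OF h])
  note ZM = filtration_measurable[OF Z]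
  interpret D: prob_space "distr M borel Z" by (rule prob_space_distr[OF ZM])
  interpret P: pair_prob_space "distr M borel Z" "\<gamma> h" by unfold_locales
  have WM: "W t \<in> M \<rightarrow>\<^sub>M borel" if "0 \<le> t" for t by (rule filtration_measurable[OF noise_adapted[OF that]])
  let ?F = "\<lambda>p. f (fst p + h *\<^sub>R G (fst p) + snd p)"
  have F: "?F \<in> borel_measurable (borel \<Otimes>\<^sub>M borel)"
    by (rule measurable_compose[OF _ f(1)]) (use measurable_compose[OF measurable_fst drift_borel] in measurable)
  have [measurable]: "Z \<in> M \<rightarrow>\<^sub>M borel" "W s \<in> M \<rightarrow>\<^sub>M borel" "W (s + h) \<in> M \<rightarrow>\<^sub>M borel"
    using ZM s h by (auto intro!: WM)
  have pm: "(\<lambda>w. (Z w, W (s + h) w - W s w)) \<in> M \<rightarrow>\<^sub>M borel \<Otimes>\<^sub>M borel"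
    by measurable
  have law: "distr M (borel \<Otimes>\<^sub>M borel) (\<lambda>w. (Z w, W (s + h) w - W s w)) = distr M borel Z \<Otimes>\<^sub>M \<gamma> h"
    using increment_independent[OF s _ Z, of "s + h"] h by simp
  have sp: "sets (distr M borel Z \<Otimes>\<^sub>M \<gamma> h) = sets (borel \<Otimes>\<^sub>M borel)"
    by (rule sets_pair_measure_cong) (simp_all add: increment_law(2)[OF h])
  have Fi: "integrable (distr M borel Z \<Otimes>\<^sub>M \<gamma> h) ?F"
  proof (rule P.integrable_const_bound[where B = B])
    show "?F \<in> borel_measurable (distr M borel Z \<Otimes>\<^sub>M \<gamma> h)"
      unfolding measurable_cong_sets[OF sp refl] by (rule F)
  qed (use f in auto)
  have "expectation (\<lambda>w. f (Z w + h *\<^sub>R G (Z w) + (W (s + h) w - W s w)))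
      = (\<integral>p. ?F p \<partial>distr M (borel \<Otimes>\<^sub>M borel) (\<lambda>w. (Z w, W (s + h) w - W s w)))"
    by (subst integral_distr[OF pm F]) simp
  also have "\<dots> = (\<integral>z. \<integral>\<xi>. ?F (z, \<xi>) \<partial>\<gamma> h \<partial>distr M borel Z)"
    unfolding law by (rule P.integral_fst'[OF Fi, symmetric])
  also have "\<dots> = (\<integral>z. step_op h f z \<partial>distr M borel Z)" by (simp add: step_op_def)
  also have "\<dots> = expectation (\<lambda>w. step_op h f (Z w))"
    by (rule integral_distr[OF ZM step_op_borel[OF f(1) h]])
  finally show ?thesis .
qed

text \<open>Conditioning on the past one step at a time, starting from the last step.\<close>

lemma expectation_scheme:
  assumes Z: "Z \<in> Ft a \<rightarrow>\<^sub>M borel" and a: "0 \<le> a" and h: "0 < h"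
    and f: "f \<in> borel_measurable borel" "\<And>x. \<bar>f x\<bar> \<le> B"
  shows "expectation (\<lambda>w. f (scheme a h (Z w) k w)) = expectation (\<lambda>w. (step_op h ^^ k) f (Z w))"
  using f
proof (induction k arbitrary: f)
  case (Suc k)
  have "expectation (\<lambda>w. f (scheme a h (Z w) (Suc k) w))
      = expectation (\<lambda>w. f (scheme a h (Z w) k w + h *\<^sub>R G (scheme a h (Z w) k w)
          + (W (a + real k * h + h) w - W (a + real k * h) w)))"
    by (simp add: scheme_def algebra_simps)
  also have "\<dots> = expectation (\<lambda>w. step_op h f (scheme a h (Z w) k w))"
    by (rule expectation_step[OF scheme_measurable[OF Z a h] _ h Suc.prems]) (use a h in auto)
  also have "\<dots> = expectation (\<lambda>w. (step_op h ^^ k) (step_op h f) (Z w))"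
    by (rule Suc.IH[OF step_op_borel[OF Suc.prems(1) h] step_op_bounded[OF Suc.prems(2,1) h]])
  finally show ?case by (simp add: funpow_swap1)
qed (simp add: scheme_def)

lemma step_iterates:
  assumes f: "f \<in> borel_measurable borel" "\<And>x. \<bar>f x\<bar> \<le> B" and h: "0 < h"
  shows "(step_op h ^^ k) f \<in> borel_measurable borel" "\<bar>(step_op h ^^ k) f x\<bar> \<le> B"
proof -
  have "(step_op h ^^ k) f \<in> borel_measurable borel \<and> (\<forall>x. \<bar>(step_op h ^^ k) f x\<bar> \<le> B)"
    by (induction k) (use f h step_op_borel step_op_bounded in auto)
  then show "(step_op h ^^ k) f \<in> borel_measurable borel" "\<bar>(step_op h ^^ k) f x\<bar> \<le> B" by auto
qed

lemma sol_start:
  assumes x: "x \<in> C"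
  shows "AE w in M. X x 0 w = x"
  using noise_start sol_equation[OF x] by eventually_elim auto

lemma expectation_sol_tendsto:
  assumes x: "x \<in> C" and a: "0 \<le> a" and t: "0 < t" and f: "bounded_lipschitz f"
  shows "(\<lambda>N. expectation (\<lambda>w. (step_op (t / real (Suc N)) ^^ Suc N) f (X x a w))) \<longlonglongrightarrow> expectation (\<lambda>w. f (X x (a + t) w))"
proof -
  obtain B L where B: "\<And>x. \<bar>f x\<bar> \<le> B" using bounded_lipschitzE[OF f] by metis
  note fb = bounded_lipschitz_borel[OF f]
  have h: "0 < t / real (Suc N)" for N using t by simp
  note Z = sol_borel[OF x a]
  have m: "(\<lambda>w. f (scheme a (t / real (Suc N)) (X x a w) (Suc N) w)) \<in> borel_measurable M" for N
    by (rule measurable_compose[OF filtration_measurable[OF scheme_measurable[OF Z a h]] fb])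
  have "(\<lambda>N. expectation (\<lambda>w. f (scheme a (t / real (Suc N)) (X x a w) (Suc N) w))) \<longlonglongrightarrow> expectation (\<lambda>w. f (X x (a + t) w))"
  proof (rule integral_dominated_convergence[where w = "\<lambda>_. B"])
    show "AE w in M. (\<lambda>N. f (scheme a (t / real (Suc N)) (X x a w) (Suc N) w)) \<longlonglongrightarrow> f (X x (a + t) w)"
      using scheme_tendsto_sol[OF x a t]
    proof eventually_elim
      case (elim w)
      show ?case
        by (rule isCont_tendsto_compose[OF _ elim])
          (use bounded_lipschitz_continuous[OF f] in \<open>simp add: continuous_on_eq_continuous_at\<close>)
    qed
    show "(\<lambda>w. f (X x (a + t) w)) \<in> borel_measurable M"
      by (rule measurable_compose[OF filtration_measurable[OF sol_borel[OF x]] fb]) (use a t in auto)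
  qed (use m B in auto)
  then show ?thesis unfolding expectation_scheme[OF Z a h fb B] .
qed

text \<open>The iterated one-step operators converge to the transition operator at deterministic initial states.
  Integrating this over the law of the solution at time \<open>s\<close> and comparing with the scheme started at
  that solution identifies both sides as limits of the same sequence.\<close>

lemma sol_markov:
  assumes x: "x \<in> C" and s: "0 \<le> s" and t: "0 \<le> t" and f: "bounded_lipschitz f"
  shows "expectation (\<lambda>w. f (X x (s + t) w)) = expectation (\<lambda>w. expectation (\<lambda>w'. f (X (X x s w) t w')))"
proof (cases "t = 0")
  case True
  have "expectation (\<lambda>w'. f (X y 0 w')) = f y" if y: "y \<in> C" for y
  proof -
    have "expectation (\<lambda>w'. f (X y 0 w')) = expectation (\<lambda>w'. f y)"
    proof (rule integral_cong_AE)
      show "AE w in M. f (X y 0 w) = f y" using sol_start[OF y] by eventually_elim simp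
    qed (auto intro!: measurable_compose[OF filtration_measurable[OF sol_borel[OF y]] bounded_lipschitz_borel[OF f]])
    then show ?thesis by (simp add: prob_space)
  qed
  then show ?thesis unfolding True
    by (intro Bochner_Integration.integral_cong refl) (simp add: sol_in x s)
next
  case False
  with t have t: "0 < t" by simp
  obtain B L where B: "\<And>x. \<bar>f x\<bar> \<le> B" using bounded_lipschitzE[OF f] by metis
  note fb = bounded_lipschitz_borel[OF f]
  have h: "0 < t / real (Suc N)" for N using t by simp
  let ?u = "\<lambda>N. (step_op (t / real (Suc N)) ^^ Suc N) f"
  have um: "?u N \<in> borel_measurable borel" and ub: "\<bar>?u N x\<bar> \<le> B" for N x
    using step_iterates[OF fb B h] by blast+
  have lim: "(\<lambda>N. ?u N y) \<longlonglongrightarrow> expectation (\<lambda>w'. f (X y t w'))" if y: "y \<in> C" for y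
  proof -
    have "expectation (\<lambda>w. ?u N (X y 0 w)) = ?u N y" for N
    proof -
      have "expectation (\<lambda>w. ?u N (X y 0 w)) = expectation (\<lambda>w. ?u N y)"
      proof (rule integral_cong_AE)
        show "AE w in M. ?u N (X y 0 w) = ?u N y" using sol_start[OF y] by eventually_elim simp
      qed (use measurable_compose[OF filtration_measurable[OF sol_borel[OF y]] um] in auto)
      then show ?thesis by (simp add: prob_space)
    qed
    then show ?thesis using expectation_sol_tendsto[OF y order_refl t f] by simp
  qed
  have "(\<lambda>N. expectation (\<lambda>w. ?u N (X x s w))) \<longlonglongrightarrow> expectation (\<lambda>w. expectation (\<lambda>w'. f (X (X x s w) t w')))"
  proof (rule integral_dominated_convergence[where w = "\<lambda>_. B"])
    show m: "(\<lambda>w. ?u N (X x s w)) \<in> borel_measurable M" for N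
      by (rule measurable_compose[OF filtration_measurable[OF sol_borel[OF x s]] um])
    show "AE w in M. (\<lambda>N. ?u N (X x s w)) \<longlonglongrightarrow> expectation (\<lambda>w'. f (X (X x s w) t w'))"
      by (rule AE_I2) (rule lim[OF sol_in[OF x s]])
    show "(\<lambda>w. expectation (\<lambda>w'. f (X (X x s w) t w'))) \<in> borel_measurable M"
      by (rule borel_measurable_LIMSEQ_real[OF lim[OF sol_in[OF x s]] m])
    show "AE w in M. norm (?u N (X x s w)) \<le> B" for N by (rule AE_I2) (use ub in simp)
  qed simp
  with expectation_sol_tendsto[OF x s t f] show ?thesis by (rule LIMSEQ_unique)
qed

text \<open>The expected norms of the Euler approximations at time 1 are bounded uniformly in the step size, so
  Fatou's lemma applies to their limit.\<close>

lemma sol_first_moment: "integrable M (\<lambda>w. dist 0 (X 0 1 w))"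
proof -
  let ?h = "\<lambda>N. 1 / real (Suc N)"
  let ?Y = "\<lambda>N w. scheme 0 (?h N) (X 0 0 w) (Suc N) w"
  define k where "k = norm (G 0)"
  let ?v = "\<lambda>N j w. k + K * norm (W (real j * ?h N) w)"
  have WM: "W t \<in> M \<rightarrow>\<^sub>M borel" if "0 \<le> t" for t by (rule filtration_measurable[OF noise_adapted[OF that]])
  have XM: "X 0 t \<in> M \<rightarrow>\<^sub>M borel" if "0 \<le> t" for t by (rule filtration_measurable[OF sol_borel[OF state_space(2) that]])
  have YM: "?Y N \<in> M \<rightarrow>\<^sub>M borel" for N
    by (rule filtration_measurable[OF scheme_measurable[OF sol_borel[OF state_space(2)]]]) auto
  have bound: "(\<integral>\<^sup>+w. ennreal (norm (?Y N w)) \<partial>M) \<le> ennreal (b + exp K * (k + K * b))" for N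
  proof -
    have nn: "0 \<le> k + K * norm (W s w)" for s w using drift_lipschitz(2) by (simp add: k_def)
    have 1: "AE w in M. norm (?Y N w) \<le> norm (W 1 w) + exp K * (?h N * (\<Sum>j<Suc N. ?v N j w))"
      using sol_start[OF state_space(2)] noise_start
    proof eventually_elim
      case (elim w)
      let ?\<xi> = "\<lambda>k. W (0 + real (Suc k) * ?h N) w - W (0 + real k * ?h N) w"
      have S: "(\<Sum>i<j. ?\<xi> i) = W (real j * ?h N) w" for j
        using sum_lessThan_telescope[of "\<lambda>i. W (real i * ?h N) w" j] elim(2) by simp
      have "norm (?Y N w - W (real (Suc N) * ?h N) w)
          \<le> (1 + ?h N * K) ^ Suc N * (norm (0::'h) + ?h N * (\<Sum>j<Suc N. ?v N j w))"
        using euler_norm_le[where \<xi> = ?\<xi> and h = "?h N" and y = 0 and k = "Suc N", OF drift_lipschitz]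
        unfolding S k_def elim(1) scheme_def by simp
      also have "\<dots> \<le> exp K * (norm (0::'h) + ?h N * (\<Sum>j<Suc N. ?v N j w))"
      proof (rule mult_right_mono)
        show "(1 + ?h N * K) ^ Suc N \<le> exp K"
          using growth_factor_le_exp[of "?h N * K" "Suc N"] drift_lipschitz(2) by simp
      qed (intro add_nonneg_nonneg mult_nonneg_nonneg sum_nonneg nn norm_ge_zero, simp)
      finally show ?case
        using norm_triangle_ineq2[of "?Y N w" "W (real (Suc N) * ?h N) w"] by simp
    qed
    have kW: "(\<integral>\<^sup>+w. ennreal (k + K * norm (W s w)) \<partial>M) \<le> ennreal (k + K * b)" if s: "0 \<le> s" "s \<le> 1" for s
    proof -
      have "(\<integral>\<^sup>+w. ennreal (k + K * norm (W s w)) \<partial>M) = (\<integral>\<^sup>+w. ennreal k + ennreal K * ennreal (norm (W s w)) \<partial>M)"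
        using drift_lipschitz(2) by (intro nn_integral_cong) (simp add: ennreal_mult k_def)
      also have "\<dots> = ennreal k + ennreal K * (\<integral>\<^sup>+w. ennreal (norm (W s w)) \<partial>M)"
        using WM[OF s(1)] by (simp add: nn_integral_add nn_integral_cmult emeasure_space_1)
      also have "\<dots> \<le> ennreal k + ennreal K * ennreal b" by (intro add_left_mono mult_left_mono noise_moment s) simp
      also have "\<dots> = ennreal (k + K * b)" using drift_lipschitz(2) noise_moment(2) by (simp add: ennreal_mult k_def)
      finally show ?thesis .
    qed
    have sM: "(\<lambda>w. ?v N j w) \<in> borel_measurable M" for j
      using WM[of "real j * ?h N"] by simp
    have "(\<integral>\<^sup>+w. ennreal (norm (?Y N w)) \<partial>M)
        \<le> (\<integral>\<^sup>+w. ennreal (norm (W 1 w)) + ennreal (exp K * ?h N) * (\<Sum>j<Suc N. ennreal (?v N j w)) \<partial>M)"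
    proof (rule nn_integral_mono_AE, use 1 in eventually_elim)
      case (elim w)
      have "ennreal (norm (W 1 w) + exp K * (?h N * (\<Sum>j<Suc N. ?v N j w)))
          = ennreal (norm (W 1 w)) + ennreal (exp K * ?h N) * ennreal (\<Sum>j<Suc N. ?v N j w)"
        using nn by (simp add: ennreal_mult[symmetric] ennreal_plus[symmetric] sum_nonneg mult.assoc del: ennreal_plus sum.lessThan_Suc)
      also have "ennreal (\<Sum>j<Suc N. ?v N j w) = (\<Sum>j<Suc N. ennreal (?v N j w))"
        using nn by (intro sum_ennreal[symmetric])
      finally show ?case using ennreal_leI[OF elim] by simp
    qed
    also have "\<dots> = (\<integral>\<^sup>+w. ennreal (norm (W 1 w)) \<partial>M)
        + ennreal (exp K * ?h N) * (\<Sum>j<Suc N. \<integral>\<^sup>+w. ennreal (?v N j w) \<partial>M)"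
    proof -
      have m1: "(\<lambda>w. ennreal (?v N j w)) \<in> borel_measurable M" for j
        using sM by measurable
      have m2: "(\<lambda>w. \<Sum>j<Suc N. ennreal (?v N j w)) \<in> borel_measurable M"
        by (rule borel_measurable_sum) (rule m1)
      have m3: "(\<lambda>w. ennreal (norm (W 1 w))) \<in> borel_measurable M" using WM[of 1] by simp
      show ?thesis
        unfolding nn_integral_sum[OF m1, symmetric] nn_integral_cmult[OF m2, symmetric]
        by (rule nn_integral_add) (use m2 m3 in auto)
    qed
    also have "\<dots> \<le> ennreal b + ennreal (exp K * ?h N) * (\<Sum>j<Suc N. ennreal (k + K * b))"
    proof (intro add_mono noise_moment mult_left_mono sum_mono kW)
      fix j assume "j \<in> {..<Suc N}"
      then show "real j * ?h N \<le> 1" by (simp add: field_simps)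
    qed auto
    also have "(\<Sum>j<Suc N. ennreal (k + K * b)) = ennreal (real (Suc N)) * ennreal (k + K * b)"
      by (simp add: ennreal_of_nat_eq_real_of_nat del: of_nat_Suc)
    also have "ennreal b + ennreal (exp K * ?h N) * (ennreal (real (Suc N)) * ennreal (k + K * b))
        = ennreal (b + exp K * (k + K * b))"
      using drift_lipschitz(2) noise_moment(2)
      by (simp add: ennreal_mult[symmetric] ennreal_plus[symmetric] k_def del: ennreal_plus of_nat_Suc)
    finally show ?thesis .
  qed
  have "(\<integral>\<^sup>+w. ennreal (norm (X 0 1 w)) \<partial>M) = (\<integral>\<^sup>+w. liminf (\<lambda>N. ennreal (norm (?Y N w))) \<partial>M)"
  proof (rule nn_integral_cong_AE, use scheme_tendsto_sol[OF state_space(2) order_refl zero_less_one] in eventually_elim)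
    case (elim w)
    then have "(\<lambda>N. ennreal (norm (?Y N w))) \<longlonglongrightarrow> ennreal (norm (X 0 1 w))"
      by (intro tendsto_ennrealI tendsto_norm) simp
    from lim_imp_Liminf[OF _ this] show ?case by simp
  qed
  also have "\<dots> \<le> liminf (\<lambda>N. \<integral>\<^sup>+w. ennreal (norm (?Y N w)) \<partial>M)"
    by (rule nn_integral_liminf) (use YM in measurable)
  also have "\<dots> \<le> ennreal (b + exp K * (k + K * b))"
    using Liminf_mono[of "\<lambda>N. \<integral>\<^sup>+w. ennreal (norm (?Y N w)) \<partial>M" "\<lambda>_. ennreal (b + exp K * (k + K * b))" sequentially] bound
    by (simp add: Liminf_const)
  finally show ?thesis using XM[of 1] by (auto simp: integrable_iff_bounded dist_norm le_less_trans)
qed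

theorem sol_contracting_markov_family: "contracting_markov_family M C X c"
proof
  show "closed C" "C \<noteq> {}" "0 < c" using state_space rate by auto
  show "\<exists>x\<in>C. integrable M (\<lambda>w. dist x (X x 1 w))" using sol_first_moment state_space(2) by blast
  fix x assume x: "x \<in> C"
  show "X x t \<in> M \<rightarrow>\<^sub>M restrict_space borel C" if "0 \<le> t" for t
    by (rule filtration_measurable[OF sol_adapted[OF x that]])
  show "AE w in M. continuous_on {0..} (\<lambda>t. X x t w)" by (rule sol_continuous[OF x])
  show "AE w in M. dist (X x t w) (X y t w) \<le> exp (- c * t) * dist x y" if "y \<in> C" "0 \<le> t" for y t
    using sol_contracting[OF x that(1)] by eventually_elim (use that in simp)
  show "expectation (\<lambda>w. f (X x (s + t) w)) = expectation (\<lambda>w. expectation (\<lambda>w'. f (X (X x s w) t w')))"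
    if "0 \<le> s" "0 \<le> t" "bounded_lipschitz f" for s t f
    by (rule sol_markov[OF x that])
qed

end


section \<open>The spectral Galerkin approximation\<close>

text \<open>Independence of \<open>\<A>\<close> from the events generated by \<open>D\<close> passes to \<open>\<A>\<close>-measurable variables and
  functions of \<open>D\<close>.\<close>

lemma (in prob_space) indep_var_of_indep_set:
  assumes ind: "indep_set \<A> {D -` U \<inter> space M | U. U \<in> sets N}"
    and \<A>: "sigma_algebra (space M) \<A>" and D: "D \<in> space M \<rightarrow> space N"
    and Z: "Z \<in> M \<rightarrow>\<^sub>M S" "\<And>A. A \<in> sets S \<Longrightarrow> Z -` A \<inter> space M \<in> \<A>"
    and f: "f \<in> N \<rightarrow>\<^sub>M T"
  shows "indep_var S Z T (\<lambda>w. f (D w))"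
proof -
  have V: "sets (vimage_algebra (space M) D N) = {D -` U \<inter> space M | U. U \<in> sets N}"
    by (rule sets_vimage_algebra2[OF D])
  have ind': "\<A> \<subseteq> events" "sets (vimage_algebra (space M) D N) \<subseteq> events"
    "\<And>a b. a \<in> \<A> \<Longrightarrow> b \<in> sets (vimage_algebra (space M) D N) \<Longrightarrow> prob (a \<inter> b) = prob a * prob b"
    using ind unfolding V indep_sets2_eq by auto
  have fD: "(\<lambda>w. f (D w)) \<in> vimage_algebra (space M) D N \<rightarrow>\<^sub>M T"
    by (rule measurable_compose[OF measurable_vimage_algebra1[OF D] f])
  have fDM: "(\<lambda>w. f (D w)) \<in> M \<rightarrow>\<^sub>M T"
    by (rule measurable_from_subalg[OF _ fD]) (use ind'(2) in \<open>simp add: subalgebra_def\<close>)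
  have 1: "sigma_sets (space M) {Z -` A \<inter> space M | A. A \<in> sets S} \<subseteq> \<A>"
    by (rule sigma_algebra.sigma_sets_subset[OF \<A>]) (use Z(2) in auto)
  have 2: "sigma_sets (space M) {(\<lambda>w. f (D w)) -` A \<inter> space M | A. A \<in> sets T} \<subseteq> sets (vimage_algebra (space M) D N)"
    using sets.sigma_sets_subset[of "{(\<lambda>w. f (D w)) -` A \<inter> space M | A. A \<in> sets T}" "vimage_algebra (space M) D N"]
      measurable_sets[OF fD] by auto
  show ?thesis
    unfolding indep_var_eq indep_sets2_eq
    using Z(1) fDM 1 2 ind' by (auto 4 4)
qed

lemma galerkin_proj_linear: "linear (galerkin_proj e n)"
  by (rule linearI) (simp_all add: galerkin_proj_def inner_add_right scaleR_add_left sum.distrib scaleR_sum_right)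

lemma norm_coefficient_sum_le:
  assumes e: "\<And>i. norm (e i :: 'h::real_inner) = 1"
  shows "norm (\<Sum>i<n. (a i * (e i \<bullet> x)) *\<^sub>R e i) \<le> (\<Sum>i<n. \<bar>a i\<bar>) * norm x"
proof -
  have "norm (\<Sum>i<n. (a i * (e i \<bullet> x)) *\<^sub>R e i) \<le> (\<Sum>i<n. norm ((a i * (e i \<bullet> x)) *\<^sub>R e i))"
    by (rule norm_sum)
  also have "\<dots> \<le> (\<Sum>i<n. \<bar>a i\<bar> * norm x)"
  proof (rule sum_mono)
    fix i
    have "\<bar>e i \<bullet> x\<bar> \<le> norm x" using Cauchy_Schwarz_ineq2[of "e i" x] by (simp add: e)
    then show "norm ((a i * (e i \<bullet> x)) *\<^sub>R e i) \<le> \<bar>a i\<bar> * norm x"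
      by (simp add: e abs_mult mult_left_mono)
  qed
  finally show ?thesis by (simp add: sum_distrib_right)
qed

definition noise_coordinates ::
  "(nat \<Rightarrow> 'h::real_inner) \<Rightarrow> (nat \<Rightarrow> real) \<Rightarrow> nat \<Rightarrow> (nat \<Rightarrow> real) \<Rightarrow> 'h" where
  "noise_coordinates e q n v = (\<Sum>i<n. (sqrt (q i) * v i) *\<^sub>R e i)"

text \<open>The centred Gaussian law with independent coordinates of variance \<open>\<bar>q i\<bar> * h\<close>.\<close>

definition galerkin_increment_law ::
  "(nat \<Rightarrow> 'h::{real_inner, second_countable_topology}) \<Rightarrow> (nat \<Rightarrow> real) \<Rightarrow> nat \<Rightarrow> real \<Rightarrow> 'h measure" where
  "galerkin_increment_law e q n h =
     distr (Pi\<^sub>M {..<n} (\<lambda>_. density lborel (normal_density 0 (sqrt h)))) borel (noise_coordinates e q n)"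

lemma noise_coordinates_measurable:
  fixes e :: "nat \<Rightarrow> 'h::{real_inner, second_countable_topology}"
  assumes "{..<n} \<subseteq> I" and sets: "\<And>i. i \<in> I \<Longrightarrow> sets (N i) = sets borel"
  shows "noise_coordinates e q n \<in> Pi\<^sub>M I N \<rightarrow>\<^sub>M borel"
proof -
  have "(\<lambda>v. v i) \<in> Pi\<^sub>M I N \<rightarrow>\<^sub>M borel" if "i < n" for i
    using measurable_component_singleton[of i I N] assms that measurable_cong_sets[OF refl sets, of i]
    by (metis lessThan_iff subsetD)
  then show ?thesis unfolding noise_coordinates_def[abs_def]
    by (intro borel_measurable_sum borel_measurable_scaleR borel_measurable_times) auto
qed

lemma prob_space_galerkin_increment_law:
  assumes "0 < h"
  shows "prob_space (galerkin_increment_law e q n h)"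
  unfolding galerkin_increment_law_def
  by (intro prob_space.prob_space_distr prob_space_PiM prob_space_normal_density noise_coordinates_measurable)
    (use assms in auto)

lemma galerkin_noise_increment:
  "galerkin_noise e q B n t w - galerkin_noise e q B n s w = noise_coordinates e q n (\<lambda>i. B i t w - B i s w)"
  by (simp add: galerkin_noise_def noise_coordinates_def flip: sum_subtractf scaleR_left_diff_distrib right_diff_distrib)

text \<open>The coordinates are independent because the Brownian motions are independent as random paths, and an
  increment is a measurable function of the path.\<close>

lemma galerkin_increment_distr:
  fixes e :: "nat \<Rightarrow> 'h::{real_inner, second_countable_topology}"
  assumes M: "filtered_prob_space M Ft" and W: "cylindrical_wiener M Ft B" and n: "1 \<le> n" and st: "0 \<le> s" "s < t"
  shows "distr M borel (\<lambda>w. galerkin_noise e q B n t w - galerkin_noise e q B n s w) = galerkin_increment_law e q n (t - s)"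
proof -
  interpret prob_space M using M by (simp add: filtered_prob_space_def)
  let ?D = "\<lambda>i w. B i t w - B i s w"
  have d: "distributed M lborel (?D i) (normal_density 0 (sqrt (t - s)))" for i
    using W st by (auto simp: cylindrical_wiener_def brownian_motion_def)
  have Dm: "?D i \<in> M \<rightarrow>\<^sub>M borel" for i using distributed_measurable[OF d] by simp
  have D: "distr M borel (?D i) = density lborel (normal_density 0 (sqrt (t - s)))" for i
    using distributed_distr_eq_density[OF d, of i] by (simp cong: distr_cong)
  have "indep_vars (\<lambda>_. Pi\<^sub>M {0..} (\<lambda>_. borel)) (\<lambda>i w. \<lambda>t\<in>{0..}. B i t w) UNIV"
    using W by (simp add: cylindrical_wiener_def)
  then have "indep_vars (\<lambda>_. borel) (\<lambda>i w. (\<lambda>t\<in>{0..}. B i t w) t - (\<lambda>t\<in>{0..}. B i t w) s) UNIV"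
    by (rule indep_vars_compose2[where Y = "\<lambda>_ f. f t - f s"])
      (use st in \<open>auto intro!: borel_measurable_diff measurable_component_singleton\<close>)
  then have "indep_vars (\<lambda>_. borel) ?D UNIV" using st by simp
  then have "indep_vars (\<lambda>_. borel) ?D {..<n}" by (rule indep_vars_subset) simp
  then have joint: "distr M (Pi\<^sub>M {..<n} (\<lambda>_. borel)) (\<lambda>w. \<lambda>i\<in>{..<n}. ?D i w)
      = Pi\<^sub>M {..<n} (\<lambda>_. density lborel (normal_density 0 (sqrt (t - s))))"
    using n Dm by (subst (asm) indep_vars_iff_distr_eq_PiM) (auto simp: D lessThan_empty_iff)
  have "distr M borel (\<lambda>w. galerkin_noise e q B n t w - galerkin_noise e q B n s w)
      = distr M borel (\<lambda>w. noise_coordinates e q n (\<lambda>i\<in>{..<n}. ?D i w))"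
    unfolding galerkin_noise_increment by (simp add: noise_coordinates_def)
  also have "\<dots> = distr (distr M (Pi\<^sub>M {..<n} (\<lambda>_. borel)) (\<lambda>w. \<lambda>i\<in>{..<n}. ?D i w)) borel (noise_coordinates e q n)"
  proof (subst distr_distr)
    show "noise_coordinates e q n \<in> Pi\<^sub>M {..<n} (\<lambda>_. borel) \<rightarrow>\<^sub>M borel"
      by (rule noise_coordinates_measurable) auto
    show "(\<lambda>w. \<lambda>i\<in>{..<n}. ?D i w) \<in> M \<rightarrow>\<^sub>M Pi\<^sub>M {..<n} (\<lambda>_. borel)"
      by (rule measurable_restrict) (rule Dm)
  qed (simp add: comp_def)
  finally show ?thesis by (simp add: joint galerkin_increment_law_def)
qed

lemma galerkin_increment_independent:
  fixes e :: "nat \<Rightarrow> 'h::{real_inner, second_countable_topology}" and Z :: "'w \<Rightarrow> 'h"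
  assumes M: "filtered_prob_space M Ft" and W: "cylindrical_wiener M Ft B" and n: "1 \<le> n" and st: "0 \<le> s" "s < t"
    and Z: "Z \<in> Ft s \<rightarrow>\<^sub>M borel"
  shows "distr M (borel \<Otimes>\<^sub>M borel) (\<lambda>w. (Z w, galerkin_noise e q B n t w - galerkin_noise e q B n s w))
     = distr M borel Z \<Otimes>\<^sub>M galerkin_increment_law e q n (t - s)"
proof -
  interpret prob_space M using M by (simp add: filtered_prob_space_def)
  have sub: "subalgebra M (Ft s)" using M by (simp add: filtered_prob_space_def)
  have "indep_var borel Z borel (\<lambda>w. noise_coordinates e q n ((\<lambda>w i. B i t w - B i s w) w))"
  proof (rule indep_var_of_indep_set[where D = "\<lambda>w i. B i t w - B i s w" and N = "Pi\<^sub>M UNIV (\<lambda>_. borel)"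
        and f = "noise_coordinates e q n" and \<A> = "sets (Ft s)"])
    show "indep_set (sets (Ft s)) {(\<lambda>w i. B i t w - B i s w) -` U \<inter> space M | U. U \<in> sets (Pi\<^sub>M UNIV (\<lambda>_. borel))}"
      using W st by (simp add: cylindrical_wiener_def)
    show "sigma_algebra (space M) (sets (Ft s))"
      using sub sets.sigma_algebra_axioms[of "Ft s"] by (simp add: subalgebra_def)
    show "Z \<in> M \<rightarrow>\<^sub>M borel" by (rule measurable_from_subalg[OF sub Z])
    show "Z -` A \<inter> space M \<in> sets (Ft s)" if "A \<in> sets borel" for A
      using measurable_sets[OF Z that] sub by (simp add: subalgebra_def)
    show "noise_coordinates e q n \<in> Pi\<^sub>M UNIV (\<lambda>_. borel) \<rightarrow>\<^sub>M borel"
      by (rule noise_coordinates_measurable) auto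
  qed (simp add: space_PiM)
  then show ?thesis
    unfolding indep_var_distribution_eq galerkin_increment_distr[OF M W n st, symmetric] galerkin_noise_increment
    by simp
qed

text \<open>The absolute moment of a centred normal variable with standard deviation \<open>sqrt t\<close> is
  \<open>sqrt t * sqrt (2 / \<pi>)\<close>.\<close>

lemma brownian_first_moment:
  assumes M: "filtered_prob_space M Ft" and b: "brownian_motion M Ft \<beta>" and t: "0 \<le> t" "t \<le> 1"
  shows "(\<integral>\<^sup>+w. ennreal \<bar>\<beta> t w\<bar> \<partial>M) \<le> 1"
proof (cases "t = 0")
  case True
  have "(\<integral>\<^sup>+w. ennreal \<bar>\<beta> t w\<bar> \<partial>M) = (\<integral>\<^sup>+w. 0 \<partial>M)"
  proof (rule nn_integral_cong_AE)
    have "AE w in M. \<beta> 0 w = 0" using b by (simp add: brownian_motion_def)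
    then show "AE w in M. ennreal \<bar>\<beta> t w\<bar> = 0" by eventually_elim (simp add: True)
  qed
  then show ?thesis by simp
next
  case False
  with t have t0: "0 < t" by simp
  have d: "distributed M lborel (\<lambda>w. \<beta> t w - \<beta> 0 w) (normal_density 0 (sqrt (t - 0)))"
    using b t0 unfolding brownian_motion_def by blast
  have i: "integrable lborel (\<lambda>x. normal_density 0 (sqrt t) x * \<bar>x\<bar>)"
    using integrable_normal_moment_abs[of "sqrt t" 0 1] t0 by simp
  have "(\<integral>\<^sup>+w. ennreal \<bar>\<beta> t w\<bar> \<partial>M) = (\<integral>\<^sup>+w. ennreal \<bar>\<beta> t w - \<beta> 0 w\<bar> \<partial>M)"
  proof (rule nn_integral_cong_AE)
    have "AE w in M. \<beta> 0 w = 0" using b by (simp add: brownian_motion_def)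
    then show "AE w in M. ennreal \<bar>\<beta> t w\<bar> = ennreal \<bar>\<beta> t w - \<beta> 0 w\<bar>" by eventually_elim simp
  qed
  also have "\<dots> = (\<integral>\<^sup>+x. ennreal (normal_density 0 (sqrt t) x) * ennreal \<bar>x\<bar> \<partial>lborel)"
    by (subst distributed_nn_integral[OF d, symmetric]) auto
  also have "\<dots> = (\<integral>\<^sup>+x. ennreal (normal_density 0 (sqrt t) x * \<bar>x\<bar>) \<partial>lborel)"
    by (simp add: ennreal_mult)
  also have "\<dots> = ennreal (\<integral>x. normal_density 0 (sqrt t) x * \<bar>x\<bar> \<partial>lborel)"
    by (rule nn_integral_eq_integral[OF i]) simp
  also have "(\<integral>x. normal_density 0 (sqrt t) x * \<bar>x\<bar> \<partial>lborel) = sqrt t * sqrt (2 / pi)"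
    using integral_normal_moment_abs_odd[of "sqrt t" 0 0] t0 by simp
  finally have eq: "(\<integral>\<^sup>+w. ennreal \<bar>\<beta> t w\<bar> \<partial>M) = ennreal (sqrt t * sqrt (2 / pi))" .
  have "sqrt t * sqrt (2 / pi) \<le> 1 * 1"
    using t pi_ge_two by (intro mult_mono) auto
  then show ?thesis unfolding eq by (simp add: ennreal_le_1)
qed

lemma galerkin_noise_first_moment:
  assumes M: "filtered_prob_space M Ft" and W: "cylindrical_wiener M Ft B"
    and e: "\<And>i. norm (e i) = 1" and t: "0 \<le> t" "t \<le> 1"
  shows "(\<integral>\<^sup>+w. ennreal (norm (galerkin_noise e q B n t w)) \<partial>M) \<le> ennreal (\<Sum>i<n. \<bar>sqrt (q i)\<bar>)"
proof -
  have b: "brownian_motion M Ft (B i)" for i using W by (simp add: cylindrical_wiener_def)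
  have sub: "subalgebra M (Ft t)" using M by (simp add: filtered_prob_space_def)
  have Bm: "B i t \<in> M \<rightarrow>\<^sub>M borel" for i
    using b[of i] t by (intro measurable_from_subalg[OF sub]) (simp add: brownian_motion_def)
  have "(\<integral>\<^sup>+w. ennreal (norm (galerkin_noise e q B n t w)) \<partial>M)
      \<le> (\<integral>\<^sup>+w. (\<Sum>i<n. ennreal \<bar>sqrt (q i)\<bar> * ennreal \<bar>B i t w\<bar>) \<partial>M)"
  proof (rule nn_integral_mono)
    fix w
    have "norm (galerkin_noise e q B n t w) \<le> (\<Sum>i<n. norm ((sqrt (q i) * B i t w) *\<^sub>R e i))"
      unfolding galerkin_noise_def by (rule norm_sum)
    also have "\<dots> = (\<Sum>i<n. \<bar>sqrt (q i)\<bar> * \<bar>B i t w\<bar>)" by (simp add: e abs_mult)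
    finally have "ennreal (norm (galerkin_noise e q B n t w)) \<le> ennreal (\<Sum>i<n. \<bar>sqrt (q i)\<bar> * \<bar>B i t w\<bar>)"
      by (rule ennreal_leI)
    also have "\<dots> = (\<Sum>i<n. ennreal (\<bar>sqrt (q i)\<bar> * \<bar>B i t w\<bar>))" by (rule sum_ennreal[symmetric]) simp
    finally show "ennreal (norm (galerkin_noise e q B n t w)) \<le> (\<Sum>i<n. ennreal \<bar>sqrt (q i)\<bar> * ennreal \<bar>B i t w\<bar>)"
      by (simp add: ennreal_mult)
  qed
  also have "\<dots> = (\<Sum>i<n. ennreal \<bar>sqrt (q i)\<bar> * (\<integral>\<^sup>+w. ennreal \<bar>B i t w\<bar> \<partial>M))"
    using Bm by (simp add: nn_integral_sum nn_integral_cmult)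
  also have "\<dots> \<le> (\<Sum>i<n. ennreal \<bar>sqrt (q i)\<bar> * 1)"
    by (intro sum_mono mult_left_mono brownian_first_moment[OF M b t]) simp
  also have "\<dots> = ennreal (\<Sum>i<n. \<bar>sqrt (q i)\<bar>)" by (simp add: sum_ennreal)
  finally show ?thesis .
qed

locale galerkin_drift =
  fixes D :: "'h::{real_inner, banach} set" and A F :: "'h \<Rightarrow> 'h"
    and F1 :: "'h \<Rightarrow> 'h \<Rightarrow>\<^sub>L 'h" and F2 :: "'h \<Rightarrow> 'h \<Rightarrow>\<^sub>L ('h \<Rightarrow>\<^sub>L 'h)"
    and e :: "nat \<Rightarrow> 'h" and lam :: "nat \<Rightarrow> real" and LF L \<delta> \<eta> :: real and n :: nat
  assumes linA: "linear_on_domain D A" and basis: "spectral_basis D A e lam"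
    and nonlin: "nonlinearity e lam F F1 F2 LF L \<delta> \<eta>"
begin

abbreviation P where "P \<equiv> galerkin_proj e n"

abbreviation drift where "drift x \<equiv> A (P x) + P (F x)"

lemma inner_e: "e i \<bullet> e j = (if i = j then 1 else 0)"
  using basis by (simp add: spectral_basis_def orthonormal_basis_def)

lemma norm_e: "norm (e i) = 1"
  by (simp add: norm_eq_sqrt_inner inner_e)

lemma P_fixes: "x \<in> galerkin_space e n \<Longrightarrow> P x = x"
  unfolding galerkin_space_def
proof (induction rule: span_induct)
  case base
  show ?case
    using linear_subspace_kernel[OF linear_compose_sub[OF galerkin_proj_linear[of e n] linear_id]] by simp
next
  case (step x)
  then obtain j where j: "j < n" "x = e j" by auto
  have "P (e j) = (\<Sum>i<n. if i = j then e j else 0)"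
    unfolding galerkin_proj_def by (intro sum.cong) (auto simp: inner_e)
  then show ?case using j by simp
qed

lemma P_in: "P x \<in> galerkin_space e n"
  unfolding galerkin_space_def galerkin_proj_def by (intro span_sum span_scale span_base) auto

lemma closed_galerkin_space: "closed (galerkin_space e n)"
proof -
  have "galerkin_space e n = {x. P x = x}" using P_in P_fixes by (metis (mono_tags) Collect_cong mem_Collect_eq subsetI subset_antisym)
  moreover have "closed {x. P x = x}"
    unfolding galerkin_proj_def by (intro closed_Collect_eq continuous_intros)
  ultimately show ?thesis by simp
qed

lemma A_P: "A (P x) = (\<Sum>i<n. (- lam i * (e i \<bullet> x)) *\<^sub>R e i)"
proof -
  have D: "subspace D" and add: "\<And>x y. x \<in> D \<Longrightarrow> y \<in> D \<Longrightarrow> A (x + y) = A x + A y"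
    and scale: "\<And>c x. x \<in> D \<Longrightarrow> A (c *\<^sub>R x) = c *\<^sub>R A x"
    using linA by (auto simp: linear_on_domain_def)
  have eD: "e i \<in> D" and Ae: "A (e i) = - (lam i *\<^sub>R e i)" for i
    using basis unfolding spectral_basis_def by (auto, metis minus_minus)
  have A0: "A 0 = 0" using scale[of 0 0] subspace_0[OF D] by simp
  have "A (\<Sum>i<m. (e i \<bullet> x) *\<^sub>R e i) = (\<Sum>i<m. (- lam i * (e i \<bullet> x)) *\<^sub>R e i)" for m
  proof (induction m)
    case (Suc m)
    have "(\<Sum>i<m. (e i \<bullet> x) *\<^sub>R e i) \<in> D" by (intro subspace_sum[OF D] subspace_scale[OF D] eD)
    then show ?case using Suc add scale eD Ae subspace_scale[OF D eD] by (simp add: mult.commute)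
  qed (simp add: A0)
  then show ?thesis by (simp add: galerkin_proj_def)
qed

lemma F_lipschitz: "norm (F u - F v) \<le> L * norm (u - v)"
proof (rule differentiable_bound[where S = UNIV and f' = "\<lambda>x. blinfun_apply (F1 x)"])
  have L: "0 < L" and F1: "norm (blinfun_apply (F1 x) v) \<le> L * norm v" for x v
    using nonlin unfolding nonlinearity_def by blast+
  show "onorm (blinfun_apply (F1 x)) \<le> L" for x
    by (rule onorm_bound[OF less_imp_le[OF L] F1])
  show "(F has_derivative blinfun_apply (F1 x)) (at x within UNIV)" for x
    using nonlin unfolding nonlinearity_def by blast
qed auto

lemma A_P_diff: "A (P u) - A (P v) = (\<Sum>i<n. (- lam i * (e i \<bullet> (u - v))) *\<^sub>R e i)"
  unfolding A_P by (simp add: inner_diff_right algebra_simps flip: sum_subtractf)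

lemma drift_lipschitz: "norm (drift u - drift v) \<le> ((\<Sum>i<n. \<bar>lam i\<bar>) + real n * L) * norm (u - v)"
proof -
  have "norm (A (P u) - A (P v)) \<le> (\<Sum>i<n. \<bar>lam i\<bar>) * norm (u - v)"
    unfolding A_P_diff using norm_coefficient_sum_le[where e = e and a = "\<lambda>i. - lam i" and n = n and x = "u - v", OF norm_e] by simp
  moreover have "norm (P (F u) - P (F v)) \<le> real n * L * norm (u - v)"
  proof -
    have "norm (P (F u - F v)) \<le> real n * norm (F u - F v)"
      using norm_coefficient_sum_le[where e = e and a = "\<lambda>_. 1" and n = n and x = "F u - F v", OF norm_e] by (simp add: galerkin_proj_def)
    also have "\<dots> \<le> real n * (L * norm (u - v))" by (intro mult_left_mono F_lipschitz) simp
    finally show ?thesis by (simp add: linear_diff[OF galerkin_proj_linear] mult.assoc)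
  qed
  ultimately show ?thesis
    using norm_triangle_ineq[of "A (P u) - A (P v)" "P (F u) - P (F v)"] by (simp add: algebra_simps)
qed

text \<open>On the Galerkin space the squared norm is the sum of the squared coefficients, so the linear part is
  bounded through the smallest eigenvalue \<open>lam 0\<close>. The projection in front of the nonlinearity moves
  to the other argument of the inner product, where it acts as the identity.\<close>

lemma drift_dissipative:
  assumes u: "u \<in> galerkin_space e n" and v: "v \<in> galerkin_space e n"
  shows "(u - v) \<bullet> (drift u - drift v) \<le> - (lam 0 - LF) * (norm (u - v))\<^sup>2"
proof -
  define d where "d = u - v"
  have "d \<in> galerkin_space e n" unfolding d_def galerkin_space_def
    by (intro span_diff) (use u v in \<open>simp_all add: galerkin_space_def\<close>)
  then have Pd: "(\<Sum>i<n. (e i \<bullet> d) *\<^sub>R e i) = d" using P_fixes[of d] by (simp add: galerkin_proj_def)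
  have nd: "(norm d)\<^sup>2 = (\<Sum>i<n. (e i \<bullet> d)\<^sup>2)"
  proof -
    have "(norm d)\<^sup>2 = d \<bullet> (\<Sum>i<n. (e i \<bullet> d) *\<^sub>R e i)" by (simp add: Pd power2_norm_eq_inner)
    also have "\<dots> = (\<Sum>i<n. (e i \<bullet> d)\<^sup>2)"
      by (simp add: inner_sum_right power2_eq_square inner_commute)
    finally show ?thesis .
  qed
  have "d \<bullet> (A (P u) - A (P v)) = - (\<Sum>i<n. lam i * (e i \<bullet> d)\<^sup>2)"
    unfolding A_P_diff d_def[symmetric]
    by (simp add: inner_sum_right power2_eq_square inner_commute mult.assoc sum_negf)
  also have "\<dots> \<le> - (\<Sum>i<n. lam 0 * (e i \<bullet> d)\<^sup>2)"
    using basis by (simp add: sum_mono mult_right_mono spectral_basis_def monoD)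
  also have "\<dots> = - lam 0 * (norm d)\<^sup>2" by (simp add: nd sum_distrib_left sum_negf)
  finally have 1: "d \<bullet> (A (P u) - A (P v)) \<le> - lam 0 * (norm d)\<^sup>2" .
  have "d \<bullet> (P (F u) - P (F v)) = d \<bullet> P (F u - F v)"
    by (simp add: linear_diff[OF galerkin_proj_linear])
  also have "\<dots> = (\<Sum>i<n. (e i \<bullet> d) *\<^sub>R e i) \<bullet> (F u - F v)"
    unfolding galerkin_proj_def by (simp add: inner_sum_right inner_sum_left inner_commute mult.commute)
  also have "\<dots> \<le> LF * (norm d)\<^sup>2"
    unfolding Pd using nonlin by (simp add: d_def nonlinearity_def)
  finally have 2: "d \<bullet> (P (F u) - P (F v)) \<le> LF * (norm d)\<^sup>2" .
  have "d \<bullet> (drift u - drift v) = d \<bullet> (A (P u) - A (P v)) + d \<bullet> (P (F u) - P (F v))"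
    by (simp add: inner_diff_right inner_add_right)
  then show ?thesis using 1 2 by (simp add: d_def algebra_simps)
qed

end

theorem theorem3p4:
  fixes D :: "'h::{real_inner, banach, second_countable_topology} set"
    and A Q F :: "'h \<Rightarrow> 'h"
    and F1 :: "'h \<Rightarrow> 'h \<Rightarrow>\<^sub>L 'h" and F2 :: "'h \<Rightarrow> 'h \<Rightarrow>\<^sub>L ('h \<Rightarrow>\<^sub>L 'h)"
    and e :: "nat \<Rightarrow> 'h" and lam q :: "nat \<Rightarrow> real"
    and M :: "'w measure" and Ft :: "real \<Rightarrow> 'w measure"
    and B :: "nat \<Rightarrow> real \<Rightarrow> 'w \<Rightarrow> real"
    and \<beta> LF L \<delta> \<eta> :: real and X0 :: 'h and n :: nat
    and Xn :: "real \<Rightarrow> 'w \<Rightarrow> 'h" and X :: "'h \<Rightarrow> real \<Rightarrow> 'w \<Rightarrow> 'h"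
  assumes A: "linear_on_domain D A" "densely_defined D" "self_adjoint_on D A"
      "negative_definite_on D A" "has_compact_inverse D A"
    and basis: "spectral_basis D A e lam"
    and Q: "covariance_operator D A e Q q"
    and \<beta>: "0 < \<beta>" "\<beta> \<le> 1"
    and HS: "hilbert_schmidt e (frac_pow e lam ((\<beta> - 1) / 2) \<circ> sqrt_op e q)"
    and prob: "filtered_prob_space M Ft"
    and W: "cylindrical_wiener M Ft B"
    and X0: "X0 \<in> Hdot e lam (max (2 * \<beta>) 1)"
    and F: "nonlinearity e lam F F1 F2 LF L \<delta> \<eta>"
    and n: "n \<ge> 1"
    and Xn: "galerkin_solution M Ft A e q B F n (galerkin_proj e n X0) Xn"
    and X: "\<And>x. x \<in> galerkin_space e n \<Longrightarrow> galerkin_solution M Ft A e q B F n x (X x)"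
    and Xn_X: "Xn = X (galerkin_proj e n X0)"
  shows "\<exists>\<nu>. invariant_measure M (galerkin_borel e n) X \<nu> \<and>
             (\<forall>\<mu>. invariant_measure M (galerkin_borel e n) X \<mu> \<longrightarrow> \<mu> = \<nu>) \<and>
             ergodic M X \<nu>"
proof -
  interpret drift: galerkin_drift D A F F1 F2 e lam LF L \<delta> \<eta> n
    by unfold_locales (fact A(1) basis F)+
  let ?G = "\<lambda>x. A (galerkin_proj e n x) + galerkin_proj e n (F x)"
  let ?K = "(\<Sum>i<n. \<bar>lam i\<bar>) + real n * L"
  interpret sde: dissipative_additive_noise M Ft "galerkin_noise e q B n" "galerkin_increment_law e q n"
      ?G ?K "lam 0 - LF" "\<Sum>i<n. \<bar>sqrt (q i)\<bar>"
      "galerkin_space e n" X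
  proof (rule dissipative_additive_noise.intro)
    have bm: "brownian_motion M Ft (B i)" for i using W by (simp add: cylindrical_wiener_def)
    show "filtered_prob_space M Ft" by (rule prob)
    show "galerkin_noise e q B n t \<in> Ft t \<rightarrow>\<^sub>M borel" if "0 \<le> t" for t
      unfolding galerkin_noise_def[abs_def] using bm that
      by (intro borel_measurable_sum borel_measurable_scaleR borel_measurable_times) (auto simp: brownian_motion_def)
    have "AE w in M. \<forall>i. B i 0 w = 0" using bm by (simp add: AE_all_countable brownian_motion_def)
    then show "AE w in M. galerkin_noise e q B n 0 w = 0"
      by eventually_elim (simp add: galerkin_noise_def)
    show "prob_space (galerkin_increment_law e q n h)" if "0 < h" for h
      by (rule prob_space_galerkin_increment_law[OF that])
    show "sets (galerkin_increment_law e q n h) = sets borel" for h by (simp add: galerkin_increment_law_def)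
    show "distr M (borel \<Otimes>\<^sub>M borel) (\<lambda>w. (Z w, galerkin_noise e q B n t w - galerkin_noise e q B n s w))
        = distr M borel Z \<Otimes>\<^sub>M galerkin_increment_law e q n (t - s)"
      if "0 \<le> s" "s < t" "Z \<in> Ft s \<rightarrow>\<^sub>M borel" for s t and Z :: "'w \<Rightarrow> 'h"
      by (rule galerkin_increment_independent[OF prob W n that])
    show "(\<integral>\<^sup>+w. ennreal (norm (galerkin_noise e q B n t w)) \<partial>M) \<le> ennreal (\<Sum>i<n. \<bar>sqrt (q i)\<bar>)"
      if "0 \<le> t" "t \<le> 1" for t
      by (rule galerkin_noise_first_moment[OF prob W drift.norm_e that])
    show "0 \<le> (\<Sum>i<n. \<bar>sqrt (q i)\<bar>)" by (rule sum_nonneg) simp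
    show "norm (?G u - ?G v)
        \<le> ?K * norm (u - v)" for u v
      by (rule drift.drift_lipschitz)
    show "0 \<le> ?K" using F by (auto simp: nonlinearity_def intro!: add_nonneg_nonneg sum_nonneg mult_nonneg_nonneg)
    show "(u - v) \<bullet> (?G u - ?G v)
        \<le> - (lam 0 - LF) * (norm (u - v))\<^sup>2" if "u \<in> galerkin_space e n" "v \<in> galerkin_space e n" for u v
      by (rule drift.drift_dissipative[OF that])
    show "0 < lam 0 - LF" using F by (simp add: nonlinearity_def)
    show "closed (galerkin_space e n)" by (rule drift.closed_galerkin_space)
    show "0 \<in> galerkin_space e n" by (simp add: galerkin_space_def span_zero)
    fix x assume "x \<in> galerkin_space e n"
    note sol = X[OF this, unfolded galerkin_solution_def galerkin_borel_def]
    show "X x t \<in> Ft t \<rightarrow>\<^sub>M restrict_space borel (galerkin_space e n)" if "0 \<le> t" for t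
      using sol that by blast
    show "AE w in M. continuous_on {0..} (\<lambda>t. X x t w)" using sol by blast
    show "AE w in M. \<forall>t\<ge>0. X x t w = x +
        integral {0..t} (\<lambda>s. A (galerkin_proj e n (X x s w)) + galerkin_proj e n (F (X x s w))) +
        galerkin_noise e q B n t w" using sol by blast
  qed
  interpret contracting_markov_family M "galerkin_space e n" X "lam 0 - LF"
    by (rule sde.sol_contracting_markov_family)
  show ?thesis unfolding galerkin_borel_def by (rule exists_unique_ergodic_invariant_measure)
qed

end
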